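(* Let $k$ be a field, let $n\ge 0$, and let $A=A_0\oplus A_1\oplus\cdots\oplus A_n$ and $B=B_0\oplus B_1\oplus\cdots\oplus B_n$ be finite-dimensional graded $k$-algebras. Let $M\in \mathrm G_n(A\otimes_k B^{\mathrm{op}})$ and $N\in \mathrm G_n(B\otimes_k A^{\mathrm{op}})$. Suppose that $M$ and $N$ induce a graded stable equivalence of Morita type between $A$ and $B$. Then there is a stable equivalence of Morita type between the Beilinson-Green algebras $\bar A$ and $\bar B$.
   Context: Here a graded algebra $A=A_0\oplus\cdots\oplus A_n$ has multiplication $A_i\otimes A_j\to A_{i+j}$ if $i+j\le n$, and $A_iA_j=0$ if $i+j>n$. A graded module $M$ has degree $\le n$ if $M_i=0$ for $i\ge n+1$; $\mathrm G_n(C)$ denotes the category of graded $C$-modules of degree $\le n$ with degree-zero maps. All modules are finitely generated; modules over $A\otimes_kB^{\mathrm{op}}$ are viewed as $A$-$B$-bimodules. The Beilinson-Green algebra of $A$ is the upper triangular matrix algebra $$\bar A=\begin{pmatrix}A_0&A_1&\cdots&A_{n-1}&A_n\\0&A_0&\cdots&A_{n-2}&A_{n-1}\\ \vdots&\vdots&&\vdots&\vdots\\0&0&\cdots&A_0&A_1\\0&0&\cdots&0&A_0\end{pmatrix},$$ with $(i,j)$ entry in $A_{j-i}$ for $0\le i\le j\le n$ and matrix multiplication induced by that of $A$; $\bar B$ is defined in the same way. $M$ and $N$ induce a graded stable equivalence of Morita type between $A$ and $B$ if (1) $M$ is graded projective as a left $A$-module and as a right $B$-module, and $N$ is graded projective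 as a left $B$-module and as a right $A$-module; (2) $M\otimes_BN\simeq A\oplus P$ as graded $A$-$A$-bimodules for some graded projective $A$-$A$-bimodule $P$, and $N\otimes_AM\simeq B\oplus Q$ as graded $B$-$B$-bimodules for some graded projective $B$-$B$-bimodule $Q$. Stable equivalence of Morita type between (ungraded) algebras $C$ and $D$: there are bimodules ${}_CU_D$ and ${}_DV_C$, projective as one-sided modules on both sides, such that $U\otimes_DV\simeq C\oplus P'$ as $C$-$C$-bimodules and $V\otimes_CU\simeq D\oplus Q'$ as $D$-$D$-bimodules for some projective bimodules $P'$ and $Q'$. *)

theory Defs
  imports "HOL-Algebra.Module" "HOL-Algebra.Generated_Groups" "HOL-Algebra.Free_Abelian_Groups"
begin

section \<open>Finite-dimensional algebras and bimodules\<close>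

text \<open>The locale \<open>algebra\<close> of the library is restricted to commutative rings, so associative
  unital algebras over \<open>K\<close> are defined here, on the same record type.\<close>

definition fin_dim :: "('k, 'x) ring_scheme \<Rightarrow> ('k, 'a, 'y) module_scheme \<Rightarrow> bool" where
  "fin_dim K V \<longleftrightarrow> (\<exists>S. finite S \<and> S \<subseteq> carrier V \<and>
     (\<forall>v\<in>carrier V. \<exists>c\<in>S \<rightarrow> carrier K. v = (\<Oplus>\<^bsub>V\<^esub>s\<in>S. c s \<odot>\<^bsub>V\<^esub> s)))"

locale fd_algebra = module K A + A?: ring A
  for K :: "('k, 'x) ring_scheme" and A :: "('k, 'a) module" +
  assumes smult_mult_left:
      "\<lbrakk>c \<in> carrier K; a \<in> carrier A; b \<in> carrier A\<rbrakk> \<Longrightarrow>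
        (c \<odot>\<^bsub>A\<^esub> a) \<otimes>\<^bsub>A\<^esub> b = c \<odot>\<^bsub>A\<^esub> (a \<otimes>\<^bsub>A\<^esub> b)"
    and smult_mult_right:
      "\<lbrakk>c \<in> carrier K; a \<in> carrier A; b \<in> carrier A\<rbrakk> \<Longrightarrow>
        a \<otimes>\<^bsub>A\<^esub> (c \<odot>\<^bsub>A\<^esub> b) = c \<odot>\<^bsub>A\<^esub> (a \<otimes>\<^bsub>A\<^esub> b)"
    and fin_dim: "fin_dim K A"

text \<open>As for the record \<open>module\<close> of the library, the fields \<open>mult\<close> and \<open>one\<close> of a bimodule
  carry no meaning.\<close>

record ('k, 'a, 'b, 'm) bimodule = "('k, 'm) module" +
  lact :: "'a \<Rightarrow> 'm \<Rightarrow> 'm"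
  ract :: "'m \<Rightarrow> 'b \<Rightarrow> 'm"

text \<open>The last two axioms say that both actions are \<open>K\<close>-bilinear for the same \<open>K\<close>-structure of
  \<open>M\<close>, i.e. that \<open>M\<close> is a left module over the tensor product over \<open>K\<close> of \<open>A\<close> and the opposite
  algebra of \<open>B\<close>.\<close>

locale bimodule = module K M
  for K :: "('k, 'x) ring_scheme" and A :: "('k, 'a) module" and B :: "('k, 'b) module"
    and M :: "('k, 'a, 'b, 'm) bimodule" +
  assumes lact_closed: "\<lbrakk>a \<in> carrier A; x \<in> carrier M\<rbrakk> \<Longrightarrow> lact M a x \<in> carrier M"
    and ract_closed: "\<lbrakk>x \<in> carrier M; b \<in> carrier B\<rbrakk> \<Longrightarrow> ract M x b \<in> carrier M"
    and lact_one: "x \<in> carrier M \<Longrightarrow> lact M \<one>\<^bsub>A\<^esub> x = x"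
    and ract_one: "x \<in> carrier M \<Longrightarrow> ract M x \<one>\<^bsub>B\<^esub> = x"
    and lact_add_left: "\<lbrakk>a \<in> carrier A; a' \<in> carrier A; x \<in> carrier M\<rbrakk> \<Longrightarrow>
          lact M (a \<oplus>\<^bsub>A\<^esub> a') x = lact M a x \<oplus>\<^bsub>M\<^esub> lact M a' x"
    and lact_add_right: "\<lbrakk>a \<in> carrier A; x \<in> carrier M; y \<in> carrier M\<rbrakk> \<Longrightarrow>
          lact M a (x \<oplus>\<^bsub>M\<^esub> y) = lact M a x \<oplus>\<^bsub>M\<^esub> lact M a y"
    and ract_add_left: "\<lbrakk>x \<in> carrier M; y \<in> carrier M; b \<in> carrier B\<rbrakk> \<Longrightarrow>
          ract M (x \<oplus>\<^bsub>M\<^esub> y) b = ract M x b \<oplus>\<^bsub>M\<^esub> ract M y b"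
    and ract_add_right: "\<lbrakk>x \<in> carrier M; b \<in> carrier B; b' \<in> carrier B\<rbrakk> \<Longrightarrow>
          ract M x (b \<oplus>\<^bsub>B\<^esub> b') = ract M x b \<oplus>\<^bsub>M\<^esub> ract M x b'"
    and lact_mult: "\<lbrakk>a \<in> carrier A; a' \<in> carrier A; x \<in> carrier M\<rbrakk> \<Longrightarrow>
          lact M (a \<otimes>\<^bsub>A\<^esub> a') x = lact M a (lact M a' x)"
    and ract_mult: "\<lbrakk>x \<in> carrier M; b \<in> carrier B; b' \<in> carrier B\<rbrakk> \<Longrightarrow>
          ract M x (b \<otimes>\<^bsub>B\<^esub> b') = ract M (ract M x b) b'"
    and lact_ract: "\<lbrakk>a \<in> carrier A; x \<in> carrier M; b \<in> carrier B\<rbrakk> \<Longrightarrow>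
          ract M (lact M a x) b = lact M a (ract M x b)"
    and lact_smult: "\<lbrakk>c \<in> carrier K; a \<in> carrier A; x \<in> carrier M\<rbrakk> \<Longrightarrow>
          lact M (c \<odot>\<^bsub>A\<^esub> a) x = c \<odot>\<^bsub>M\<^esub> lact M a x \<and>
          lact M a (c \<odot>\<^bsub>M\<^esub> x) = c \<odot>\<^bsub>M\<^esub> lact M a x"
    and ract_smult: "\<lbrakk>c \<in> carrier K; x \<in> carrier M; b \<in> carrier B\<rbrakk> \<Longrightarrow>
          ract M x (c \<odot>\<^bsub>B\<^esub> b) = c \<odot>\<^bsub>M\<^esub> ract M x b \<and>
          ract M (c \<odot>\<^bsub>M\<^esub> x) b = c \<odot>\<^bsub>M\<^esub> ract M x b"

text \<open>Since units act as identities, a map that is linear for the actions of \<open>K\<close>-algebras is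
  \<open>K\<close>-linear.  Only the carriers of \<open>A\<close> and \<open>B\<close> matter, so that one of them may be \<open>K\<close> itself.\<close>

definition bihom ::
  "('a, 'y) partial_object_scheme \<Rightarrow> ('b, 'z) partial_object_scheme \<Rightarrow>
    ('k, 'a, 'b, 'm) bimodule \<Rightarrow> ('k, 'a, 'b, 'n) bimodule \<Rightarrow> ('m \<Rightarrow> 'n) set" where
  "bihom A B X Y = {f \<in> hom (add_monoid X) (add_monoid Y).
     (\<forall>a\<in>carrier A. \<forall>x\<in>carrier X. f (lact X a x) = lact Y a (f x)) \<and>
     (\<forall>x\<in>carrier X. \<forall>b\<in>carrier B. f (ract X x b) = ract Y (f x) b)}"

definition biiso ::
  "('a, 'y) partial_object_scheme \<Rightarrow> ('b, 'z) partial_object_scheme \<Rightarrow>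
    ('k, 'a, 'b, 'm) bimodule \<Rightarrow> ('k, 'a, 'b, 'n) bimodule \<Rightarrow> ('m \<Rightarrow> 'n) set" where
  "biiso A B X Y = {f \<in> bihom A B X Y. bij_betw f (carrier X) (carrier Y)}"

definition regular :: "('k, 'a) module \<Rightarrow> ('k, 'a, 'a, 'a) bimodule" where
  "regular A = \<lparr>carrier = carrier A, monoid.mult = undefined, one = undefined,
     ring.zero = \<zero>\<^bsub>A\<^esub>, add = add A, smult = smult A, lact = monoid.mult A, ract = monoid.mult A\<rparr>"

text \<open>Left \<open>A\<close>-modules are encoded as \<open>A\<close>-\<open>K\<close>-bimodules and right \<open>B\<close>-modules as
  \<open>K\<close>-\<open>B\<close>-bimodules; the following maps forget one of the two actions.\<close>

definition as_left :: "('k, 'a, 'b, 'm) bimodule \<Rightarrow> ('k, 'a, 'k, 'm) bimodule" where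
  "as_left M = \<lparr>carrier = carrier M, monoid.mult = undefined, one = undefined,
     ring.zero = \<zero>\<^bsub>M\<^esub>, add = add M, smult = smult M,
     lact = lact M, ract = (\<lambda>x c. c \<odot>\<^bsub>M\<^esub> x)\<rparr>"

definition as_right :: "('k, 'a, 'b, 'm) bimodule \<Rightarrow> ('k, 'k, 'b, 'm) bimodule" where
  "as_right M = \<lparr>carrier = carrier M, monoid.mult = undefined, one = undefined,
     ring.zero = \<zero>\<^bsub>M\<^esub>, add = add M, smult = smult M,
     lact = smult M, ract = ract M\<rparr>"

definition dsum ::
  "('k, 'a, 'b, 'm) bimodule \<Rightarrow> ('k, 'a, 'b, 'n) bimodule \<Rightarrow> ('k, 'a, 'b, 'm \<times> 'n) bimodule" where
  "dsum X Y = \<lparr>carrier = carrier X \<times> carrier Y, monoid.mult = undefined, one = undefined,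
     ring.zero = (\<zero>\<^bsub>X\<^esub>, \<zero>\<^bsub>Y\<^esub>),
     add = (\<lambda>(x, y) (x', y'). (x \<oplus>\<^bsub>X\<^esub> x', y \<oplus>\<^bsub>Y\<^esub> y')),
     smult = (\<lambda>c (x, y). (c \<odot>\<^bsub>X\<^esub> x, c \<odot>\<^bsub>Y\<^esub> y)),
     lact = (\<lambda>a (x, y). (lact X a x, lact Y a y)),
     ract = (\<lambda>(x, y) b. (ract X x b, ract Y y b))\<rparr>"

definition copies :: "nat \<Rightarrow> ('k, 'a, 'b, 'g) bimodule \<Rightarrow> ('k, 'a, 'b, nat \<Rightarrow> 'g) bimodule" where
  "copies m G = \<lparr>carrier = {..<m} \<rightarrow>\<^sub>E carrier G, monoid.mult = undefined, one = undefined,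
     ring.zero = (\<lambda>i\<in>{..<m}. \<zero>\<^bsub>G\<^esub>),
     add = (\<lambda>x y. \<lambda>i\<in>{..<m}. x i \<oplus>\<^bsub>G\<^esub> y i),
     smult = (\<lambda>c x. \<lambda>i\<in>{..<m}. c \<odot>\<^bsub>G\<^esub> x i),
     lact = (\<lambda>a x. \<lambda>i\<in>{..<m}. lact G a (x i)),
     ract = (\<lambda>x b. \<lambda>i\<in>{..<m}. ract G (x i) b)\<rparr>"


section \<open>Tensor products of bimodules\<close>

text \<open>The tensor product of \<open>M\<close> and \<open>N\<close> over \<open>R\<close> is the free abelian group on pairs modulo
  the subgroup generated by the biadditivity and balancing relations.\<close>

definition tensor_rels ::
  "('b, 'z) partial_object_scheme \<Rightarrow> ('k, 'a, 'b, 'm) bimodule \<Rightarrow> ('k, 'b, 'c, 'n) bimodule \<Rightarrow>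
    ('m \<times> 'n \<Rightarrow>\<^sub>0 int) set" where
  "tensor_rels R M N =
     {frag_of (x \<oplus>\<^bsub>M\<^esub> x', y) - frag_of (x, y) - frag_of (x', y) | x x' y.
        x \<in> carrier M \<and> x' \<in> carrier M \<and> y \<in> carrier N} \<union>
     {frag_of (x, y \<oplus>\<^bsub>N\<^esub> y') - frag_of (x, y) - frag_of (x, y') | x y y'.
        x \<in> carrier M \<and> y \<in> carrier N \<and> y' \<in> carrier N} \<union>
     {frag_of (ract M x r, y) - frag_of (x, lact N r y) | x r y.
        x \<in> carrier M \<and> r \<in> carrier R \<and> y \<in> carrier N}"

definition tensor_pairs ::
  "('k, 'a, 'b, 'm) bimodule \<Rightarrow> ('k, 'b, 'c, 'n) bimodule \<Rightarrow> ('m \<times> 'n \<Rightarrow>\<^sub>0 int) monoid" where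
  "tensor_pairs M N = free_Abelian_group (carrier M \<times> carrier N)"

definition tensor_ker ::
  "('b, 'z) partial_object_scheme \<Rightarrow> ('k, 'a, 'b, 'm) bimodule \<Rightarrow> ('k, 'b, 'c, 'n) bimodule \<Rightarrow>
    ('m \<times> 'n \<Rightarrow>\<^sub>0 int) set" where
  "tensor_ker R M N = generate (tensor_pairs M N) (tensor_rels R M N)"

text \<open>The map that \<open>(x, y) \<mapsto> (f x, g y)\<close> induces on cosets; it is well defined on the tensor
  product for the maps used in \<open>tensor\<close>, the union below being one of equal cosets.\<close>

definition tensor_map ::
  "('b, 'z) partial_object_scheme \<Rightarrow> ('k, 'a, 'b, 'm) bimodule \<Rightarrow> ('k, 'b, 'c, 'n) bimodule \<Rightarrow>
    ('m \<Rightarrow> 'm) \<Rightarrow> ('n \<Rightarrow> 'n) \<Rightarrow> ('m \<times> 'n \<Rightarrow>\<^sub>0 int) set \<Rightarrow> ('m \<times> 'n \<Rightarrow>\<^sub>0 int) set" where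
  "tensor_map R M N f g T =
     (\<Union>t\<in>T. tensor_ker R M N #>\<^bsub>tensor_pairs M N\<^esub> frag_extend (\<lambda>(x, y). frag_of (f x, g y)) t)"

definition tensor ::
  "('b, 'z) partial_object_scheme \<Rightarrow> ('k, 'a, 'b, 'm) bimodule \<Rightarrow> ('k, 'b, 'c, 'n) bimodule \<Rightarrow>
    ('k, 'a, 'c, ('m \<times> 'n \<Rightarrow>\<^sub>0 int) set) bimodule" where
  "tensor R M N = (let Q = tensor_pairs M N Mod tensor_ker R M N in
     \<lparr>carrier = carrier Q, monoid.mult = undefined, one = undefined,
      ring.zero = \<one>\<^bsub>Q\<^esub>, add = monoid.mult Q,
      smult = (\<lambda>c. tensor_map R M N (\<lambda>x. c \<odot>\<^bsub>M\<^esub> x) (\<lambda>y. y)),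
      lact = (\<lambda>a. tensor_map R M N (lact M a) (\<lambda>y. y)),
      ract = (\<lambda>T b. tensor_map R M N (\<lambda>x. x) (\<lambda>y. ract N y b) T)\<rparr>)"

definition pure_tensor ::
  "('b, 'z) partial_object_scheme \<Rightarrow> ('k, 'a, 'b, 'm) bimodule \<Rightarrow> ('k, 'b, 'c, 'n) bimodule \<Rightarrow>
    'm \<Rightarrow> 'n \<Rightarrow> ('m \<times> 'n \<Rightarrow>\<^sub>0 int) set" where
  "pure_tensor R M N x y = tensor_ker R M N #>\<^bsub>tensor_pairs M N\<^esub> frag_of (x, y)"

text \<open>The free \<open>A\<close>-\<open>B\<close>-bimodule of rank one: the tensor product over \<open>K\<close> of \<open>A\<close> and \<open>B\<close>.\<close>

definition free_bimodule ::
  "('k, 'x) ring_scheme \<Rightarrow> ('k, 'a) module \<Rightarrow> ('k, 'b) module \<Rightarrow>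
    ('k, 'a, 'b, ('a \<times> 'b \<Rightarrow>\<^sub>0 int) set) bimodule" where
  "free_bimodule K A B = tensor K (as_left (regular A)) (as_right (regular B))"


section \<open>Projective bimodules and stable equivalences of Morita type\<close>

text \<open>A finitely generated projective module is a direct summand of a free module of finite rank.
  The following predicate is applied to the three kinds of free modules of rank one.\<close>

definition summand_of_copies ::
  "('a, 'y) partial_object_scheme \<Rightarrow> ('b, 'z) partial_object_scheme \<Rightarrow>
    ('k, 'a, 'b, 'g) bimodule \<Rightarrow> ('k, 'a, 'b, 'm) bimodule \<Rightarrow> bool" where
  "summand_of_copies A B G X \<longleftrightarrow>
     (\<exists>m. \<exists>\<iota>\<in>bihom A B X (copies m G). \<exists>\<pi>\<in>bihom A B (copies m G) X.
        \<forall>x\<in>carrier X. \<pi> (\<iota> x) = x)"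

definition left_projective ::
  "('k, 'x) ring_scheme \<Rightarrow> ('k, 'a) module \<Rightarrow> ('k, 'a, 'b, 'm) bimodule \<Rightarrow> bool" where
  "left_projective K A M \<longleftrightarrow> summand_of_copies A K (as_left (regular A)) (as_left M)"

definition right_projective ::
  "('k, 'x) ring_scheme \<Rightarrow> ('k, 'b) module \<Rightarrow> ('k, 'a, 'b, 'm) bimodule \<Rightarrow> bool" where
  "right_projective K B M \<longleftrightarrow> summand_of_copies K B (as_right (regular B)) (as_right M)"

definition projective_bimodule ::
  "('k, 'x) ring_scheme \<Rightarrow> ('k, 'a) module \<Rightarrow> ('k, 'b) module \<Rightarrow>
    ('k, 'a, 'b, 'm) bimodule \<Rightarrow> bool" where
  "projective_bimodule K A B P \<longleftrightarrow>
     bimodule K A B P \<and> summand_of_copies A B (free_bimodule K A B) P"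

text \<open>Finitely generated bimodules over finite-dimensional algebras are finite-dimensional, hence
  each of them is isomorphic to one with carrier inside \<open>nat \<Rightarrow> 'k\<close> (coordinate vectors).
  Bimodules that are only asserted to exist can therefore be taken over that type.\<close>

definition induce_stable_equivalence ::
  "('k, 'x) ring_scheme \<Rightarrow> ('k, 'c) module \<Rightarrow> ('k, 'd) module \<Rightarrow>
    ('k, 'c, 'd, 'm) bimodule \<Rightarrow> ('k, 'd, 'c, 'n) bimodule \<Rightarrow> bool" where
  "induce_stable_equivalence K C D U V \<longleftrightarrow>
     bimodule K C D U \<and> bimodule K D C V \<and>
     left_projective K C U \<and> right_projective K D U \<and>
     left_projective K D V \<and> right_projective K C V \<and>
     (\<exists>P :: ('k, 'c, 'c, nat \<Rightarrow> 'k) bimodule. projective_bimodule K C C P \<and>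
        biiso C C (tensor D U V) (dsum (regular C) P) \<noteq> {}) \<and>
     (\<exists>Q :: ('k, 'd, 'd, nat \<Rightarrow> 'k) bimodule. projective_bimodule K D D Q \<and>
        biiso D D (tensor C V U) (dsum (regular D) Q) \<noteq> {})"

definition stable_equivalence_Morita_type ::
  "('k, 'x) ring_scheme \<Rightarrow> ('k, 'c) module \<Rightarrow> ('k, 'd) module \<Rightarrow> bool" where
  "stable_equivalence_Morita_type K C D \<longleftrightarrow>
     fd_algebra K C \<and> fd_algebra K D \<and>
     (\<exists>(U :: ('k, 'c, 'd, nat \<Rightarrow> 'k) bimodule) (V :: ('k, 'd, 'c, nat \<Rightarrow> 'k) bimodule).
        induce_stable_equivalence K C D U V)"


section \<open>Gradings\<close>

text \<open>Gradings are indexed by the natural numbers: a graded module has no components of negative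
  degree.  The family \<open>g\<close> lists the homogeneous components.\<close>

definition grading :: "('k, 'x) ring_scheme \<Rightarrow> ('k, 'v, 'z) module_scheme \<Rightarrow> (nat \<Rightarrow> 'v set) \<Rightarrow> bool"
  where
  "grading K V g \<longleftrightarrow> (\<forall>i. submodule (g i) K V) \<and>
     (\<forall>v\<in>carrier V. \<exists>!x. (\<forall>i. x i \<in> g i) \<and> finite {i. x i \<noteq> \<zero>\<^bsub>V\<^esub>} \<and>
        v = (\<Oplus>\<^bsub>V\<^esub>i\<in>{i. x i \<noteq> \<zero>\<^bsub>V\<^esub>}. x i))"

definition degree_le :: "nat \<Rightarrow> ('v, 'z) ring_scheme \<Rightarrow> (nat \<Rightarrow> 'v set) \<Rightarrow> bool" where
  "degree_le n V g \<longleftrightarrow> (\<forall>i>n. g i = {\<zero>\<^bsub>V\<^esub>})"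

definition graded_algebra ::
  "('k, 'x) ring_scheme \<Rightarrow> nat \<Rightarrow> ('k, 'a) module \<Rightarrow> (nat \<Rightarrow> 'a set) \<Rightarrow> bool" where
  "graded_algebra K n A gA \<longleftrightarrow> fd_algebra K A \<and> grading K A gA \<and> degree_le n A gA \<and>
     (\<forall>i j. \<forall>a\<in>gA i. \<forall>b\<in>gA j. a \<otimes>\<^bsub>A\<^esub> b \<in> gA (i + j))"

definition graded_bimodule ::
  "('k, 'x) ring_scheme \<Rightarrow> ('k, 'a) module \<Rightarrow> (nat \<Rightarrow> 'a set) \<Rightarrow> ('k, 'b) module \<Rightarrow>
    (nat \<Rightarrow> 'b set) \<Rightarrow> ('k, 'a, 'b, 'm) bimodule \<Rightarrow> (nat \<Rightarrow> 'm set) \<Rightarrow> bool" where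
  "graded_bimodule K A gA B gB M gM \<longleftrightarrow> bimodule K A B M \<and> grading K M gM \<and>
     (\<forall>i j. \<forall>a\<in>gA i. \<forall>x\<in>gM j. lact M a x \<in> gM (i + j)) \<and>
     (\<forall>i j. \<forall>x\<in>gM i. \<forall>b\<in>gB j. ract M x b \<in> gM (i + j))"

definition graded_bihom ::
  "('a, 'y) partial_object_scheme \<Rightarrow> ('b, 'z) partial_object_scheme \<Rightarrow>
    ('k, 'a, 'b, 'm) bimodule \<Rightarrow> (nat \<Rightarrow> 'm set) \<Rightarrow>
    ('k, 'a, 'b, 'n) bimodule \<Rightarrow> (nat \<Rightarrow> 'n set) \<Rightarrow> ('m \<Rightarrow> 'n) set" where
  "graded_bihom A B X gX Y gY = {f \<in> bihom A B X Y. \<forall>d. f ` gX d \<subseteq> gY d}"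

definition graded_biiso ::
  "('a, 'y) partial_object_scheme \<Rightarrow> ('b, 'z) partial_object_scheme \<Rightarrow>
    ('k, 'a, 'b, 'm) bimodule \<Rightarrow> (nat \<Rightarrow> 'm set) \<Rightarrow>
    ('k, 'a, 'b, 'n) bimodule \<Rightarrow> (nat \<Rightarrow> 'n set) \<Rightarrow> ('m \<Rightarrow> 'n) set" where
  "graded_biiso A B X gX Y gY = {f \<in> biiso A B X Y. \<forall>d. f ` gX d = gY d}"

definition dsum_grade :: "(nat \<Rightarrow> 'm set) \<Rightarrow> (nat \<Rightarrow> 'n set) \<Rightarrow> nat \<Rightarrow> ('m \<times> 'n) set" where
  "dsum_grade gX gY d = gX d \<times> gY d"

definition tensor_grade ::
  "('b, 'z) partial_object_scheme \<Rightarrow> ('k, 'a, 'b, 'm) bimodule \<Rightarrow> (nat \<Rightarrow> 'm set) \<Rightarrow>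
    ('k, 'b, 'c, 'n) bimodule \<Rightarrow> (nat \<Rightarrow> 'n set) \<Rightarrow> nat \<Rightarrow> ('m \<times> 'n \<Rightarrow>\<^sub>0 int) set set" where
  "tensor_grade R M gM N gN d = generate (add_monoid (tensor R M N))
     {pure_tensor R M N x y | x y i j. x \<in> gM i \<and> y \<in> gN j \<and> i + j = d}"

text \<open>The \<open>i\<close>-th copy of \<open>G\<close> is shifted so that its degree \<open>d\<close> part becomes that of degree
  \<open>d + s i\<close>.\<close>

definition copies_grade ::
  "nat \<Rightarrow> (nat \<Rightarrow> nat) \<Rightarrow> ('k, 'a, 'b, 'g) bimodule \<Rightarrow> (nat \<Rightarrow> 'g set) \<Rightarrow> nat \<Rightarrow> (nat \<Rightarrow> 'g) set" where
  "copies_grade m s G gG d =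
     (\<Pi>\<^sub>E i\<in>{..<m}. if s i \<le> d then gG (d - s i) else {\<zero>\<^bsub>G\<^esub>})"

text \<open>Graded projective modules are graded direct summands of graded free modules, i.e. of finite
  direct sums of shifts of the free module of rank one.  Modules have no components of negative
  degree, so summands generated in negative degree are not needed.\<close>

definition graded_summand_of_copies ::
  "('a, 'y) partial_object_scheme \<Rightarrow> ('b, 'z) partial_object_scheme \<Rightarrow>
    ('k, 'a, 'b, 'g) bimodule \<Rightarrow> (nat \<Rightarrow> 'g set) \<Rightarrow>
    ('k, 'a, 'b, 'm) bimodule \<Rightarrow> (nat \<Rightarrow> 'm set) \<Rightarrow> bool" where
  "graded_summand_of_copies A B G gG X gX \<longleftrightarrow>
     (\<exists>m s. \<exists>\<iota>\<in>graded_bihom A B X gX (copies m G) (copies_grade m s G gG).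
        \<exists>\<pi>\<in>graded_bihom A B (copies m G) (copies_grade m s G gG) X gX.
        \<forall>x\<in>carrier X. \<pi> (\<iota> x) = x)"

definition graded_left_projective ::
  "('k, 'x) ring_scheme \<Rightarrow> ('k, 'a) module \<Rightarrow> (nat \<Rightarrow> 'a set) \<Rightarrow>
    ('k, 'a, 'b, 'm) bimodule \<Rightarrow> (nat \<Rightarrow> 'm set) \<Rightarrow> bool" where
  "graded_left_projective K A gA M gM \<longleftrightarrow>
     graded_summand_of_copies A K (as_left (regular A)) gA (as_left M) gM"

definition graded_right_projective ::
  "('k, 'x) ring_scheme \<Rightarrow> ('k, 'b) module \<Rightarrow> (nat \<Rightarrow> 'b set) \<Rightarrow>
    ('k, 'a, 'b, 'm) bimodule \<Rightarrow> (nat \<Rightarrow> 'm set) \<Rightarrow> bool" where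
  "graded_right_projective K B gB M gM \<longleftrightarrow>
     graded_summand_of_copies K B (as_right (regular B)) gB (as_right M) gM"

definition graded_projective_bimodule ::
  "('k, 'x) ring_scheme \<Rightarrow> ('k, 'a) module \<Rightarrow> (nat \<Rightarrow> 'a set) \<Rightarrow> ('k, 'b) module \<Rightarrow>
    (nat \<Rightarrow> 'b set) \<Rightarrow> ('k, 'a, 'b, 'm) bimodule \<Rightarrow> (nat \<Rightarrow> 'm set) \<Rightarrow> bool" where
  "graded_projective_bimodule K A gA B gB P gP \<longleftrightarrow>
     graded_bimodule K A gA B gB P gP \<and>
     graded_summand_of_copies A B (free_bimodule K A B)
       (tensor_grade K (as_left (regular A)) gA (as_right (regular B)) gB) P gP"

definition induce_graded_stable_equivalence ::
  "('k, 'x) ring_scheme \<Rightarrow> ('k, 'a) module \<Rightarrow> (nat \<Rightarrow> 'a set) \<Rightarrow> ('k, 'b) module \<Rightarrow>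
    (nat \<Rightarrow> 'b set) \<Rightarrow> ('k, 'a, 'b, 'm) bimodule \<Rightarrow> (nat \<Rightarrow> 'm set) \<Rightarrow>
    ('k, 'b, 'a, 'n) bimodule \<Rightarrow> (nat \<Rightarrow> 'n set) \<Rightarrow> bool" where
  "induce_graded_stable_equivalence K A gA B gB M gM N gN \<longleftrightarrow>
     graded_left_projective K A gA M gM \<and> graded_right_projective K B gB M gM \<and>
     graded_left_projective K B gB N gN \<and> graded_right_projective K A gA N gN \<and>
     (\<exists>(P :: ('k, 'a, 'a, nat \<Rightarrow> 'k) bimodule) gP.
        graded_projective_bimodule K A gA A gA P gP \<and>
        graded_biiso A A (tensor B M N) (tensor_grade B M gM N gN)
          (dsum (regular A) P) (dsum_grade gA gP) \<noteq> {}) \<and>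
     (\<exists>(Q :: ('k, 'b, 'b, nat \<Rightarrow> 'k) bimodule) gQ.
        graded_projective_bimodule K B gB B gB Q gQ \<and>
        graded_biiso B B (tensor A N M) (tensor_grade A N gN M gM)
          (dsum (regular B) Q) (dsum_grade gB gQ) \<noteq> {})"


section \<open>Beilinson-Green algebras\<close>

text \<open>Rows and columns are indexed by \<open>0, ..., n\<close>; entries outside this range, or below the
  diagonal, are zero.\<close>

definition beilinson_green ::
  "nat \<Rightarrow> ('k, 'a) module \<Rightarrow> (nat \<Rightarrow> 'a set) \<Rightarrow> ('k, nat \<Rightarrow> nat \<Rightarrow> 'a) module" where
  "beilinson_green n A gA =
     \<lparr>carrier = {X. \<forall>i j. X i j \<in> (if i \<le> j \<and> j \<le> n then gA (j - i) else {\<zero>\<^bsub>A\<^esub>})},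
      monoid.mult = (\<lambda>X Y i j. \<Oplus>\<^bsub>A\<^esub>l\<in>{..n}. X i l \<otimes>\<^bsub>A\<^esub> Y l j),
      one = (\<lambda>i j. if i = j \<and> j \<le> n then \<one>\<^bsub>A\<^esub> else \<zero>\<^bsub>A\<^esub>),
      ring.zero = (\<lambda>i j. \<zero>\<^bsub>A\<^esub>),
      add = (\<lambda>X Y i j. X i j \<oplus>\<^bsub>A\<^esub> Y i j),
      smult = (\<lambda>c X i j. c \<odot>\<^bsub>A\<^esub> X i j)\<rparr>"

end

theory Submission
  imports Defs
begin

text \<open>For a graded bimodule \<open>M\<close> let \<open>barM\<close> be the bimodule of upper triangular matrices with
  \<open>(i, j)\<close> entry in degree \<open>j - i\<close>, so that the Beilinson-Green algebra is the case of the regular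
  bimodule.  The stable equivalence is given by \<open>barM\<close> and \<open>barN\<close>.  If \<open>M\<close> is a summand of shifts
  of \<open>A\<close>, then \<open>barM\<close> is a summand of the modules given by shifted rows or columns, i.e. of copies
  of \<open>barA\<close>; the triangular matrices over the shift by \<open>s\<close> of the free bimodule are the sum over
  \<open>a\<close> of the projective bimodules generated by the idempotents at \<open>(a, a)\<close> and \<open>(a + s, a + s)\<close>.
  Matrix multiplication with entries multiplied in the tensor product maps the tensor product of
  \<open>barM\<close> and \<open>barN\<close> over \<open>barB\<close> onto the triangular matrices over the tensor product of \<open>M\<close> and
  \<open>N\<close>, and a homogeneous dual basis of the right module \<open>M\<close> shows that it is injective.\<close>


section \<open>Additive maps and finite sums\<close>

text \<open>The degrees dictate the shifts: an entry at \<open>(i, j)\<close> has degree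
  \<open>j - i\<close>, so lowering degrees by \<open>s\<close> means raising the row index or
  lowering the column index by \<open>s\<close>, and the side of the action decides which of the two
  is compatible with it. Rows and columns pushed out of \<open>0, ..., n\<close> hold only entries
  whose degree is too small for the shift, so truncation at \<open>n\<close> loses nothing. Two
  obstacles shape the rest. The pieces \<open>tensor_grade\<close> are merely generated subgroups;
  instead of proving that they grade the tensor product, the argument works in the direct sum to
  which the tensor product is isomorphic by hypothesis and whose pieces are evidently submodules.
  Moreover, a stable equivalence has to be witnessed by bimodules with carriers inside
  \<open>nat \<Rightarrow> 'k\<close>, whereas \<open>barM\<close> consists of matrices over an
  arbitrary type. This calls for an injection of the matrices into coordinate sequences, obtained by
  embedding \<open>M\<close> into a finite power of \<open>A\<close>, and for transporting all
  structure along it.\<close>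

abbreviation ahom :: "('a, 'm) ring_scheme \<Rightarrow> ('b, 'n) ring_scheme \<Rightarrow> ('a \<Rightarrow> 'b) set" where
  "ahom X Y \<equiv> hom (add_monoid X) (add_monoid Y)"

lemma ahomI:
  assumes "\<And>x. x \<in> carrier X \<Longrightarrow> f x \<in> carrier Y"
    and "\<And>x y. x \<in> carrier X \<Longrightarrow> y \<in> carrier X \<Longrightarrow> f (x \<oplus>\<^bsub>X\<^esub> y) = f x \<oplus>\<^bsub>Y\<^esub> f y"
  shows "f \<in> ahom X Y"
  using assms by (auto simp: hom_def)

lemma ahom_closed: "f \<in> ahom X Y \<Longrightarrow> x \<in> carrier X \<Longrightarrow> f x \<in> carrier Y"
  by (auto simp: hom_def)

lemma ahom_add:
  "f \<in> ahom X Y \<Longrightarrow> x \<in> carrier X \<Longrightarrow> y \<in> carrier X \<Longrightarrow> f (x \<oplus>\<^bsub>X\<^esub> y) = f x \<oplus>\<^bsub>Y\<^esub> f y"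
  by (auto simp: hom_def)

lemma ahom_zero:
  assumes "abelian_group X" "abelian_group Y" "f \<in> ahom X Y"
  shows "f \<zero>\<^bsub>X\<^esub> = \<zero>\<^bsub>Y\<^esub>"
  using hom_one[OF assms(3)] abelian_group.a_group[OF assms(1)] abelian_group.a_group[OF assms(2)]
  by simp

lemma ahom_minus:
  assumes "abelian_group X" "abelian_group Y" "f \<in> ahom X Y" "x \<in> carrier X"
  shows "f (\<ominus>\<^bsub>X\<^esub> x) = \<ominus>\<^bsub>Y\<^esub> f x"
proof -
  interpret X: abelian_group X by fact
  interpret Y: abelian_group Y by fact
  have "f (\<ominus>\<^bsub>X\<^esub> x) \<oplus>\<^bsub>Y\<^esub> f x = \<zero>\<^bsub>Y\<^esub>"
    using ahom_add[OF assms(3), of "\<ominus>\<^bsub>X\<^esub> x" x] ahom_zero[OF assms(1-3)] assms(4)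
    by (simp add: X.l_neg)
  then show ?thesis
    using ahom_closed[OF assms(3)] assms(4) by (metis X.a_inv_closed Y.minus_equality)
qed

lemma ahom_comp: "f \<in> ahom X Y \<Longrightarrow> g \<in> ahom Y Z \<Longrightarrow> (\<lambda>x. g (f x)) \<in> ahom X Z"
  by (simp add: hom_def Pi_def)

lemma ahom_finsum:
  assumes "abelian_group X" "abelian_group Y" "f \<in> ahom X Y" "g \<in> I \<rightarrow> carrier X"
  shows "f (finsum X g I) = finsum Y (\<lambda>i. f (g i)) I"
proof (cases "finite I")
  case True
  interpret X: abelian_group X by fact
  interpret Y: abelian_group Y by fact
  from True assms(4) show ?thesis
  proof (induction I)
    case empty
    then show ?case using ahom_zero[OF assms(1-3)] by simp
  next
    case (insert i I)
    then have "g \<in> I \<rightarrow> carrier X" "g i \<in> carrier X" by auto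
    moreover have "(\<lambda>i. f (g i)) \<in> I \<rightarrow> carrier Y" "f (g i) \<in> carrier Y"
      using insert.prems ahom_closed[OF assms(3)] by auto
    ultimately show ?case
      using insert ahom_add[OF assms(3), of "g i" "finsum X g I"]
      by simp
  qed
next
  case False
  then show ?thesis
    using ahom_zero[OF assms(1-3)] by (simp add: finsum_def finprod_def)
qed

section \<open>Rearranging finite sums in abelian monoids\<close>

context abelian_monoid
begin

lemma finsum_closedI: "(\<And>i. i \<in> I \<Longrightarrow> f i \<in> carrier G) \<Longrightarrow> finsum G f I \<in> carrier G"
  by (rule finsum_closed) auto

lemma finsum_congI:
  "(\<And>i. i \<in> I \<Longrightarrow> f i = g i) \<Longrightarrow> (\<And>i. i \<in> I \<Longrightarrow> g i \<in> carrier G) \<Longrightarrow> finsum G f I = finsum G g I"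
  by (rule finsum_cong') auto

lemma finsum_zeroI: "(\<And>i. i \<in> I \<Longrightarrow> f i = \<zero>) \<Longrightarrow> finsum G f I = \<zero>"
  by (rule add.finprod_one_eqI)

lemma finsum_addI:
  assumes "\<And>i. i \<in> I \<Longrightarrow> f i \<in> carrier G" "\<And>i. i \<in> I \<Longrightarrow> g i \<in> carrier G"
  shows "finsum G (\<lambda>i. f i \<oplus> g i) I = finsum G f I \<oplus> finsum G g I"
  using assms by (intro finsum_addf) auto

lemma finsum_single:
  assumes "finite I" "j \<in> I" "f j \<in> carrier G" "\<And>i. i \<in> I \<Longrightarrow> i \<noteq> j \<Longrightarrow> f i = \<zero>"
  shows "finsum G f I = f j"
proof -
  have "finsum G f I = finsum G (\<lambda>i. if j = i then f i else \<zero>) I"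
    using assms by (intro finsum_congI) auto
  also have "\<dots> = f j"
    by (rule finsum_cong'[THEN trans, OF refl _ _ finsum_singleton[OF assms(2,1), of "\<lambda>_. f j"]])
      (use assms in auto)
  finally show ?thesis .
qed

lemma finsum_insertI:
  assumes "finite I" "i \<notin> I" "f i \<in> carrier G" "\<And>j. j \<in> I \<Longrightarrow> f j \<in> carrier G"
  shows "finsum G f (insert i I) = f i \<oplus> finsum G f I"
  using assms by (intro finsum_insert) auto

lemma finsum_swap:
  assumes "finite I" "finite J" "\<And>i j. i \<in> I \<Longrightarrow> j \<in> J \<Longrightarrow> f i j \<in> carrier G"
  shows "(\<Oplus>i\<in>I. \<Oplus>j\<in>J. f i j) = (\<Oplus>j\<in>J. \<Oplus>i\<in>I. f i j)"
  using assms(1,3)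
proof (induction I)
  case empty
  then show ?case by (simp add: finsum_zeroI)
next
  case (insert i I)
  have "(\<Oplus>i\<in>insert i I. \<Oplus>j\<in>J. f i j) = (\<Oplus>j\<in>J. f i j) \<oplus> (\<Oplus>i\<in>I. \<Oplus>j\<in>J. f i j)"
    using insert by (intro finsum_insertI finsum_closedI) auto
  also have "\<dots> = (\<Oplus>j\<in>J. f i j) \<oplus> (\<Oplus>j\<in>J. \<Oplus>i\<in>I. f i j)"
    using insert by simp
  also have "\<dots> = (\<Oplus>j\<in>J. f i j \<oplus> (\<Oplus>i\<in>I. f i j))"
    using insert by (intro finsum_addI[symmetric] finsum_closedI) auto
  also have "\<dots> = (\<Oplus>j\<in>J. \<Oplus>i\<in>insert i I. f i j)"
    using insert by (intro finsum_congI finsum_insertI[symmetric] finsum_closedI) auto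
  finally show ?case .
qed

lemma finsum_Times:
  assumes "finite I" "finite J" "\<And>i j. i \<in> I \<Longrightarrow> j \<in> J \<Longrightarrow> f i j \<in> carrier G"
  shows "finsum G (\<lambda>(i, j). f i j) (I \<times> J) = (\<Oplus>i\<in>I. \<Oplus>j\<in>J. f i j)"
  using assms(1,3)
proof (induction I)
  case empty
  then show ?case by simp
next
  case (insert i I)
  have "finsum G (\<lambda>(i, j). f i j) (insert i I \<times> J) = finsum G (\<lambda>(i, j). f i j) (Pair i ` J \<union> I \<times> J)"
    by (rule arg_cong[of _ _ "finsum G _"]) auto
  also have "\<dots> = finsum G (\<lambda>(i, j). f i j) (Pair i ` J) \<oplus> finsum G (\<lambda>(i, j). f i j) (I \<times> J)"
    using insert assms(2) by (intro finsum_Un_disjoint) auto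
  also have "finsum G (\<lambda>(i, j). f i j) (Pair i ` J) = (\<Oplus>j\<in>J. f i j)"
    using insert by (subst finsum_reindex) (auto simp: inj_on_def)
  also have "finsum G (\<lambda>(i, j). f i j) (I \<times> J) = (\<Oplus>i\<in>I. \<Oplus>j\<in>J. f i j)"
    using insert by simp
  also have "(\<Oplus>j\<in>J. f i j) \<oplus> \<dots> = (\<Oplus>i\<in>insert i I. \<Oplus>j\<in>J. f i j)"
    using insert by (intro finsum_insertI[symmetric] finsum_closedI) auto
  finally show ?case .
qed

end

lemma finsum_ahomI:
  assumes "abelian_group X" "abelian_group Y" "\<And>i. i \<in> I \<Longrightarrow> f i \<in> ahom X Y"
  shows "(\<lambda>x. \<Oplus>\<^bsub>Y\<^esub>i\<in>I. f i x) \<in> ahom X Y"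
proof -
  interpret X: abelian_group X by fact
  interpret Y: abelian_group Y by fact
  show ?thesis
  proof (rule ahomI)
    fix x y assume *: "x \<in> carrier X" "y \<in> carrier X"
    have "(\<Oplus>\<^bsub>Y\<^esub>i\<in>I. f i (x \<oplus>\<^bsub>X\<^esub> y)) = (\<Oplus>\<^bsub>Y\<^esub>i\<in>I. f i x \<oplus>\<^bsub>Y\<^esub> f i y)"
      using * by (intro Y.finsum_congI) (auto simp: ahom_add[OF assms(3)] ahom_closed[OF assms(3)])
    also have "\<dots> = (\<Oplus>\<^bsub>Y\<^esub>i\<in>I. f i x) \<oplus>\<^bsub>Y\<^esub> (\<Oplus>\<^bsub>Y\<^esub>i\<in>I. f i y)"
      using * by (intro Y.finsum_addI) (auto simp: ahom_closed[OF assms(3)])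
    finally show "(\<Oplus>\<^bsub>Y\<^esub>i\<in>I. f i (x \<oplus>\<^bsub>X\<^esub> y)) = \<dots>" .
  qed (auto intro!: Y.finsum_closedI simp: ahom_closed[OF assms(3)])
qed

text \<open>Forgetting an action changes neither the carrier nor the addition, so sums in the
  one-sided versions of a bimodule can be computed in the bimodule itself.\<close>

lemma finsum_add_monoid_cong:
  "carrier Y = carrier X \<Longrightarrow> add Y = add X \<Longrightarrow> \<zero>\<^bsub>Y\<^esub> = \<zero>\<^bsub>X\<^esub> \<Longrightarrow> finsum Y f I = finsum X f I"
  by (simp add: finsum_def finprod_def)

lemma abelian_group_cong:
  assumes "abelian_group X" "carrier Y = carrier X" "add Y = add X" "\<zero>\<^bsub>Y\<^esub> = \<zero>\<^bsub>X\<^esub>"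
  shows "abelian_group Y"
proof -
  interpret X: abelian_group X by fact
  show ?thesis
    using X.l_neg X.a_inv_closed
    by (intro abelian_groupI) (auto simp: assms(2-4) X.a_ac)
qed


section \<open>Groups with two operator domains\<close>

text \<open>The part of the bimodule axioms that is shared by the one-sided modules, where one of the
  operator domains is the ground field, and by tensor products.\<close>

locale biact = abelian_group X
  for A :: "('a, 'y) partial_object_scheme" and B :: "('b, 'z) partial_object_scheme"
    and X :: "('k, 'a, 'b, 'm) bimodule" +
  assumes lact_ahom: "a \<in> carrier A \<Longrightarrow> lact X a \<in> ahom X X"
    and ract_ahom: "b \<in> carrier B \<Longrightarrow> (\<lambda>x. ract X x b) \<in> ahom X X"
begin

lemma abelian_group: "abelian_group X" ..

lemma lact_closed: "a \<in> carrier A \<Longrightarrow> x \<in> carrier X \<Longrightarrow> lact X a x \<in> carrier X"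
  using ahom_closed[OF lact_ahom] .

lemma ract_closed: "b \<in> carrier B \<Longrightarrow> x \<in> carrier X \<Longrightarrow> ract X x b \<in> carrier X"
  using ahom_closed[OF ract_ahom] .

lemma lact_zero: "a \<in> carrier A \<Longrightarrow> lact X a \<zero>\<^bsub>X\<^esub> = \<zero>\<^bsub>X\<^esub>"
  using ahom_zero[OF abelian_group abelian_group lact_ahom] .

lemma ract_zero: "b \<in> carrier B \<Longrightarrow> ract X \<zero>\<^bsub>X\<^esub> b = \<zero>\<^bsub>X\<^esub>"
  using ahom_zero[OF abelian_group abelian_group ract_ahom] .

lemma lact_finsum: "a \<in> carrier A \<Longrightarrow> (\<And>i. i \<in> I \<Longrightarrow> f i \<in> carrier X) \<Longrightarrow>
    lact X a (finsum X f I) = (\<Oplus>\<^bsub>X\<^esub>i\<in>I. lact X a (f i))"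
  by (rule ahom_finsum[OF abelian_group abelian_group lact_ahom]) auto

lemma ract_finsum: "b \<in> carrier B \<Longrightarrow> (\<And>i. i \<in> I \<Longrightarrow> f i \<in> carrier X) \<Longrightarrow>
    ract X (finsum X f I) b = (\<Oplus>\<^bsub>X\<^esub>i\<in>I. ract X (f i) b)"
  by (rule ahom_finsum[OF abelian_group abelian_group ract_ahom]) auto

end

lemma bihomI:
  assumes "f \<in> ahom X Y"
    and "\<And>a x. a \<in> carrier A \<Longrightarrow> x \<in> carrier X \<Longrightarrow> f (lact X a x) = lact Y a (f x)"
    and "\<And>x b. x \<in> carrier X \<Longrightarrow> b \<in> carrier B \<Longrightarrow> f (ract X x b) = ract Y (f x) b"
  shows "f \<in> bihom A B X Y"
  using assms by (auto simp: bihom_def)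

lemma bihomD:
  assumes "f \<in> bihom A B X Y"
  shows bihom_ahom: "f \<in> ahom X Y"
    and bihom_closed: "x \<in> carrier X \<Longrightarrow> f x \<in> carrier Y"
    and bihom_add: "x \<in> carrier X \<Longrightarrow> y \<in> carrier X \<Longrightarrow> f (x \<oplus>\<^bsub>X\<^esub> y) = f x \<oplus>\<^bsub>Y\<^esub> f y"
    and bihom_lact: "a \<in> carrier A \<Longrightarrow> x \<in> carrier X \<Longrightarrow> f (lact X a x) = lact Y a (f x)"
    and bihom_ract: "x \<in> carrier X \<Longrightarrow> b \<in> carrier B \<Longrightarrow> f (ract X x b) = ract Y (f x) b"
  using assms by (auto simp: bihom_def hom_def)

lemma bihom_comp:
  assumes "f \<in> bihom A B X Y" "g \<in> bihom A B Y Z"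
  shows "(\<lambda>x. g (f x)) \<in> bihom A B X Z"
  using ahom_comp[OF bihom_ahom[OF assms(1)] bihom_ahom[OF assms(2)]]
  by (rule bihomI) (simp_all add: bihomD[OF assms(1)] bihomD[OF assms(2)])

lemma bihom_finsumI:
  assumes "abelian_group X" "biact A B Y" "\<And>i. i \<in> I \<Longrightarrow> f i \<in> bihom A B X Y"
  shows "(\<lambda>x. \<Oplus>\<^bsub>Y\<^esub>i\<in>I. f i x) \<in> bihom A B X Y"
proof -
  interpret Y: biact A B Y by fact
  note [simp] = bihomD[OF assms(3)] Y.lact_closed Y.ract_closed
  show ?thesis
  proof (rule bihomI)
    show "(\<lambda>x. \<Oplus>\<^bsub>Y\<^esub>i\<in>I. f i x) \<in> ahom X Y"
      using assms(1) Y.abelian_group by (rule finsum_ahomI) simp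
  next
    fix a x assume "a \<in> carrier A" "x \<in> carrier X"
    then show "(\<Oplus>\<^bsub>Y\<^esub>i\<in>I. f i (lact X a x)) = lact Y a (\<Oplus>\<^bsub>Y\<^esub>i\<in>I. f i x)"
      by (subst Y.lact_finsum) (auto intro!: Y.finsum_congI)
  next
    fix b x assume "b \<in> carrier B" "x \<in> carrier X"
    then show "(\<Oplus>\<^bsub>Y\<^esub>i\<in>I. f i (ract X x b)) = ract Y (\<Oplus>\<^bsub>Y\<^esub>i\<in>I. f i x) b"
      by (subst Y.ract_finsum) (auto intro!: Y.finsum_congI)
  qed
qed

lemma biisoI:
  "f \<in> bihom A B X Y \<Longrightarrow> bij_betw f (carrier X) (carrier Y) \<Longrightarrow> f \<in> biiso A B X Y"
  by (auto simp: biiso_def)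

lemma biiso_comp:
  assumes "f \<in> biiso A B X Y" "g \<in> biiso A B Y Z"
  shows "(\<lambda>x. g (f x)) \<in> biiso A B X Z"
  using assms bihom_comp[of f A B X Y g Z] bij_betw_trans[of f _ _ g]
  by (auto simp: biiso_def comp_def)

lemma biiso_inv:
  assumes "biact A B X" "f \<in> biiso A B X Y"
  shows "inv_into (carrier X) f \<in> biiso A B Y X"
proof -
  interpret X: biact A B X by fact
  from assms(2) have f: "f \<in> bihom A B X Y" and b: "bij_betw f (carrier X) (carrier Y)"
    by (auto simp: biiso_def)
  let ?g = "inv_into (carrier X) f"
  have gb: "bij_betw ?g (carrier Y) (carrier X)" by (rule bij_betw_inv_into[OF b])
  have gc: "\<And>y. y \<in> carrier Y \<Longrightarrow> ?g y \<in> carrier X" using gb by (auto simp: bij_betw_def)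
  have fg: "\<And>y. y \<in> carrier Y \<Longrightarrow> f (?g y) = y" using b by (meson bij_betw_inv_into_right)
  have gf: "\<And>x. x \<in> carrier X \<Longrightarrow> ?g (f x) = x" using b by (meson bij_betw_inv_into_left)
  have "?g \<in> bihom A B Y X"
  proof (intro bihomI ahomI gc)
    fix x y assume "x \<in> carrier Y" "y \<in> carrier Y"
    then show "?g (x \<oplus>\<^bsub>Y\<^esub> y) = ?g x \<oplus>\<^bsub>X\<^esub> ?g y"
      using gf[of "?g x \<oplus>\<^bsub>X\<^esub> ?g y"] by (simp add: bihom_add[OF f] fg gc)
  next
    fix a x assume "a \<in> carrier A" "x \<in> carrier Y"
    then show "?g (lact Y a x) = lact X a (?g x)"
      using gf[of "lact X a (?g x)"] by (simp add: bihom_lact[OF f] fg gc X.lact_closed)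
  next
    fix b x assume "b \<in> carrier B" "x \<in> carrier Y"
    then show "?g (ract Y x b) = ract X (?g x) b"
      using gf[of "ract X (?g x) b"] by (simp add: bihom_ract[OF f] fg gc X.ract_closed)
  qed
  then show ?thesis using gb by (rule biisoI)
qed


section \<open>Direct summands of finite direct sums\<close>

lemma copies_simps [simp]:
  "carrier (copies m G) = {..<m} \<rightarrow>\<^sub>E carrier G"
  "\<zero>\<^bsub>copies m G\<^esub> = (\<lambda>i\<in>{..<m}. \<zero>\<^bsub>G\<^esub>)"
  "x \<oplus>\<^bsub>copies m G\<^esub> y = (\<lambda>i\<in>{..<m}. x i \<oplus>\<^bsub>G\<^esub> y i)"
  "lact (copies m G) a x = (\<lambda>i\<in>{..<m}. lact G a (x i))"
  "ract (copies m G) x b = (\<lambda>i\<in>{..<m}. ract G (x i) b)"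
  by (simp_all add: copies_def)

lemma abelian_group_copies:
  assumes "abelian_group G" shows "abelian_group (copies m G)"
proof -
  interpret G: abelian_group G by fact
  show ?thesis
  proof (rule abelian_groupI)
    fix x y z assume *: "x \<in> carrier (copies m G)" "y \<in> carrier (copies m G)" "z \<in> carrier (copies m G)"
    show "x \<oplus>\<^bsub>copies m G\<^esub> y \<oplus>\<^bsub>copies m G\<^esub> z = x \<oplus>\<^bsub>copies m G\<^esub> (y \<oplus>\<^bsub>copies m G\<^esub> z)"
      using * by (auto simp: fun_eq_iff G.a_assoc PiE_iff)
  next
    fix x y assume *: "x \<in> carrier (copies m G)" "y \<in> carrier (copies m G)"
    show "x \<oplus>\<^bsub>copies m G\<^esub> y = y \<oplus>\<^bsub>copies m G\<^esub> x"
      using * by (auto simp: fun_eq_iff G.a_comm PiE_iff)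
  next
    fix x assume *: "x \<in> carrier (copies m G)"
    show "\<zero>\<^bsub>copies m G\<^esub> \<oplus>\<^bsub>copies m G\<^esub> x = x"
      using * by (auto simp: fun_eq_iff PiE_iff extensional_def)
    show "\<exists>y\<in>carrier (copies m G). y \<oplus>\<^bsub>copies m G\<^esub> x = \<zero>\<^bsub>copies m G\<^esub>"
      using * by (intro bexI[of _ "\<lambda>i\<in>{..<m}. \<ominus>\<^bsub>G\<^esub> x i"]) (auto simp: fun_eq_iff PiE_iff G.l_neg)
  qed (auto simp: PiE_iff)
qed

text \<open>The matrix constructions produce sums of maps through \<open>G\<close> indexed by pairs,
  of a row or column and a generator. A bijection of the finite index set with
  \<open>{..<card I}\<close> bundles them into one split embedding.\<close>

lemma summand_of_copiesI:
  assumes X: "biact A B X" and G: "biact A B G" and fin: "finite I"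
    and \<phi>: "\<And>i. i \<in> I \<Longrightarrow> \<phi> i \<in> bihom A B X G"
    and \<psi>: "\<And>i. i \<in> I \<Longrightarrow> \<psi> i \<in> bihom A B G X"
    and eq: "\<And>x. x \<in> carrier X \<Longrightarrow> (\<Oplus>\<^bsub>X\<^esub>i\<in>I. \<psi> i (\<phi> i x)) = x"
  shows "summand_of_copies A B G X"
proof -
  interpret X: biact A B X by fact
  interpret G: biact A B G by fact
  obtain h where h: "bij_betw h {..<card I} I"
    using ex_bij_betw_nat_finite[OF fin] by (auto simp: atLeast0LessThan)
  then have hI: "\<And>i. i < card I \<Longrightarrow> h i \<in> I" by (auto simp: bij_betw_def)
  let ?G = "copies (card I) G"
  define \<iota> where "\<iota> x = (\<lambda>i\<in>{..<card I}. \<phi> (h i) x)" for x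
  define \<pi> where "\<pi> y = (\<Oplus>\<^bsub>X\<^esub>i\<in>{..<card I}. \<psi> (h i) (y i))" for y
  have \<iota>: "\<iota> \<in> bihom A B X ?G"
    by (intro bihomI ahomI) (auto simp: \<iota>_def fun_eq_iff bihomD[OF \<phi>] hI)
  have \<pi>: "\<pi> \<in> bihom A B ?G X"
    unfolding \<pi>_def
  proof (rule bihom_finsumI)
    fix i assume "i \<in> {..<card I}"
    then show "(\<lambda>y. \<psi> (h i) (y i)) \<in> bihom A B ?G X"
      by (intro bihomI ahomI) (auto simp: bihomD[OF \<psi>] hI PiE_iff)
  qed (use X abelian_group_copies G.abelian_group in auto)
  have "\<pi> (\<iota> x) = x" if x: "x \<in> carrier X" for x
  proof -
    have c: "\<And>i. i \<in> I \<Longrightarrow> \<psi> i (\<phi> i x) \<in> carrier X"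
      using x by (simp add: bihomD[OF \<psi>] bihomD[OF \<phi>])
    have "\<pi> (\<iota> x) = (\<Oplus>\<^bsub>X\<^esub>i\<in>{..<card I}. \<psi> (h i) (\<phi> (h i) x))"
      unfolding \<pi>_def \<iota>_def using hI c by (intro X.finsum_congI) auto
    also have "\<dots> = (\<Oplus>\<^bsub>X\<^esub>i\<in>h ` {..<card I}. \<psi> i (\<phi> i x))"
      using h c hI by (subst X.finsum_reindex) (auto simp: bij_betw_def)
    also have "h ` {..<card I} = I" using h by (auto simp: bij_betw_def)
    finally show ?thesis using eq[OF x] by simp
  qed
  with \<iota> \<pi> show ?thesis unfolding summand_of_copies_def by blast
qed

text \<open>Composing the splitting with coordinate projections and coordinate embeddings gives a
  homogeneous dual basis: \<open>\<phi> k\<close> lowers degrees by \<open>s k\<close> and kills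
  everything below degree \<open>s k\<close>, while \<open>\<psi> k\<close> raises degrees by
  \<open>s k\<close>.\<close>

lemma graded_summand_of_copiesE:
  assumes "graded_summand_of_copies A B G gG X gX"
    and X: "abelian_group X" and G: "biact A B G" and zero: "\<And>d. \<zero>\<^bsub>G\<^esub> \<in> gG d"
  obtains m :: nat and s :: "nat \<Rightarrow> nat" and \<phi> \<psi> where
    "\<And>k. k < m \<Longrightarrow> \<phi> k \<in> bihom A B X G" "\<And>k. k < m \<Longrightarrow> \<psi> k \<in> bihom A B G X"
    "\<And>k d x. k < m \<Longrightarrow> x \<in> gX d \<Longrightarrow> \<phi> k x \<in> (if s k \<le> d then gG (d - s k) else {\<zero>\<^bsub>G\<^esub>})"
    "\<And>k d y. k < m \<Longrightarrow> y \<in> gG d \<Longrightarrow> \<psi> k y \<in> gX (d + s k)"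
    "\<And>x. x \<in> carrier X \<Longrightarrow> (\<Oplus>\<^bsub>X\<^esub>k\<in>{..<m}. \<psi> k (\<phi> k x)) = x"
proof -
  from assms(1) obtain m s \<iota> \<pi>
    where \<iota>: "\<iota> \<in> graded_bihom A B X gX (copies m G) (copies_grade m s G gG)"
      and \<pi>: "\<pi> \<in> graded_bihom A B (copies m G) (copies_grade m s G gG) X gX"
      and \<pi>\<iota>: "\<And>x. x \<in> carrier X \<Longrightarrow> \<pi> (\<iota> x) = x"
    unfolding graded_summand_of_copies_def by blast
  interpret X: abelian_group X by fact
  interpret G: biact A B G by fact
  interpret C: abelian_group "copies m G" by (rule abelian_group_copies[OF G.abelian_group])
  have \<iota>': "\<iota> \<in> bihom A B X (copies m G)" and \<pi>': "\<pi> \<in> bihom A B (copies m G) X"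
    using \<iota> \<pi> by (auto simp: graded_bihom_def)
  note \<iota>c = bihom_closed[OF \<iota>', simplified]
  define e where "e k g = (\<lambda>i\<in>{..<m}. if i = k then g else \<zero>\<^bsub>G\<^esub>)" for k and g
  have ec: "e k g \<in> carrier (copies m G)" if "g \<in> carrier G" for k g
    using that by (auto simp: e_def)
  have eval: "(\<lambda>y. y i) \<in> ahom (copies m G) G" if "i < m" for i
    using that by (intro ahomI) (auto simp: PiE_iff)
  have dec: "(\<Oplus>\<^bsub>copies m G\<^esub>k\<in>{..<m}. e k (y k)) = y" if y: "y \<in> carrier (copies m G)" for y
  proof
    fix i
    have c: "\<And>k. k < m \<Longrightarrow> e k (y k) \<in> carrier (copies m G)"
      using y by (intro ec) (auto simp: PiE_iff)
    show "(\<Oplus>\<^bsub>copies m G\<^esub>k\<in>{..<m}. e k (y k)) i = y i"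
    proof (cases "i < m")
      case True
      then have "(\<Oplus>\<^bsub>copies m G\<^esub>k\<in>{..<m}. e k (y k)) i = (\<Oplus>\<^bsub>G\<^esub>k\<in>{..<m}. e k (y k) i)"
        using c by (intro ahom_finsum[OF C.abelian_group_axioms G.abelian_group eval]) auto
      also have "\<dots> = e i (y i) i"
        using True y by (intro G.finsum_single) (auto simp: e_def PiE_iff)
      finally show ?thesis using True by (simp add: e_def)
    next
      case False
      have "(\<Oplus>\<^bsub>copies m G\<^esub>k\<in>{..<m}. e k (y k)) \<in> carrier (copies m G)"
        using c by (intro C.finsum_closedI) auto
      then show ?thesis using False y by (auto simp: PiE_def extensional_def)
    qed
  qed
  show thesis
  proof
    fix k assume k: "k < m"
    show "(\<lambda>x. \<iota> x k) \<in> bihom A B X G"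
      using k \<iota>c by (intro bihomI ahomI) (auto simp: bihomD[OF \<iota>'] PiE_iff)
    have "e k \<in> bihom A B G (copies m G)"
      using k by (intro bihomI ahomI)
        (auto simp: e_def fun_eq_iff G.lact_zero G.ract_zero)
    then show "(\<lambda>g. \<pi> (e k g)) \<in> bihom A B G X" using \<pi>' by (rule bihom_comp)
    fix d x assume "x \<in> gX d"
    then have "\<iota> x \<in> copies_grade m s G gG d" using \<iota> by (auto simp: graded_bihom_def)
    with k show "\<iota> x k \<in> (if s k \<le> d then gG (d - s k) else {\<zero>\<^bsub>G\<^esub>})"
      by (auto simp: copies_grade_def PiE_iff)
  next
    fix k d y assume "k < m" "y \<in> gG d"
    \<comment> \<open>The other coordinates of \<open>e k y\<close> are zero; by \<open>zero\<close>
      they lie in the graded pieces required of them.\<close>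
    then have "e k y \<in> copies_grade m s G gG (d + s k)"
      by (auto simp: copies_grade_def e_def zero)
    then show "\<pi> (e k y) \<in> gX (d + s k)" using \<pi> by (auto simp: graded_bihom_def)
  next
    fix x assume x: "x \<in> carrier X"
    have "(\<Oplus>\<^bsub>X\<^esub>k\<in>{..<m}. \<pi> (e k (\<iota> x k))) = \<pi> (\<Oplus>\<^bsub>copies m G\<^esub>k\<in>{..<m}. e k (\<iota> x k))"
      using x \<iota>c ec by (intro ahom_finsum[OF C.abelian_group_axioms X bihom_ahom[OF \<pi>'], symmetric])
        (auto simp del: copies_simps)
    also have "\<dots> = \<pi> (\<iota> x)" using x \<iota>c by (subst dec) auto
    finally show "(\<Oplus>\<^bsub>X\<^esub>k\<in>{..<m}. \<pi> (e k (\<iota> x k))) = x" using \<pi>\<iota>[OF x] by simp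
  qed
qed

lemma summand_of_copies_biiso:
  assumes "biact A B X" "h \<in> biiso A B X Y" "summand_of_copies A B G X"
  shows "summand_of_copies A B G Y"
proof -
  let ?h' = "inv_into (carrier X) h"
  have h': "?h' \<in> biiso A B Y X" using assms(1,2) by (rule biiso_inv)
  from assms(3) obtain m \<iota> \<pi> where \<iota>: "\<iota> \<in> bihom A B X (copies m G)"
    and \<pi>: "\<pi> \<in> bihom A B (copies m G) X" and eq: "\<And>x. x \<in> carrier X \<Longrightarrow> \<pi> (\<iota> x) = x"
    unfolding summand_of_copies_def by blast
  have "(\<lambda>y. \<iota> (?h' y)) \<in> bihom A B Y (copies m G)"
    using h' \<iota> by (auto simp: biiso_def intro: bihom_comp)
  moreover have "(\<lambda>y. h (\<pi> y)) \<in> bihom A B (copies m G) Y"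
    using assms(2) \<pi> by (auto simp: biiso_def intro: bihom_comp)
  moreover have "h (\<pi> (\<iota> (?h' y))) = y" if "y \<in> carrier Y" for y
  proof -
    have "?h' y \<in> carrier X" "h (?h' y) = y"
      using h' assms(2) that bihom_closed[of ?h' A B Y X y]
      by (auto simp: biiso_def bij_betw_def f_inv_into_f)
    then show ?thesis using eq by simp
  qed
  ultimately show ?thesis unfolding summand_of_copies_def by (intro exI bexI ballI)
qed


section \<open>Tensor products\<close>

definition balanced_map ::
  "('b, 'z) partial_object_scheme \<Rightarrow> ('k, 'a, 'b, 'm) bimodule \<Rightarrow> ('k, 'b, 'c, 'n) bimodule \<Rightarrow>
    ('h, 'y) ring_scheme \<Rightarrow> ('m \<Rightarrow> 'n \<Rightarrow> 'h) \<Rightarrow> bool" where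
  "balanced_map R M N H \<beta> \<longleftrightarrow>
     (\<forall>x\<in>carrier M. \<beta> x \<in> ahom N H) \<and> (\<forall>y\<in>carrier N. (\<lambda>x. \<beta> x y) \<in> ahom M H) \<and>
     (\<forall>x\<in>carrier M. \<forall>r\<in>carrier R. \<forall>y\<in>carrier N. \<beta> (ract M x r) y = \<beta> x (lact N r y))"

lemma balanced_mapI:
  assumes "\<And>x y. x \<in> carrier M \<Longrightarrow> y \<in> carrier N \<Longrightarrow> \<beta> x y \<in> carrier H"
    and "\<And>x x' y. x \<in> carrier M \<Longrightarrow> x' \<in> carrier M \<Longrightarrow> y \<in> carrier N \<Longrightarrow>
      \<beta> (x \<oplus>\<^bsub>M\<^esub> x') y = \<beta> x y \<oplus>\<^bsub>H\<^esub> \<beta> x' y"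
    and "\<And>x y y'. x \<in> carrier M \<Longrightarrow> y \<in> carrier N \<Longrightarrow> y' \<in> carrier N \<Longrightarrow>
      \<beta> x (y \<oplus>\<^bsub>N\<^esub> y') = \<beta> x y \<oplus>\<^bsub>H\<^esub> \<beta> x y'"
    and "\<And>x r y. x \<in> carrier M \<Longrightarrow> r \<in> carrier R \<Longrightarrow> y \<in> carrier N \<Longrightarrow>
      \<beta> (ract M x r) y = \<beta> x (lact N r y)"
  shows "balanced_map R M N H \<beta>"
  using assms by (auto simp: balanced_map_def intro!: ahomI)

lemma balanced_mapD:
  assumes "balanced_map R M N H \<beta>"
  shows balanced_map_closed: "x \<in> carrier M \<Longrightarrow> y \<in> carrier N \<Longrightarrow> \<beta> x y \<in> carrier H"
    and balanced_map_ahom_left: "y \<in> carrier N \<Longrightarrow> (\<lambda>x. \<beta> x y) \<in> ahom M H"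
    and balanced_map_ahom_right: "x \<in> carrier M \<Longrightarrow> \<beta> x \<in> ahom N H"
    and balanced_map_add_left: "x \<in> carrier M \<Longrightarrow> x' \<in> carrier M \<Longrightarrow> y \<in> carrier N \<Longrightarrow>
      \<beta> (x \<oplus>\<^bsub>M\<^esub> x') y = \<beta> x y \<oplus>\<^bsub>H\<^esub> \<beta> x' y"
    and balanced_map_add_right: "x \<in> carrier M \<Longrightarrow> y \<in> carrier N \<Longrightarrow> y' \<in> carrier N \<Longrightarrow>
      \<beta> x (y \<oplus>\<^bsub>N\<^esub> y') = \<beta> x y \<oplus>\<^bsub>H\<^esub> \<beta> x y'"
    and balanced_map_ract: "x \<in> carrier M \<Longrightarrow> r \<in> carrier R \<Longrightarrow> y \<in> carrier N \<Longrightarrow>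
      \<beta> (ract M x r) y = \<beta> x (lact N r y)"
  using assms by (auto simp: balanced_map_def hom_def)

lemma balanced_map_comp:
  assumes "balanced_map R M N H \<beta>" "h \<in> ahom H H'"
  shows "balanced_map R M N H' (\<lambda>x y. h (\<beta> x y))"
  by (rule balanced_mapI)
    (simp_all add: balanced_mapD[OF assms(1)] ahom_closed[OF assms(2)] ahom_add[OF assms(2)])

text \<open>Two abelian groups with closed actions of \<open>R\<close> are what it takes for the
  relations to lie in the free abelian group on pairs. One locale thus serves tensor products over
  the ground field, over \<open>B\<close> and over the Beilinson-Green algebras.\<close>

locale tensor_factors = M: abelian_group M + N: abelian_group N
  for R :: "('b, 'z) partial_object_scheme" and M :: "('k, 'a, 'b, 'm) bimodule"
    and N :: "('k, 'b, 'c, 'n) bimodule" +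
  assumes ract_closed: "x \<in> carrier M \<Longrightarrow> r \<in> carrier R \<Longrightarrow> ract M x r \<in> carrier M"
    and lact_closed: "r \<in> carrier R \<Longrightarrow> y \<in> carrier N \<Longrightarrow> lact N r y \<in> carrier N"
begin

abbreviation "F \<equiv> tensor_pairs M N"
abbreviation "rels \<equiv> tensor_rels R M N"
abbreviation "ker \<equiv> tensor_ker R M N"
abbreviation "T \<equiv> tensor R M N"
abbreviation "pt \<equiv> pure_tensor R M N"

lemma F_simps [simp]:
  "c \<in> carrier F \<longleftrightarrow> Poly_Mapping.keys c \<subseteq> carrier M \<times> carrier N"
  "\<one>\<^bsub>F\<^esub> = 0" "c \<otimes>\<^bsub>F\<^esub> c' = c + c'"
  "Poly_Mapping.keys c \<subseteq> carrier M \<times> carrier N \<Longrightarrow> inv\<^bsub>F\<^esub> c = - c"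
  by (simp_all add: tensor_pairs_def)

lemma F_comm_group: "comm_group F"
  unfolding tensor_pairs_def by (rule abelian_free_Abelian_group)

lemma keys_diff_subset:
  fixes a b :: "'u \<Rightarrow>\<^sub>0 int"
  shows "Poly_Mapping.keys a \<subseteq> S \<Longrightarrow> Poly_Mapping.keys b \<subseteq> S \<Longrightarrow> Poly_Mapping.keys (a - b) \<subseteq> S"
  using keys_diff[of a b] by blast

lemma diff_closed: "a \<in> carrier F \<Longrightarrow> b \<in> carrier F \<Longrightarrow> a - b \<in> carrier F"
  by (simp add: keys_diff_subset)

lemma frag_of_closed: "x \<in> carrier M \<Longrightarrow> y \<in> carrier N \<Longrightarrow> frag_of (x, y) \<in> carrier F"
  by simp

lemma rels_carrier: "rels \<subseteq> carrier F"
proof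
  fix c assume "c \<in> rels"
  then show "c \<in> carrier F"
    using diff_closed frag_of_closed
    by (auto simp: tensor_rels_def ract_closed lact_closed simp del: F_simps(1))
qed

lemma rels_intros:
  "x \<in> carrier M \<Longrightarrow> x' \<in> carrier M \<Longrightarrow> y \<in> carrier N \<Longrightarrow>
    frag_of (x \<oplus>\<^bsub>M\<^esub> x', y) - frag_of (x, y) - frag_of (x', y) \<in> rels"
  "x \<in> carrier M \<Longrightarrow> y \<in> carrier N \<Longrightarrow> y' \<in> carrier N \<Longrightarrow>
    frag_of (x, y \<oplus>\<^bsub>N\<^esub> y') - frag_of (x, y) - frag_of (x, y') \<in> rels"
  "x \<in> carrier M \<Longrightarrow> r \<in> carrier R \<Longrightarrow> y \<in> carrier N \<Longrightarrow>
    frag_of (ract M x r, y) - frag_of (x, lact N r y) \<in> rels"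
  by (auto simp: tensor_rels_def)

lemma rels_cases:
  assumes "c \<in> rels"
  obtains (add_left) x x' y where "c = frag_of (x \<oplus>\<^bsub>M\<^esub> x', y) - frag_of (x, y) - frag_of (x', y)"
      "x \<in> carrier M" "x' \<in> carrier M" "y \<in> carrier N"
    | (add_right) x y y' where "c = frag_of (x, y \<oplus>\<^bsub>N\<^esub> y') - frag_of (x, y) - frag_of (x, y')"
      "x \<in> carrier M" "y \<in> carrier N" "y' \<in> carrier N"
    | (balance) x r y where "c = frag_of (ract M x r, y) - frag_of (x, lact N r y)"
      "x \<in> carrier M" "r \<in> carrier R" "y \<in> carrier N"
  using assms unfolding tensor_rels_def by auto

lemma ker_subgroup: "subgroup ker F"
  unfolding tensor_ker_def
  by (rule group.generate_is_subgroup[OF comm_group.axioms(2)[OF F_comm_group] rels_carrier])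

lemma ker_normal: "ker \<lhd> F"
  using comm_group.subgroup_imp_normal[OF F_comm_group ker_subgroup] .

lemma tensor_simps:
  "carrier T = (\<lambda>c. ker #>\<^bsub>F\<^esub> c) ` carrier F"
  "add T = monoid.mult (F Mod ker)" "\<zero>\<^bsub>T\<^esub> = \<one>\<^bsub>F Mod ker\<^esub>"
  "carrier T = carrier (F Mod ker)"
  by (simp_all add: tensor_def Let_def carrier_FactGroup)

lemma abelian_group_tensor: "abelian_group T"
proof -
  interpret Q: comm_group "F Mod ker"
    by (rule comm_group.abelian_FactGroup[OF F_comm_group ker_subgroup])
  have "\<exists>y\<in>carrier (F Mod ker). y \<otimes>\<^bsub>F Mod ker\<^esub> x = \<one>\<^bsub>F Mod ker\<^esub>"
    if "x \<in> carrier (F Mod ker)" for x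
    using Q.l_inv[OF that] Q.inv_closed[OF that] by blast
  then show ?thesis
    by (intro abelian_groupI; unfold tensor_simps(2-4))
      (assumption | rule Q.m_closed Q.one_closed Q.m_assoc Q.m_comm Q.l_one)+
qed

interpretation T: abelian_group T by (rule abelian_group_tensor)

lemma coset_add:
  "c \<in> carrier F \<Longrightarrow> c' \<in> carrier F \<Longrightarrow> (ker #>\<^bsub>F\<^esub> c) \<oplus>\<^bsub>T\<^esub> (ker #>\<^bsub>F\<^esub> c') = ker #>\<^bsub>F\<^esub> (c + c')"
  using normal.rcos_sum[OF ker_normal, of c c'] by (simp add: tensor_simps)

lemma coset_eqI:
  assumes "c \<in> carrier F" "c' \<in> carrier F" "c - c' \<in> ker"
  shows "ker #>\<^bsub>F\<^esub> c = ker #>\<^bsub>F\<^esub> c'"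
proof -
  interpret F: comm_group F by (rule F_comm_group)
  have "c \<in> ker #>\<^bsub>F\<^esub> c'"
    using assms(3) by (auto simp: r_coset_def intro!: bexI[of _ "c - c'"])
  then show ?thesis using F.repr_independence[OF _ assms(2) ker_subgroup] by simp
qed

lemma coset_diff:
  assumes "c \<in> carrier F" "c' \<in> carrier F"
  shows "ker #>\<^bsub>F\<^esub> (c - c') = (ker #>\<^bsub>F\<^esub> c) \<ominus>\<^bsub>T\<^esub> (ker #>\<^bsub>F\<^esub> c')"
proof -
  have d: "c - c' \<in> carrier F" using assms by (simp add: keys_diff_subset)
  have "(ker #>\<^bsub>F\<^esub> (c - c')) \<oplus>\<^bsub>T\<^esub> (ker #>\<^bsub>F\<^esub> c') = ker #>\<^bsub>F\<^esub> c"
    using coset_add[OF d assms(2)] by simp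
  moreover have "\<And>c. c \<in> carrier F \<Longrightarrow> ker #>\<^bsub>F\<^esub> c \<in> carrier T" by (auto simp: tensor_simps(1))
  ultimately show ?thesis
    using d assms by (metis T.add.inv_solve_right a_minus_def)
qed

lemma pure_closed: "x \<in> carrier M \<Longrightarrow> y \<in> carrier N \<Longrightarrow> pt x y \<in> carrier T"
  by (auto simp: pure_tensor_def tensor_simps(1))

lemma pure_add_left:
  assumes "x \<in> carrier M" "x' \<in> carrier M" "y \<in> carrier N"
  shows "pt (x \<oplus>\<^bsub>M\<^esub> x') y = pt x y \<oplus>\<^bsub>T\<^esub> pt x' y"
proof -
  have "frag_of (x \<oplus>\<^bsub>M\<^esub> x', y) - (frag_of (x, y) + frag_of (x', y)) \<in> ker"
    unfolding tensor_ker_def diff_diff_eq[symmetric] using assms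
    by (intro generate.incl) (auto simp: tensor_rels_def)
  moreover have "frag_of (x, y) + frag_of (x', y) \<in> carrier F"
    using assms keys_add[of "frag_of (x, y)" "frag_of (x', y)"] by auto
  ultimately have "ker #>\<^bsub>F\<^esub> frag_of (x \<oplus>\<^bsub>M\<^esub> x', y) = ker #>\<^bsub>F\<^esub> (frag_of (x, y) + frag_of (x', y))"
    using assms by (intro coset_eqI) auto
  then show ?thesis
    unfolding pure_tensor_def using assms by (simp add: coset_add)
qed

lemma pure_add_right:
  assumes "x \<in> carrier M" "y \<in> carrier N" "y' \<in> carrier N"
  shows "pt x (y \<oplus>\<^bsub>N\<^esub> y') = pt x y \<oplus>\<^bsub>T\<^esub> pt x y'"
proof -
  have "frag_of (x, y \<oplus>\<^bsub>N\<^esub> y') - (frag_of (x, y) + frag_of (x, y')) \<in> ker"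
    unfolding tensor_ker_def diff_diff_eq[symmetric] using assms
    by (intro generate.incl) (auto simp: tensor_rels_def)
  moreover have "frag_of (x, y) + frag_of (x, y') \<in> carrier F"
    using assms keys_add[of "frag_of (x, y)" "frag_of (x, y')"] by auto
  ultimately have "ker #>\<^bsub>F\<^esub> frag_of (x, y \<oplus>\<^bsub>N\<^esub> y') = ker #>\<^bsub>F\<^esub> (frag_of (x, y) + frag_of (x, y'))"
    using assms by (intro coset_eqI) auto
  then show ?thesis
    unfolding pure_tensor_def using assms by (simp add: coset_add)
qed

lemma pure_ract:
  assumes "x \<in> carrier M" "r \<in> carrier R" "y \<in> carrier N"
  shows "pt (ract M x r) y = pt x (lact N r y)"
  unfolding pure_tensor_def
proof (rule coset_eqI)
  show "frag_of (ract M x r, y) - frag_of (x, lact N r y) \<in> ker"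
    unfolding tensor_ker_def using assms by (intro generate.incl) (auto simp: tensor_rels_def)
qed (use assms in \<open>auto simp: ract_closed lact_closed\<close>)

lemma balanced_map_pure: "balanced_map R M N T pt"
  by (intro balanced_mapI pure_closed pure_add_left pure_add_right pure_ract)

text \<open>The induction step is a difference because the free abelian group on pairs is built from
  its generators by subtraction; negative coefficients are covered without a case for
  inverses.\<close>

lemma tensor_induct [consumes 1, case_names zero diff pure]:
  assumes "t \<in> carrier T" "P \<zero>\<^bsub>T\<^esub>"
    and diff: "\<And>s t. s \<in> carrier T \<Longrightarrow> t \<in> carrier T \<Longrightarrow> P s \<Longrightarrow> P t \<Longrightarrow> P (s \<ominus>\<^bsub>T\<^esub> t)"
    and pure: "\<And>x y. x \<in> carrier M \<Longrightarrow> y \<in> carrier N \<Longrightarrow> P (pt x y)"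
  shows "P t"
proof -
  obtain c where c: "c \<in> carrier F" "t = ker #>\<^bsub>F\<^esub> c" using assms(1) by (auto simp: tensor_simps(1))
  have "P (ker #>\<^bsub>F\<^esub> c)"
  proof (rule free_Abelian_group_induct[of c "carrier M \<times> carrier N"])
    interpret F: comm_group F by (rule F_comm_group)
    have "ker #>\<^bsub>F\<^esub> 0 = \<zero>\<^bsub>T\<^esub>"
      using F.coset_mult_one[OF subgroup.subset[OF ker_subgroup]] by (simp add: tensor_simps)
    then show "P (ker #>\<^bsub>F\<^esub> 0)" using assms(2) by simp
  next
    fix a b :: "'m \<times> 'n \<Rightarrow>\<^sub>0 int"
    assume *: "Poly_Mapping.keys a \<subseteq> carrier M \<times> carrier N" "Poly_Mapping.keys b \<subseteq> carrier M \<times> carrier N"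
      "P (ker #>\<^bsub>F\<^esub> a)" "P (ker #>\<^bsub>F\<^esub> b)"
    then show "P (ker #>\<^bsub>F\<^esub> (a - b))"
      by (subst coset_diff) (auto intro!: diff simp: tensor_simps(1))
  next
    fix a assume "a \<in> carrier M \<times> carrier N"
    then show "P (ker #>\<^bsub>F\<^esub> frag_of a)"
      using pure[of "fst a" "snd a"] by (auto simp: pure_tensor_def)
  qed (use c in simp)
  then show ?thesis using c by simp
qed

text \<open>Pure tensors generate the group. All later checks of linearity, and of maps being
  inverse to each other, reduce to pure tensors in this way.\<close>

lemma tensor_hom_eqI:
  assumes "abelian_group H" "f \<in> ahom T H" "g \<in> ahom T H" "t \<in> carrier T"
    and "\<And>x y. x \<in> carrier M \<Longrightarrow> y \<in> carrier N \<Longrightarrow> f (pt x y) = g (pt x y)"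
  shows "f t = g t"
  using assms(4)
proof (induction rule: tensor_induct)
  case zero
  then show ?case using ahom_zero[OF abelian_group_tensor assms(1)] assms(2,3) by metis
next
  case (diff s t)
  then show ?case
    by (simp add: a_minus_def ahom_add[OF assms(2)] ahom_add[OF assms(3)]
        ahom_minus[OF abelian_group_tensor assms(1) assms(2)]
        ahom_minus[OF abelian_group_tensor assms(1) assms(3)])
qed (rule assms(5))

text \<open>The map extends to the free abelian group on pairs; biadditivity and balancing say that
  the extension kills every relation, so it descends to the quotient.\<close>

lemma tensor_universal:
  assumes "abelian_group H" "balanced_map R M N H \<beta>"
  obtains h where "h \<in> ahom T H" "\<And>x y. x \<in> carrier M \<Longrightarrow> y \<in> carrier N \<Longrightarrow> h (pt x y) = \<beta> x y"
proof -
  interpret H: abelian_group H by fact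
  interpret F: comm_group F by (rule F_comm_group)
  note [simp] = balanced_mapD[OF assms(2)]
  obtain g where g: "g \<in> hom F (add_monoid H)"
    and g_of: "\<And>z. z \<in> carrier M \<times> carrier N \<Longrightarrow> g (frag_of z) = (\<lambda>(x, y). \<beta> x y) z"
    unfolding tensor_pairs_def
    by (rule H.add.free_Abelian_group_universal[of "\<lambda>(x, y). \<beta> x y" "carrier M \<times> carrier N"]) auto
  interpret g: group_hom F "add_monoid H" g
    using g by (simp add: group_hom_def group_hom_axioms_def H.a_group)
  have gd: "g (a - b) = g a \<ominus>\<^bsub>H\<^esub> g b" if "a \<in> carrier F" "b \<in> carrier F" for a b
  proof -
    have "g (a - b) \<oplus>\<^bsub>H\<^esub> g b = g a"
      using g.hom_mult[of "a - b" b] that by (simp add: keys_diff_subset)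
    then show ?thesis
      using that g.hom_closed keys_diff_subset
      by (metis (no_types, lifting) F_simps(1) H.add.inv_solve_right a_minus_def partial_object.simps(1))
  qed
  \<comment> \<open>What remains of a biadditivity relation after \<open>g\<close> has been applied
    to it.\<close>
  have cancel: "p \<oplus>\<^bsub>H\<^esub> q \<ominus>\<^bsub>H\<^esub> p \<ominus>\<^bsub>H\<^esub> q = \<zero>\<^bsub>H\<^esub>" if "p \<in> carrier H" "q \<in> carrier H" for p q
    using that H.r_neg[of "p \<oplus>\<^bsub>H\<^esub> q"] by (simp add: H.minus_eq H.minus_add H.a_assoc)
  have "rels \<subseteq> kernel F (add_monoid H) g"
  proof
    fix c assume c: "c \<in> rels"
    then have "c \<in> carrier F" using rels_carrier by blast
    moreover have "g c = \<zero>\<^bsub>H\<^esub>"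
      using c
      by (cases rule: rels_cases)
        (simp_all add: gd g_of keys_diff_subset ract_closed lact_closed cancel H.r_neg H.minus_eq[of p p for p])
    ultimately show "c \<in> kernel F (add_monoid H) g" by (simp add: kernel_def)
  qed
  then have ker: "ker \<subseteq> kernel F (add_monoid H) g"
    unfolding tensor_ker_def by (rule F.generate_subgroup_incl[OF _ g.subgroup_kernel])
  obtain h where h: "h \<in> hom (F Mod ker) (add_monoid H)"
    and hc: "\<And>c. c \<in> carrier F \<Longrightarrow> h (ker #>\<^bsub>F\<^esub> c) = g c"
    using g.FactGroup_universal_kernel[OF ker_normal ker] by metis
  show thesis
  proof
    show "h \<in> ahom T H"
      using h by (simp add: hom_def tensor_simps(2,4))
    fix x y assume "x \<in> carrier M" "y \<in> carrier N"
    then show "h (pt x y) = \<beta> x y"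
      by (simp add: pure_tensor_def hc g_of)
  qed
qed

text \<open>\<open>tensor_map\<close> is a union of cosets over all representatives. The map induced
  on formal sums sends each relation to a relation of the same kind, so these cosets coincide and
  the union is a single coset.\<close>

lemma tensor_map_ahom:
  assumes f: "f \<in> ahom M M" "\<And>x r. x \<in> carrier M \<Longrightarrow> r \<in> carrier R \<Longrightarrow> f (ract M x r) = ract M (f x) r"
    and g: "g \<in> ahom N N" "\<And>y r. y \<in> carrier N \<Longrightarrow> r \<in> carrier R \<Longrightarrow> g (lact N r y) = lact N r (g y)"
  shows "tensor_map R M N f g \<in> ahom T T" (is ?ahom)
    and "\<And>x y. x \<in> carrier M \<Longrightarrow> y \<in> carrier N \<Longrightarrow> tensor_map R M N f g (pt x y) = pt (f x) (g y)"
proof -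
  interpret F: comm_group F by (rule F_comm_group)
  define E where "E = frag_extend (\<lambda>(x, y). frag_of (f x, g y))"
  have [simp]: "\<And>x. x \<in> carrier M \<Longrightarrow> f x \<in> carrier M" "\<And>y. y \<in> carrier N \<Longrightarrow> g y \<in> carrier N"
    using f(1) g(1) by (auto simp: hom_def)
  have Ec: "E c \<in> carrier F" if "c \<in> carrier F" for c
    using that keys_frag_extend[of "\<lambda>(x, y). frag_of (f x, g y)" c] by (fastforce simp: E_def)
  have Ea: "E (a + b) = E a + E b" and Ed: "E (a - b) = E a - E b" for a b
    by (simp_all add: E_def frag_extend_add frag_extend_diff)
  have E_of: "E (frag_of (x, y)) = frag_of (f x, g y)" for x y by (simp add: E_def)
  have Ehom: "E \<in> hom F F" using Ec Ea by (auto simp: hom_def simp del: F_simps(1))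
  interpret E: group_hom F F E
    using Ehom by (simp add: group_hom_def group_hom_axioms_def F.is_group)
  have "E ` rels \<subseteq> rels"
  proof (rule image_subsetI)
    fix c assume "c \<in> rels"
    then show "E c \<in> rels"
    proof (cases rule: rels_cases)
      case (add_left x x' y)
      then show ?thesis using rels_intros(1)[of "f x" "f x'" "g y"]
        by (simp add: Ed E_of ahom_add[OF f(1)])
    next
      case (add_right x y y')
      then show ?thesis using rels_intros(2)[of "f x" "g y" "g y'"]
        by (simp add: Ed E_of ahom_add[OF g(1)])
    next
      case (balance x r y)
      then show ?thesis using rels_intros(3)[of "f x" r "g y"]
        by (simp add: Ed E_of f(2) g(2))
    qed
  qed
  then have "generate F (E ` rels) \<subseteq> ker"
    unfolding tensor_ker_def by (rule F.mono_generate)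
  then have Ek: "E c \<in> ker" if "c \<in> ker" for c
    using that E.generate_img[OF rels_carrier] unfolding tensor_ker_def by auto
  have tm: "tensor_map R M N f g (ker #>\<^bsub>F\<^esub> c) = ker #>\<^bsub>F\<^esub> E c" if c: "c \<in> carrier F" for c
  proof -
    \<comment> \<open>Another representative differs from \<open>c\<close> by some \<open>k\<close>
      in the kernel, and \<open>E k\<close> lies in the kernel again.\<close>
    have "ker #>\<^bsub>F\<^esub> E t = ker #>\<^bsub>F\<^esub> E c" if "t \<in> ker #>\<^bsub>F\<^esub> c" for t
    proof -
      from that obtain k where k: "k \<in> ker" "t = k + c" by (auto simp: r_coset_def)
      then have "k \<in> carrier F" using subgroup.subset[OF ker_subgroup] by blast
      with c k have "t \<in> carrier F" using F.m_closed by auto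
      then show ?thesis using k c Ec[of t] Ec[of c] Ek by (intro coset_eqI) (simp_all add: Ea)
    qed
    moreover have "c \<in> ker #>\<^bsub>F\<^esub> c" using F.rcos_self[OF c ker_subgroup] .
    ultimately show ?thesis
      unfolding tensor_map_def E_def[symmetric] by blast
  qed
  show ?ahom
  proof (rule ahomI)
    fix s assume "s \<in> carrier T"
    then show "tensor_map R M N f g s \<in> carrier T" using Ec tm by (auto simp: tensor_simps(1))
  next
    fix s t assume "s \<in> carrier T" "t \<in> carrier T"
    then obtain a b where ab: "a \<in> carrier F" "b \<in> carrier F" "s = ker #>\<^bsub>F\<^esub> a" "t = ker #>\<^bsub>F\<^esub> b"
      by (auto simp: tensor_simps(1))
    moreover have "a + b \<in> carrier F" using F.m_closed[OF ab(1,2)] by simp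
    ultimately show "tensor_map R M N f g (s \<oplus>\<^bsub>T\<^esub> t) = tensor_map R M N f g s \<oplus>\<^bsub>T\<^esub> tensor_map R M N f g t"
      using coset_add tm Ec Ea by simp
  qed
  fix x y assume "x \<in> carrier M" "y \<in> carrier N"
  then show "tensor_map R M N f g (pt x y) = pt (f x) (g y)"
    unfolding pure_tensor_def by (subst tm) (auto simp: E_of)
qed

end

section \<open>Bimodule structure on tensor products\<close>

locale tensor_biact = tensor_factors R M N + M: biact A R M + N: biact R C N
  for A :: "('a, 'y) partial_object_scheme" and R :: "('b, 'z) partial_object_scheme"
    and C :: "('c, 'w) partial_object_scheme" and M :: "('k, 'a, 'b, 'm) bimodule"
    and N :: "('k, 'b, 'c, 'n) bimodule" +
  assumes M_lact_ract: "a \<in> carrier A \<Longrightarrow> x \<in> carrier M \<Longrightarrow> r \<in> carrier R \<Longrightarrow>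
      ract M (lact M a x) r = lact M a (ract M x r)"
    and N_lact_ract: "r \<in> carrier R \<Longrightarrow> y \<in> carrier N \<Longrightarrow> c \<in> carrier C \<Longrightarrow>
      ract N (lact N r y) c = lact N r (ract N y c)"
begin

lemma tensor_lact:
  assumes "a \<in> carrier A"
  shows "lact T a \<in> ahom T T"
    and "x \<in> carrier M \<Longrightarrow> y \<in> carrier N \<Longrightarrow> lact T a (pt x y) = pt (lact M a x) y"
proof -
  have "lact T a = tensor_map R M N (lact M a) (\<lambda>y. y)"
    by (simp add: tensor_def Let_def)
  moreover have "(\<lambda>y. y) \<in> ahom N N" by (rule ahomI) simp_all
  ultimately show "lact T a \<in> ahom T T"
    "x \<in> carrier M \<Longrightarrow> y \<in> carrier N \<Longrightarrow> lact T a (pt x y) = pt (lact M a x) y"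
    using tensor_map_ahom[of "lact M a" "\<lambda>y. y"] assms M.lact_ahom M_lact_ract by auto
qed

lemma tensor_ract:
  assumes "c \<in> carrier C"
  shows "(\<lambda>t. ract T t c) \<in> ahom T T"
    and "x \<in> carrier M \<Longrightarrow> y \<in> carrier N \<Longrightarrow> ract T (pt x y) c = pt x (ract N y c)"
proof -
  have "(\<lambda>t. ract T t c) = tensor_map R M N (\<lambda>x. x) (\<lambda>y. ract N y c)"
    by (simp add: tensor_def Let_def)
  moreover from this have "\<And>t. ract T t c = tensor_map R M N (\<lambda>x. x) (\<lambda>y. ract N y c) t" by metis
  moreover have "(\<lambda>x. x) \<in> ahom M M" by (rule ahomI) simp_all
  ultimately show "(\<lambda>t. ract T t c) \<in> ahom T T"
    "x \<in> carrier M \<Longrightarrow> y \<in> carrier N \<Longrightarrow> ract T (pt x y) c = pt x (ract N y c)"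
    using tensor_map_ahom[of "\<lambda>x. x" "\<lambda>y. ract N y c"] assms N.ract_ahom N_lact_ract by auto
qed

lemma biact_tensor: "biact A C T"
  using abelian_group_tensor tensor_lact(1) tensor_ract(1) by (auto simp: biact_def biact_axioms_def)

lemma tensor_bihom:
  assumes "biact A C H" "balanced_map R M N H \<beta>"
    and "\<And>a x y. a \<in> carrier A \<Longrightarrow> x \<in> carrier M \<Longrightarrow> y \<in> carrier N \<Longrightarrow> \<beta> (lact M a x) y = lact H a (\<beta> x y)"
    and "\<And>x y c. x \<in> carrier M \<Longrightarrow> y \<in> carrier N \<Longrightarrow> c \<in> carrier C \<Longrightarrow> \<beta> x (ract N y c) = ract H (\<beta> x y) c"
  obtains h where "h \<in> bihom A C T H" "\<And>x y. x \<in> carrier M \<Longrightarrow> y \<in> carrier N \<Longrightarrow> h (pt x y) = \<beta> x y"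
proof -
  interpret H: biact A C H by fact
  obtain h where h: "h \<in> ahom T H"
    and hp: "\<And>x y. x \<in> carrier M \<Longrightarrow> y \<in> carrier N \<Longrightarrow> h (pt x y) = \<beta> x y"
    using tensor_universal[OF H.abelian_group assms(2)] by blast
  show thesis
  proof (rule that[OF bihomI])
    fix a t assume a: "a \<in> carrier A" and t: "t \<in> carrier T"
    show "h (lact T a t) = lact H a (h t)"
      by (rule tensor_hom_eqI[OF H.abelian_group ahom_comp[OF tensor_lact(1)[OF a] h]
            ahom_comp[OF h H.lact_ahom[OF a]] t])
        (simp add: tensor_lact(2)[OF a] hp assms(3) a M.lact_closed)
  next
    fix t c assume c: "c \<in> carrier C" and t: "t \<in> carrier T"
    show "h (ract T t c) = ract H (h t) c"
      by (rule tensor_hom_eqI[OF H.abelian_group ahom_comp[OF tensor_ract(1)[OF c] h]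
            ahom_comp[OF h H.ract_ahom[OF c]] t])
        (simp add: tensor_ract(2)[OF c] hp assms(4) c N.ract_closed)
  qed (use h hp in auto)
qed

end

text \<open>Functoriality of the tensor product, the inverse maps inducing the inverse. It is called
  for because the bimodules of the final equivalence are isomorphic copies of the matrix
  bimodules.\<close>

lemma tensor_biiso:
  assumes "tensor_biact A R C M N" "tensor_biact A R C M' N'"
    and f: "f \<in> biiso A R M M'" and g: "g \<in> biiso R C N N'"
  shows "biiso A C (tensor R M N) (tensor R M' N') \<noteq> {}"
proof -
  interpret t: tensor_biact A R C M N by fact
  interpret t': tensor_biact A R C M' N' by fact
  have f_bihom: "f \<in> bihom A R M M'" and g_bihom: "g \<in> bihom R C N N'"
    using f g by (auto simp: biiso_def)
  let ?f = "inv_into (carrier M) f" and ?g = "inv_into (carrier N) g"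
  have f'_bihom: "?f \<in> bihom A R M' M" and g'_bihom: "?g \<in> bihom R C N' N"
    using biiso_inv[OF t.M.biact_axioms f] biiso_inv[OF t.N.biact_axioms g] by (auto simp: biiso_def)
  note [simp] = bihomD[OF f_bihom] bihomD[OF g_bihom] bihomD[OF f'_bihom] bihomD[OF g'_bihom]
  have inv: "\<And>x. x \<in> carrier M \<Longrightarrow> ?f (f x) = x" "\<And>x. x \<in> carrier M' \<Longrightarrow> f (?f x) = x"
    "\<And>x. x \<in> carrier N \<Longrightarrow> ?g (g x) = x" "\<And>x. x \<in> carrier N' \<Longrightarrow> g (?g x) = x"
    using f g by (auto simp: biiso_def bij_betw_def f_inv_into_f)
  obtain h where h: "h \<in> bihom A C t.T t'.T"
    and hp: "\<And>x y. x \<in> carrier M \<Longrightarrow> y \<in> carrier N \<Longrightarrow> h (t.pt x y) = t'.pt (f x) (g y)"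
    by (rule t.tensor_bihom[OF t'.biact_tensor, of "\<lambda>x y. t'.pt (f x) (g y)"])
      (auto intro!: balanced_mapI simp: t'.pure_closed t'.pure_add_left t'.pure_add_right t'.pure_ract
        t'.tensor_lact t'.tensor_ract)
  obtain h' where h': "h' \<in> bihom A C t'.T t.T"
    and hp': "\<And>x y. x \<in> carrier M' \<Longrightarrow> y \<in> carrier N' \<Longrightarrow> h' (t'.pt x y) = t.pt (?f x) (?g y)"
    by (rule t'.tensor_bihom[OF t.biact_tensor, of "\<lambda>x y. t.pt (?f x) (?g y)"])
      (auto intro!: balanced_mapI simp: t.pure_closed t.pure_add_left t.pure_add_right t.pure_ract
        t.tensor_lact t.tensor_ract)
  have id: "(\<lambda>x. x) \<in> ahom X X" for X :: "('u, 'v) ring_scheme" by (rule ahomI) simp_all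
  have "h' (h t) = t" if "t \<in> carrier t.T" for t
    by (rule t.tensor_hom_eqI[OF t.abelian_group_tensor
          ahom_comp[OF bihom_ahom[OF h] bihom_ahom[OF h']] id that])
      (simp add: hp hp' inv)
  moreover have "h (h' t) = t" if "t \<in> carrier t'.T" for t
    by (rule t'.tensor_hom_eqI[OF t'.abelian_group_tensor
          ahom_comp[OF bihom_ahom[OF h'] bihom_ahom[OF h]] id that])
      (simp add: hp hp' inv)
  ultimately have "bij_betw h (carrier t.T) (carrier t'.T)"
    by (intro bij_betwI[of _ _ _ h']) (auto simp: bihomD[OF h] bihomD[OF h'])
  then show ?thesis using h by (auto simp: biiso_def)
qed


section \<open>Gradings\<close>

context
  fixes K :: "('k, 'x) ring_scheme" and V :: "('k, 'v, 'z) module_scheme" and g :: "nat \<Rightarrow> 'v set"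
  assumes module: "module K V" and grading: "grading K V g"
begin

interpretation V: module K V by (rule module)

lemma grading_submodule: "submodule (g d) K V"
  using grading by (auto simp: grading_def)

lemma grading_carrier: "v \<in> g d \<Longrightarrow> v \<in> carrier V"
  using V.submoduleE(1)[OF grading_submodule] by blast

lemma grading_zero: "\<zero>\<^bsub>V\<^esub> \<in> g d"
  using subgroup.one_closed[OF submodule.axioms(1)[OF grading_submodule[of d]]] by simp

lemma grading_add: "v \<in> g d \<Longrightarrow> w \<in> g d \<Longrightarrow> v \<oplus>\<^bsub>V\<^esub> w \<in> g d"
  using V.submoduleE(5)[OF grading_submodule] .

lemma grading_minus: "v \<in> g d \<Longrightarrow> \<ominus>\<^bsub>V\<^esub> v \<in> g d"
  using V.submoduleE(3)[OF grading_submodule] .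

lemma grading_smult: "c \<in> carrier K \<Longrightarrow> v \<in> g d \<Longrightarrow> c \<odot>\<^bsub>V\<^esub> v \<in> g d"
  using V.submoduleE(4)[OF grading_submodule] .

end

section \<open>Projections onto homogeneous components\<close>

definition homogeneous_part :: "('v, 'z) ring_scheme \<Rightarrow> (nat \<Rightarrow> 'v set) \<Rightarrow> nat \<Rightarrow> 'v \<Rightarrow> 'v" where
  "homogeneous_part V g d v = (THE x. (\<forall>i. x i \<in> g i) \<and> finite {i. x i \<noteq> \<zero>\<^bsub>V\<^esub>} \<and>
     v = (\<Oplus>\<^bsub>V\<^esub>i\<in>{i. x i \<noteq> \<zero>\<^bsub>V\<^esub>}. x i)) d"

context
  fixes K :: "('k, 'x) ring_scheme" and V :: "('k, 'v, 'z) module_scheme" and g :: "nat \<Rightarrow> 'v set"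
    and n :: nat
  assumes module: "module K V" and grading: "grading K V g" and deg: "degree_le n V g"
begin

interpretation V: module K V by (rule module)

text \<open>Under the degree bound the supports, which vary with the element, can all be replaced by
  \<open>{..n}\<close>. Over this fixed index set decompositions add termwise, which makes the
  projections additive.\<close>

lemma homogeneous_support:
  assumes "\<And>i. x i \<in> g i"
  shows "{i. x i \<noteq> \<zero>\<^bsub>V\<^esub>} \<subseteq> {..n}"
    and "(\<Oplus>\<^bsub>V\<^esub>i\<in>{i. x i \<noteq> \<zero>\<^bsub>V\<^esub>}. x i) = (\<Oplus>\<^bsub>V\<^esub>i\<in>{..n}. x i)"
proof -
  show s: "{i. x i \<noteq> \<zero>\<^bsub>V\<^esub>} \<subseteq> {..n}"
    using assms deg by (force simp: degree_le_def not_le[symmetric])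
  show "(\<Oplus>\<^bsub>V\<^esub>i\<in>{i. x i \<noteq> \<zero>\<^bsub>V\<^esub>}. x i) = (\<Oplus>\<^bsub>V\<^esub>i\<in>{..n}. x i)"
    using s assms grading_carrier[OF module grading]
    by (intro V.add.finprod_mono_neutral_cong_left) auto
qed

lemma homogeneous_part_eqI:
  assumes "\<And>i. x i \<in> g i" "v = (\<Oplus>\<^bsub>V\<^esub>i\<in>{..n}. x i)"
  shows "homogeneous_part V g d v = x d"
proof -
  have v: "v \<in> carrier V"
    unfolding assms(2) using assms(1) grading_carrier[OF module grading] by (intro V.finsum_closedI) auto
  have "(THE x. (\<forall>i. x i \<in> g i) \<and> finite {i. x i \<noteq> \<zero>\<^bsub>V\<^esub>} \<and>
     v = (\<Oplus>\<^bsub>V\<^esub>i\<in>{i. x i \<noteq> \<zero>\<^bsub>V\<^esub>}. x i)) = x"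
    using grading v homogeneous_support[OF assms(1)] assms
    by (intro the1_equality) (auto simp: grading_def intro: finite_subset)
  then show ?thesis by (simp add: homogeneous_part_def)
qed

lemma homogeneous_part:
  assumes "v \<in> carrier V"
  shows homogeneous_part_in: "homogeneous_part V g d v \<in> g d"
    and homogeneous_part_sum: "(\<Oplus>\<^bsub>V\<^esub>d\<in>{..n}. homogeneous_part V g d v) = v"
proof -
  obtain x where x: "\<And>i. x i \<in> g i" "v = (\<Oplus>\<^bsub>V\<^esub>i\<in>{i. x i \<noteq> \<zero>\<^bsub>V\<^esub>}. x i)"
    using grading assms unfolding grading_def by metis
  with homogeneous_support[OF x(1)] have eq: "v = (\<Oplus>\<^bsub>V\<^esub>i\<in>{..n}. x i)" by simp
  then have "\<And>d. homogeneous_part V g d v = x d" using x(1) by (intro homogeneous_part_eqI) auto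
  then show "homogeneous_part V g d v \<in> g d" "(\<Oplus>\<^bsub>V\<^esub>d\<in>{..n}. homogeneous_part V g d v) = v"
    using x(1) eq by simp_all
qed

lemma homogeneous_part_closed: "v \<in> carrier V \<Longrightarrow> homogeneous_part V g d v \<in> carrier V"
  using homogeneous_part_in grading_carrier[OF module grading] by blast

lemma homogeneous_part_ahom: "homogeneous_part V g d \<in> ahom V V"
proof (intro ahomI homogeneous_part_closed)
  fix v w assume *: "v \<in> carrier V" "w \<in> carrier V"
  show "homogeneous_part V g d (v \<oplus>\<^bsub>V\<^esub> w) = homogeneous_part V g d v \<oplus>\<^bsub>V\<^esub> homogeneous_part V g d w"
    using * homogeneous_part_sum homogeneous_part_closed
    by (intro homogeneous_part_eqI)
      (simp_all add: grading_add[OF module grading] homogeneous_part_in V.finsum_addI)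
qed

lemma homogeneous_part_smult:
  assumes "c \<in> carrier K" "v \<in> carrier V"
  shows "homogeneous_part V g d (c \<odot>\<^bsub>V\<^esub> v) = c \<odot>\<^bsub>V\<^esub> homogeneous_part V g d v"
  using assms homogeneous_part_sum homogeneous_part_closed
  by (intro homogeneous_part_eqI)
    (simp_all add: grading_smult[OF module grading] homogeneous_part_in
      V.finsum_smult_ldistr[symmetric])

lemma homogeneous_part_homogeneous:
  assumes "v \<in> g e"
  shows "homogeneous_part V g d v = (if d = e then v else \<zero>\<^bsub>V\<^esub>)"
proof (rule homogeneous_part_eqI[where x = "\<lambda>d. if d = e then v else \<zero>\<^bsub>V\<^esub>"])
  show "v = (\<Oplus>\<^bsub>V\<^esub>i\<in>{..n}. if i = e then v else \<zero>\<^bsub>V\<^esub>)"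
  proof (cases "e \<le> n")
    case True
    then show ?thesis
      using assms grading_carrier[OF module grading]
      by (subst V.finsum_single[of _ e]) auto
  next
    case False
    with assms deg have "v = \<zero>\<^bsub>V\<^esub>" by (auto simp: degree_le_def)
    then show ?thesis by (simp add: V.finsum_zeroI)
  qed
qed (use assms grading_zero[OF module grading] in auto)

end

text \<open>The definition of a graded algebra leaves this to be proved. For \<open>a\<close> of
  degree \<open>d\<close>, comparing the degree \<open>d\<close> parts of \<open>a\<close> and of
  the unit times \<open>a\<close> shows that the degree zero part \<open>?e\<close> of the unit
  fixes \<open>a\<close> from the left.\<close>

lemma graded_algebra_one:
  assumes "graded_algebra K n A gA"
  shows "\<one>\<^bsub>A\<^esub> \<in> gA 0"
proof -
  from assms have A: "fd_algebra K A" and gr: "grading K A gA" and deg: "degree_le n A gA"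
    and gm: "\<And>i j a b. a \<in> gA i \<Longrightarrow> b \<in> gA j \<Longrightarrow> a \<otimes>\<^bsub>A\<^esub> b \<in> gA (i + j)"
    by (auto simp: graded_algebra_def)
  interpret A: fd_algebra K A by fact
  have mod: "module K A" ..
  note [simp] = homogeneous_part_closed[OF mod gr deg]
  let ?h = "homogeneous_part A gA"
  let ?e = "?h 0 \<one>\<^bsub>A\<^esub>"
  have id: "?e \<otimes>\<^bsub>A\<^esub> a = a" if a: "a \<in> gA d" for a d
  proof -
    have c: "a \<in> carrier A" using grading_carrier[OF mod gr a] .
    have ah: "(\<lambda>x. ?h d (x \<otimes>\<^bsub>A\<^esub> a)) \<in> ahom A A"
      using c by (intro ahom_comp[OF _ homogeneous_part_ahom[OF mod gr deg]] ahomI) (auto simp: A.l_distr)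
    have hh: "?h d (?h i \<one>\<^bsub>A\<^esub> \<otimes>\<^bsub>A\<^esub> a) = (if i = 0 then ?h i \<one>\<^bsub>A\<^esub> \<otimes>\<^bsub>A\<^esub> a else \<zero>\<^bsub>A\<^esub>)" for i
      using homogeneous_part_homogeneous[OF mod gr deg
          gm[OF homogeneous_part_in[OF mod gr deg A.one_closed] a], of d i] by simp
    have "a = ?h d (\<one>\<^bsub>A\<^esub> \<otimes>\<^bsub>A\<^esub> a)"
      using homogeneous_part_homogeneous[OF mod gr deg a] c by simp
    also have "\<dots> = ?h d ((\<Oplus>\<^bsub>A\<^esub>i\<in>{..n}. ?h i \<one>\<^bsub>A\<^esub>) \<otimes>\<^bsub>A\<^esub> a)"
      using homogeneous_part_sum[OF mod gr deg] by simp
    also have "\<dots> = (\<Oplus>\<^bsub>A\<^esub>i\<in>{..n}. ?h d (?h i \<one>\<^bsub>A\<^esub> \<otimes>\<^bsub>A\<^esub> a))"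
      by (rule ahom_finsum[OF A.is_abelian_group A.is_abelian_group ah]) auto
    also have "\<dots> = ?h d (?e \<otimes>\<^bsub>A\<^esub> a)"
      using c hh by (subst A.finsum_single[of _ 0]) auto
    also have "\<dots> = ?e \<otimes>\<^bsub>A\<^esub> a"
      by (simp add: hh)
    finally show ?thesis by simp
  qed
  \<comment> \<open>Multiplied with the components of the unit one by one, \<open>?e\<close> fixes
    each of them and so returns the unit.\<close>
  have "?e = ?e \<otimes>\<^bsub>A\<^esub> (\<Oplus>\<^bsub>A\<^esub>i\<in>{..n}. ?h i \<one>\<^bsub>A\<^esub>)"
    by (simp add: homogeneous_part_sum[OF mod gr deg])
  also have "\<dots> = (\<Oplus>\<^bsub>A\<^esub>i\<in>{..n}. ?e \<otimes>\<^bsub>A\<^esub> ?h i \<one>\<^bsub>A\<^esub>)"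
    by (subst A.finsum_rdistr) auto
  also have "\<dots> = \<one>\<^bsub>A\<^esub>"
    by (simp add: id[OF homogeneous_part_in[OF mod gr deg]] homogeneous_part_sum[OF mod gr deg])
  finally show ?thesis using homogeneous_part_in[OF mod gr deg A.one_closed, of 0] by simp
qed


section \<open>Constructions on bimodules\<close>

lemma bimodule_biact: "bimodule K A B M \<Longrightarrow> biact A B M"
proof -
  assume "bimodule K A B M"
  then interpret M: bimodule K A B M .
  show ?thesis
    by unfold_locales
      (auto intro!: ahomI simp: M.lact_closed M.ract_closed M.lact_add_right M.ract_add_left)
qed

lemma (in bimodule) lact_ahom_left: "abelian_group A \<Longrightarrow> x \<in> carrier M \<Longrightarrow> (\<lambda>a. lact M a x) \<in> ahom A M"
  by (auto intro!: ahomI simp: lact_closed lact_add_left)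

lemma (in bimodule) ract_ahom_right: "abelian_group B \<Longrightarrow> x \<in> carrier M \<Longrightarrow> ract M x \<in> ahom B M"
  by (auto intro!: ahomI simp: ract_closed ract_add_right)

lemma as_left_simps [simp]:
  "carrier (as_left M) = carrier M" "add (as_left M) = add M" "\<zero>\<^bsub>as_left M\<^esub> = \<zero>\<^bsub>M\<^esub>"
  "smult (as_left M) = smult M" "lact (as_left M) = lact M" "ract (as_left M) x c = c \<odot>\<^bsub>M\<^esub> x"
  by (simp_all add: as_left_def)

lemma as_right_simps [simp]:
  "carrier (as_right M) = carrier M" "add (as_right M) = add M" "\<zero>\<^bsub>as_right M\<^esub> = \<zero>\<^bsub>M\<^esub>"
  "smult (as_right M) = smult M" "lact (as_right M) = smult M" "ract (as_right M) = ract M"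
  by (simp_all add: as_right_def)

lemma regular_simps [simp]:
  "carrier (regular A) = carrier A" "add (regular A) = add A" "\<zero>\<^bsub>regular A\<^esub> = \<zero>\<^bsub>A\<^esub>"
  "smult (regular A) = smult A" "lact (regular A) = monoid.mult A" "ract (regular A) = monoid.mult A"
  by (simp_all add: regular_def)

lemma dsum_simps [simp]:
  "carrier (dsum X Y) = carrier X \<times> carrier Y" "\<zero>\<^bsub>dsum X Y\<^esub> = (\<zero>\<^bsub>X\<^esub>, \<zero>\<^bsub>Y\<^esub>)"
  "p \<oplus>\<^bsub>dsum X Y\<^esub> q = (fst p \<oplus>\<^bsub>X\<^esub> fst q, snd p \<oplus>\<^bsub>Y\<^esub> snd q)"
  "c \<odot>\<^bsub>dsum X Y\<^esub> p = (c \<odot>\<^bsub>X\<^esub> fst p, c \<odot>\<^bsub>Y\<^esub> snd p)"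
  "lact (dsum X Y) a p = (lact X a (fst p), lact Y a (snd p))"
  "ract (dsum X Y) p b = (ract X (fst p) b, ract Y (snd p) b)"
  by (simp_all add: dsum_def split_beta)

lemma abelian_group_as_left: "abelian_group M \<Longrightarrow> abelian_group (as_left M)"
  by (rule abelian_group_cong) simp_all

lemma abelian_group_as_right: "abelian_group M \<Longrightarrow> abelian_group (as_right M)"
  by (rule abelian_group_cong) simp_all

lemma finsum_as_left: "finsum (as_left M) f I = finsum M f I"
  by (rule finsum_add_monoid_cong) simp_all

lemma finsum_as_right: "finsum (as_right M) f I = finsum M f I"
  by (rule finsum_add_monoid_cong) simp_all

lemma finsum_regular: "finsum (regular A) f I = finsum A f I"
  by (rule finsum_add_monoid_cong) simp_all

lemma biact_as_left:
  assumes "bimodule K A B M" shows "biact A K (as_left M)"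
proof -
  interpret M: bimodule K A B M by fact
  show ?thesis
    using abelian_group_as_left[OF M.abelian_group_axioms]
    by (intro biact.intro biact_axioms.intro ahomI)
      (auto simp: M.lact_closed M.lact_add_right M.smult_r_distr)
qed

lemma biact_as_right:
  assumes "bimodule K A B M" shows "biact K B (as_right M)"
proof -
  interpret M: bimodule K A B M by fact
  show ?thesis
    using abelian_group_as_right[OF M.abelian_group_axioms]
    by (intro biact.intro biact_axioms.intro ahomI)
      (auto simp: M.ract_closed M.ract_add_left M.smult_r_distr)
qed

lemma bimodule_regular:
  assumes "fd_algebra K A" shows "bimodule K A A (regular A)"
proof -
  interpret A: fd_algebra K A by fact
  have ab: "abelian_group (regular A)"
    by (rule abelian_group_cong[OF A.is_abelian_group]) simp_all
  show ?thesis
    by (intro bimodule.intro moduleI bimodule_axioms.intro)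
      (use ab A.R.is_cring in \<open>auto simp: A.smult_l_distr A.smult_r_distr A.smult_assoc1
        A.l_distr A.r_distr A.m_assoc A.smult_mult_left A.smult_mult_right\<close>)
qed

lemma bimodule_dsum:
  assumes "bimodule K A B X" "bimodule K A B Y" shows "bimodule K A B (dsum X Y)"
proof -
  interpret X: bimodule K A B X by fact
  interpret Y: bimodule K A B Y by fact
  have ab: "abelian_group (dsum X Y)"
  proof (rule abelian_groupI)
    fix p assume "p \<in> carrier (dsum X Y)"
    then show "\<exists>q\<in>carrier (dsum X Y). q \<oplus>\<^bsub>dsum X Y\<^esub> p = \<zero>\<^bsub>dsum X Y\<^esub>"
      by (intro bexI[of _ "(\<ominus>\<^bsub>X\<^esub> fst p, \<ominus>\<^bsub>Y\<^esub> snd p)"]) (auto simp: X.M.l_neg Y.M.l_neg)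
  qed (auto simp: X.M.a_ac Y.M.a_ac)
  show ?thesis
    by (intro bimodule.intro moduleI bimodule_axioms.intro)
      (use ab X.R.is_cring in \<open>auto simp: X.smult_l_distr X.smult_r_distr X.smult_assoc1
        Y.smult_l_distr Y.smult_r_distr Y.smult_assoc1
        X.lact_closed Y.lact_closed X.ract_closed Y.ract_closed
        X.lact_one Y.lact_one X.ract_one Y.ract_one
        X.lact_add_left Y.lact_add_left X.lact_add_right Y.lact_add_right
        X.ract_add_left Y.ract_add_left X.ract_add_right Y.ract_add_right
        X.lact_mult Y.lact_mult X.ract_mult Y.ract_mult X.lact_ract Y.lact_ract
        X.lact_smult Y.lact_smult X.ract_smult Y.ract_smult\<close>)
qed


section \<open>Triangular matrices over graded bimodules\<close>

text \<open>With the zero entries built in, every matrix sum can run over all of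
  \<open>{..n}\<close>, although only middle indices between row and column contribute.\<close>

definition entry :: "nat \<Rightarrow> ('m, 'z) ring_scheme \<Rightarrow> (nat \<Rightarrow> 'm set) \<Rightarrow> nat \<Rightarrow> nat \<Rightarrow> 'm set" where
  "entry n M gM i j = (if i \<le> j \<and> j \<le> n then gM (j - i) else {\<zero>\<^bsub>M\<^esub>})"

definition bg_bimodule :: "nat \<Rightarrow> ('k, 'a, 'b, 'm) bimodule \<Rightarrow> (nat \<Rightarrow> 'm set) \<Rightarrow>
    ('k, nat \<Rightarrow> nat \<Rightarrow> 'a, nat \<Rightarrow> nat \<Rightarrow> 'b, nat \<Rightarrow> nat \<Rightarrow> 'm) bimodule" where
  "bg_bimodule n M gM =
     \<lparr>carrier = {X. \<forall>i j. X i j \<in> entry n M gM i j}, monoid.mult = undefined, one = undefined,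
      ring.zero = (\<lambda>i j. \<zero>\<^bsub>M\<^esub>), add = (\<lambda>X Y i j. X i j \<oplus>\<^bsub>M\<^esub> Y i j),
      smult = (\<lambda>c X i j. c \<odot>\<^bsub>M\<^esub> X i j),
      lact = (\<lambda>Z X i j. \<Oplus>\<^bsub>M\<^esub>l\<in>{..n}. lact M (Z i l) (X l j)),
      ract = (\<lambda>X Z i j. \<Oplus>\<^bsub>M\<^esub>l\<in>{..n}. ract M (X i l) (Z l j))\<rparr>"

lemma bg_bimodule_simps [simp]:
  "X \<in> carrier (bg_bimodule n M gM) \<longleftrightarrow> (\<forall>i j. X i j \<in> entry n M gM i j)"
  "\<zero>\<^bsub>bg_bimodule n M gM\<^esub> = (\<lambda>i j. \<zero>\<^bsub>M\<^esub>)"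
  "X \<oplus>\<^bsub>bg_bimodule n M gM\<^esub> Y = (\<lambda>i j. X i j \<oplus>\<^bsub>M\<^esub> Y i j)"
  "c \<odot>\<^bsub>bg_bimodule n M gM\<^esub> X = (\<lambda>i j. c \<odot>\<^bsub>M\<^esub> X i j)"
  "lact (bg_bimodule n M gM) Z X = (\<lambda>i j. \<Oplus>\<^bsub>M\<^esub>l\<in>{..n}. lact M (Z i l) (X l j))"
  "ract (bg_bimodule n M gM) X W = (\<lambda>i j. \<Oplus>\<^bsub>M\<^esub>l\<in>{..n}. ract M (X i l) (W l j))"
  by (simp_all add: bg_bimodule_def)

lemma beilinson_green_simps:
  "X \<in> carrier (beilinson_green n A gA) \<longleftrightarrow> (\<forall>i j. X i j \<in> entry n A gA i j)"
  "X \<otimes>\<^bsub>beilinson_green n A gA\<^esub> Y = (\<lambda>i j. \<Oplus>\<^bsub>A\<^esub>l\<in>{..n}. X i l \<otimes>\<^bsub>A\<^esub> Y l j)"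
  "\<one>\<^bsub>beilinson_green n A gA\<^esub> = (\<lambda>i j. if i = j \<and> j \<le> n then \<one>\<^bsub>A\<^esub> else \<zero>\<^bsub>A\<^esub>)"
  "\<zero>\<^bsub>beilinson_green n A gA\<^esub> = (\<lambda>i j. \<zero>\<^bsub>A\<^esub>)"
  "X \<oplus>\<^bsub>beilinson_green n A gA\<^esub> Y = (\<lambda>i j. X i j \<oplus>\<^bsub>A\<^esub> Y i j)"
  "c \<odot>\<^bsub>beilinson_green n A gA\<^esub> X = (\<lambda>i j. c \<odot>\<^bsub>A\<^esub> X i j)"
  by (simp_all add: beilinson_green_def entry_def)

text \<open>An equality of records, not just an isomorphism: the meaningless fields are
  \<open>undefined\<close> on both sides. Facts about triangular matrices over a bimodule thereby
  become facts about the algebra, whose multiplication is both of the actions.\<close>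

lemma regular_beilinson_green:
  "regular (beilinson_green n A gA) = bg_bimodule n (regular A) gA"
proof -
  have "monoid.mult (regular X) = undefined" "one (regular X) = undefined" for X :: "('u, 'v) module"
    by (simp_all add: regular_def)
  then show ?thesis
    by (intro bimodule.equality)
      (simp_all add: bg_bimodule_def beilinson_green_def entry_def finsum_regular)
qed

text \<open>The common core of all associativity laws for matrix products: \<open>f\<close> and
  \<open>g\<close> multiply by an outer entry, \<open>eq\<close> is the law for entries, and the two
  summations are interchanged.\<close>

lemma finsum_assoc:
  assumes "abelian_group U" "abelian_group V" "abelian_group W" "finite I"
    and u: "\<And>r l. r \<in> I \<Longrightarrow> l \<in> I \<Longrightarrow> u r l \<in> carrier U"
    and v: "\<And>r l. r \<in> I \<Longrightarrow> l \<in> I \<Longrightarrow> v r l \<in> carrier V"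
    and f: "\<And>l. l \<in> I \<Longrightarrow> f l \<in> ahom U W" and g: "\<And>r. r \<in> I \<Longrightarrow> g r \<in> ahom V W"
    and eq: "\<And>r l. r \<in> I \<Longrightarrow> l \<in> I \<Longrightarrow> f l (u r l) = g r (v r l)"
  shows "(\<Oplus>\<^bsub>W\<^esub>l\<in>I. f l (\<Oplus>\<^bsub>U\<^esub>r\<in>I. u r l)) = (\<Oplus>\<^bsub>W\<^esub>r\<in>I. g r (\<Oplus>\<^bsub>V\<^esub>l\<in>I. v r l))"
proof -
  interpret W: abelian_group W by fact
  note c = ahom_closed[OF g]
  have "(\<Oplus>\<^bsub>W\<^esub>l\<in>I. f l (\<Oplus>\<^bsub>U\<^esub>r\<in>I. u r l)) = (\<Oplus>\<^bsub>W\<^esub>l\<in>I. \<Oplus>\<^bsub>W\<^esub>r\<in>I. g r (v r l))"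
  proof (intro W.finsum_congI W.finsum_closedI)
    fix l assume l: "l \<in> I"
    have "f l (\<Oplus>\<^bsub>U\<^esub>r\<in>I. u r l) = (\<Oplus>\<^bsub>W\<^esub>r\<in>I. f l (u r l))"
      using u l by (intro ahom_finsum[OF assms(1,3) f]) auto
    also have "\<dots> = (\<Oplus>\<^bsub>W\<^esub>r\<in>I. g r (v r l))"
      using eq c v l by (intro W.finsum_congI) auto
    finally show "f l (\<Oplus>\<^bsub>U\<^esub>r\<in>I. u r l) = (\<Oplus>\<^bsub>W\<^esub>r\<in>I. g r (v r l))" .
  qed (use c v in auto)
  also have "\<dots> = (\<Oplus>\<^bsub>W\<^esub>r\<in>I. \<Oplus>\<^bsub>W\<^esub>l\<in>I. g r (v r l))"
    using c v by (intro W.finsum_swap assms(4)) auto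
  also have "\<dots> = (\<Oplus>\<^bsub>W\<^esub>r\<in>I. g r (\<Oplus>\<^bsub>V\<^esub>l\<in>I. v r l))"
  proof (intro W.finsum_congI c)
    fix r assume r: "r \<in> I"
    show "(\<Oplus>\<^bsub>W\<^esub>l\<in>I. g r (v r l)) = g r (\<Oplus>\<^bsub>V\<^esub>l\<in>I. v r l)"
      using v r by (intro ahom_finsum[OF assms(2,3) g, symmetric]) auto
  next
    fix r assume "r \<in> I"
    then show "(\<Oplus>\<^bsub>V\<^esub>l\<in>I. v r l) \<in> carrier V"
      using v assms(2) by (intro abelian_monoid.finsum_closedI abelian_group.axioms(1)) auto
  qed
  finally show ?thesis .
qed

text \<open>The conditions on \<open>gM\<close> are those that keep triangular matrices with
  homogeneous entries closed under sums, scalars and both actions. In this form they pass to direct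
  sums component by component.\<close>

locale graded_bimod =
  fixes K :: "('k, 'x) ring_scheme" and n :: nat
    and A :: "('k, 'a) module" and gA :: "nat \<Rightarrow> 'a set"
    and B :: "('k, 'b) module" and gB :: "nat \<Rightarrow> 'b set"
    and M :: "('k, 'a, 'b, 'm) bimodule" and gM :: "nat \<Rightarrow> 'm set"
  assumes gr_alg_A: "graded_algebra K n A gA" and gr_alg_B: "graded_algebra K n B gB"
    and bimodule_M: "bimodule K A B M" and submodule_M: "\<And>d. submodule (gM d) K M"
    and gM_lact: "\<And>i j a x. a \<in> gA i \<Longrightarrow> x \<in> gM j \<Longrightarrow> lact M a x \<in> gM (i + j)"
    and gM_ract: "\<And>i j x b. x \<in> gM i \<Longrightarrow> b \<in> gB j \<Longrightarrow> ract M x b \<in> gM (i + j)"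
begin

lemma alg_A: "fd_algebra K A" and grading_A: "grading K A gA" and deg_A: "degree_le n A gA"
  using gr_alg_A by (auto simp: graded_algebra_def)

lemma alg_B: "fd_algebra K B" and grading_B: "grading K B gB" and deg_B: "degree_le n B gB"
  using gr_alg_B by (auto simp: graded_algebra_def)



sublocale A: fd_algebra K A by (rule alg_A)
sublocale B: fd_algebra K B by (rule alg_B)
sublocale M: bimodule K A B M by (rule bimodule_M)
sublocale M: biact A B M by (rule bimodule_biact[OF bimodule_M])

lemma module_A: "module K A" and module_B: "module K B" and module_M: "module K M" ..

lemma abelian_group_A: "abelian_group A" and abelian_group_B: "abelian_group B"
  and abelian_group_M: "abelian_group M" ..

abbreviation "barA \<equiv> beilinson_green n A gA"
abbreviation "barB \<equiv> beilinson_green n B gB"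
abbreviation "barM \<equiv> bg_bimodule n M gM"



lemmas gA = grading_carrier[OF module_A grading_A] grading_zero[OF module_A grading_A]
lemmas gB = grading_carrier[OF module_B grading_B] grading_zero[OF module_B grading_B]
lemma gM:
  shows "x \<in> gM d \<Longrightarrow> x \<in> carrier M" "\<zero>\<^bsub>M\<^esub> \<in> gM d"
    "x \<in> gM d \<Longrightarrow> y \<in> gM d \<Longrightarrow> x \<oplus>\<^bsub>M\<^esub> y \<in> gM d" "x \<in> gM d \<Longrightarrow> \<ominus>\<^bsub>M\<^esub> x \<in> gM d"
    "c \<in> carrier K \<Longrightarrow> x \<in> gM d \<Longrightarrow> c \<odot>\<^bsub>M\<^esub> x \<in> gM d"
  using M.submoduleE[OF submodule_M] subgroup.one_closed[OF submodule.axioms(1)[OF submodule_M]]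
  by auto

lemma entry_A: "a \<in> entry n A gA i j \<Longrightarrow> a \<in> carrier A"
  by (auto simp: entry_def gA split: if_splits)

lemma entry_B: "b \<in> entry n B gB i j \<Longrightarrow> b \<in> carrier B"
  by (auto simp: entry_def gB split: if_splits)

lemma entry_M: "x \<in> entry n M gM i j \<Longrightarrow> x \<in> carrier M"
  by (auto simp: entry_def gM split: if_splits)

lemma entries_A: "\<forall>i j. X i j \<in> entry n A gA i j \<Longrightarrow> X i j \<in> carrier A"
  using entry_A by blast

lemma entries_B: "\<forall>i j. X i j \<in> entry n B gB i j \<Longrightarrow> X i j \<in> carrier B"
  using entry_B by blast

lemma entries_M: "\<forall>i j. X i j \<in> entry n M gM i j \<Longrightarrow> X i j \<in> carrier M"
  using entry_M by blast

lemma entry_zero: "\<zero>\<^bsub>M\<^esub> \<in> entry n M gM i j"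
  by (simp add: entry_def gM)

lemma entry_add: "x \<in> entry n M gM i j \<Longrightarrow> y \<in> entry n M gM i j \<Longrightarrow> x \<oplus>\<^bsub>M\<^esub> y \<in> entry n M gM i j"
  by (auto simp: entry_def gM split: if_splits)

lemma entry_minus: "x \<in> entry n M gM i j \<Longrightarrow> \<ominus>\<^bsub>M\<^esub> x \<in> entry n M gM i j"
  by (auto simp: entry_def gM split: if_splits)

lemma entry_smult: "c \<in> carrier K \<Longrightarrow> x \<in> entry n M gM i j \<Longrightarrow> c \<odot>\<^bsub>M\<^esub> x \<in> entry n M gM i j"
  by (auto simp: entry_def gM split: if_splits)

lemma entry_finsum:
  assumes "\<And>k. k \<in> I \<Longrightarrow> f k \<in> entry n M gM i j"
  shows "finsum M f I \<in> entry n M gM i j"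
proof (cases "finite I")
  case True
  from this assms show ?thesis
  proof (induction I)
    case (insert k I)
    then have "finsum M f (insert k I) = f k \<oplus>\<^bsub>M\<^esub> finsum M f I"
      by (intro M.finsum_insertI entry_M) auto
    then show ?case using insert by (simp add: entry_add)
  qed (simp add: entry_zero)
next
  case False
  then show ?thesis by (simp add: entry_zero finsum_def finprod_def)
qed

lemma lact_zero_left: "x \<in> carrier M \<Longrightarrow> lact M \<zero>\<^bsub>A\<^esub> x = \<zero>\<^bsub>M\<^esub>"
  using ahom_zero[OF abelian_group_A abelian_group_M M.lact_ahom_left[OF abelian_group_A]] .

lemma ract_zero_right: "x \<in> carrier M \<Longrightarrow> ract M x \<zero>\<^bsub>B\<^esub> = \<zero>\<^bsub>M\<^esub>"
  using ahom_zero[OF abelian_group_B abelian_group_M M.ract_ahom_right[OF abelian_group_B]] .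

text \<open>The degrees telescope, \<open>(l - i) + (j - l) = j - i\<close>, when
  \<open>i \<le> l \<le> j\<close>; otherwise one of the factors is zero.\<close>

lemma entry_lact:
  "a \<in> entry n A gA i l \<Longrightarrow> x \<in> entry n M gM l j \<Longrightarrow> lact M a x \<in> entry n M gM i j"
  using gM_lact[of a "l - i" x "j - l"]
  by (auto simp: entry_def M.lact_zero lact_zero_left gM gA split: if_splits)

lemma entry_ract:
  "x \<in> entry n M gM i l \<Longrightarrow> b \<in> entry n B gB l j \<Longrightarrow> ract M x b \<in> entry n M gM i j"
  using gM_ract[of x "l - i" b "j - l"]
  by (auto simp: entry_def M.ract_zero ract_zero_right gM gB split: if_splits)

lemma abelian_group_bar: "abelian_group barM"
proof (rule abelian_groupI)
  fix X assume X: "X \<in> carrier barM"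
  then show "\<exists>Y\<in>carrier barM. Y \<oplus>\<^bsub>barM\<^esub> X = \<zero>\<^bsub>barM\<^esub>"
    by (intro bexI[of _ "\<lambda>i j. \<ominus>\<^bsub>M\<^esub> X i j"]) (auto simp: entries_M entry_minus fun_eq_iff M.l_neg)
qed (auto simp: entry_zero entry_add fun_eq_iff M.a_ac entries_M)

lemma bar_eval_ahom: "(\<lambda>X. X i j) \<in> ahom barM M"
  by (rule ahomI) (auto simp: entries_M)

lemma bar_finsum:
  assumes "\<And>k. k \<in> I \<Longrightarrow> f k \<in> carrier barM"
  shows "finsum barM f I i j = (\<Oplus>\<^bsub>M\<^esub>k\<in>I. f k i j)"
  using assms
  by (intro ahom_finsum[OF abelian_group_bar abelian_group_M bar_eval_ahom]) (auto simp del: bg_bimodule_simps)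

lemma bar_one_lact:
  assumes "X \<in> carrier barM"
  shows "lact barM \<one>\<^bsub>barA\<^esub> X = X"
proof (intro ext)
  fix i j
  have X: "X i j \<in> entry n M gM i j" "X i j \<in> carrier M" for i j using assms by (auto simp: entries_M)
  have *: "lact M (\<one>\<^bsub>barA\<^esub> i l) (X l j) = (if i = l \<and> l \<le> n then X l j else \<zero>\<^bsub>M\<^esub>)" for l
    using X by (simp add: beilinson_green_simps M.lact_one lact_zero_left)
  show "lact barM \<one>\<^bsub>barA\<^esub> X i j = X i j"
  proof (cases "i \<le> n")
    case True
    then show ?thesis using X by (simp add: * M.finsum_single[of _ i])
  next
    case False
    then have "X i j = \<zero>\<^bsub>M\<^esub>" using X(1)[of i j] by (auto simp: entry_def split: if_splits)
    with False show ?thesis by (auto simp: * intro!: M.finsum_zeroI)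
  qed
qed

lemma bar_ract_one:
  assumes "X \<in> carrier barM"
  shows "ract barM X \<one>\<^bsub>barB\<^esub> = X"
proof (intro ext)
  fix i j
  have X: "X i j \<in> entry n M gM i j" "X i j \<in> carrier M" for i j using assms by (auto simp: entries_M)
  have *: "ract M (X i l) (\<one>\<^bsub>barB\<^esub> l j) = (if l = j \<and> j \<le> n then X i l else \<zero>\<^bsub>M\<^esub>)" for l
    using X by (simp add: beilinson_green_simps M.ract_one ract_zero_right)
  show "ract barM X \<one>\<^bsub>barB\<^esub> i j = X i j"
  proof (cases "j \<le> n")
    case True
    then show ?thesis using X by (simp add: * M.finsum_single[of _ j])
  next
    case False
    then have "X i j = \<zero>\<^bsub>M\<^esub>" using X(1)[of i j] by (auto simp: entry_def split: if_splits)
    with False show ?thesis by (auto simp: * intro!: M.finsum_zeroI)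
  qed
qed

lemma bimodule_bar: "bimodule K barA barB barM"
proof -
  note [simp] = beilinson_green_simps
  have mod: "module K barM"
    using abelian_group_bar module.axioms(1)[OF module_M]
    by (intro moduleI)
      (auto simp: entry_smult M.smult_l_distr M.smult_r_distr M.smult_assoc1 entries_M fun_eq_iff)
  show ?thesis
  proof (intro bimodule.intro mod bimodule_axioms.intro bar_one_lact bar_ract_one)
    fix Z Z' X assume "Z \<in> carrier barA" "Z' \<in> carrier barA" "X \<in> carrier barM"
    then have [simp]: "\<And>i j. Z i j \<in> carrier A" "\<And>i j. Z' i j \<in> carrier A" "\<And>i j. X i j \<in> carrier M"
      by (auto simp: entries_A entries_B entries_M)
    show "lact barM (Z \<oplus>\<^bsub>barA\<^esub> Z') X = lact barM Z X \<oplus>\<^bsub>barM\<^esub> lact barM Z' X"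
      by (auto simp: fun_eq_iff M.lact_add_left M.lact_closed M.finsum_addI)
    show "lact barM (Z \<otimes>\<^bsub>barA\<^esub> Z') X = lact barM Z (lact barM Z' X)"
      by (intro ext, simp, rule finsum_assoc[OF abelian_group_A abelian_group_M abelian_group_M])
        (auto simp: M.lact_closed M.lact_mult intro: M.lact_ahom_left[OF abelian_group_A] M.lact_ahom)
  next
    fix Z X Y assume "Z \<in> carrier barA" "X \<in> carrier barM" "Y \<in> carrier barM"
    then have [simp]: "\<And>i j. Z i j \<in> carrier A" "\<And>i j. X i j \<in> carrier M" "\<And>i j. Y i j \<in> carrier M"
      by (auto simp: entries_A entries_B entries_M)
    show "lact barM Z (X \<oplus>\<^bsub>barM\<^esub> Y) = lact barM Z X \<oplus>\<^bsub>barM\<^esub> lact barM Z Y"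
      by (auto simp: fun_eq_iff M.lact_add_right M.lact_closed M.finsum_addI)
  next
    fix X Y Z assume "X \<in> carrier barM" "Y \<in> carrier barM" "Z \<in> carrier barB"
    then have [simp]: "\<And>i j. Z i j \<in> carrier B" "\<And>i j. X i j \<in> carrier M" "\<And>i j. Y i j \<in> carrier M"
      by (auto simp: entries_A entries_B entries_M)
    show "ract barM (X \<oplus>\<^bsub>barM\<^esub> Y) Z = ract barM X Z \<oplus>\<^bsub>barM\<^esub> ract barM Y Z"
      by (auto simp: fun_eq_iff M.ract_add_left M.ract_closed M.finsum_addI)
  next
    fix X Z Z' assume "X \<in> carrier barM" "Z \<in> carrier barB" "Z' \<in> carrier barB"
    then have [simp]: "\<And>i j. Z i j \<in> carrier B" "\<And>i j. Z' i j \<in> carrier B" "\<And>i j. X i j \<in> carrier M"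
      by (auto simp: entries_A entries_B entries_M)
    show "ract barM X (Z \<oplus>\<^bsub>barB\<^esub> Z') = ract barM X Z \<oplus>\<^bsub>barM\<^esub> ract barM X Z'"
      by (auto simp: fun_eq_iff M.ract_add_right M.ract_closed M.finsum_addI)
    show "ract barM X (Z \<otimes>\<^bsub>barB\<^esub> Z') = ract barM (ract barM X Z) Z'"
      by (intro ext, simp, rule finsum_assoc[OF abelian_group_M abelian_group_B abelian_group_M, symmetric])
        (auto simp: M.ract_closed M.ract_mult intro: M.ract_ahom_right[OF abelian_group_B] M.ract_ahom)
  next
    fix Z X Z' assume "Z \<in> carrier barA" "X \<in> carrier barM" "Z' \<in> carrier barB"
    then have [simp]: "\<And>i j. Z i j \<in> carrier A" "\<And>i j. Z' i j \<in> carrier B" "\<And>i j. X i j \<in> carrier M"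
      by (auto simp: entries_A entries_B entries_M)
    show "ract barM (lact barM Z X) Z' = lact barM Z (ract barM X Z')"
      by (intro ext, simp, rule finsum_assoc[OF abelian_group_M abelian_group_M abelian_group_M])
        (auto simp: M.ract_closed M.lact_closed M.lact_ract intro: M.lact_ahom M.ract_ahom)
  next
    fix c Z X assume "c \<in> carrier K" "Z \<in> carrier barA" "X \<in> carrier barM"
    then have [simp]: "c \<in> carrier K" "\<And>i j. Z i j \<in> carrier A" "\<And>i j. X i j \<in> carrier M"
      by (auto simp: entries_A entries_B entries_M)
    show "lact barM (c \<odot>\<^bsub>barA\<^esub> Z) X = c \<odot>\<^bsub>barM\<^esub> lact barM Z X \<and>
      lact barM Z (c \<odot>\<^bsub>barM\<^esub> X) = c \<odot>\<^bsub>barM\<^esub> lact barM Z X"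
      by (simp add: fun_eq_iff M.lact_smult M.lact_closed M.finsum_smult_ldistr)
  next
    fix c X Z assume "c \<in> carrier K" "X \<in> carrier barM" "Z \<in> carrier barB"
    then have [simp]: "c \<in> carrier K" "\<And>i j. Z i j \<in> carrier B" "\<And>i j. X i j \<in> carrier M"
      by (auto simp: entries_A entries_B entries_M)
    show "ract barM X (c \<odot>\<^bsub>barB\<^esub> Z) = c \<odot>\<^bsub>barM\<^esub> ract barM X Z \<and>
      ract barM (c \<odot>\<^bsub>barM\<^esub> X) Z = c \<odot>\<^bsub>barM\<^esub> ract barM X Z"
      by (simp add: fun_eq_iff M.ract_smult M.ract_closed M.finsum_smult_ldistr)
  qed (auto intro!: entry_finsum, (blast intro: entry_lact entry_ract)+)
qed

lemma biact_bar: "biact barA barB barM"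
  by (rule bimodule_biact[OF bimodule_bar])

end

lemma graded_bimodI:
  assumes "graded_algebra K n A gA" "graded_algebra K n B gB" "graded_bimodule K A gA B gB M gM"
  shows "graded_bimod K n A gA B gB M gM"
  using assms by (auto simp: graded_bimod_def graded_bimodule_def grading_def)

lemma graded_bimod_regular:
  assumes "graded_algebra K n A gA"
  shows "graded_bimod K n A gA A gA (regular A) gA"
proof -
  from assms have A: "fd_algebra K A" and gr: "grading K A gA"
    and gm: "\<And>i j a b. a \<in> gA i \<Longrightarrow> b \<in> gA j \<Longrightarrow> a \<otimes>\<^bsub>A\<^esub> b \<in> gA (i + j)"
    by (auto simp: graded_algebra_def)
  interpret A: fd_algebra K A by fact
  interpret R: bimodule K A A "regular A" by (rule bimodule_regular[OF A])
  have mA: "module K A" ..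
  have "\<And>a. a \<in> carrier A \<Longrightarrow> a_inv (regular A) a = \<ominus>\<^bsub>A\<^esub> a"
    by (rule R.M.minus_equality) (auto simp: A.l_neg)
  then have "submodule (gA d) K (regular A)" for d
    by (intro R.submoduleI)
      (auto simp: grading_carrier[OF mA gr] grading_zero[OF mA gr] grading_add[OF mA gr]
        grading_smult[OF mA gr] grading_minus[OF mA gr])
  then show ?thesis
    using assms bimodule_regular[OF A] gm by (simp add: graded_bimod_def)
qed


section \<open>The Beilinson-Green algebra\<close>

text \<open>In \<open>fin_dim\<close> coefficients belong to vectors, here to the indices of a
  family that may repeat vectors. The coefficients over each fibre \<open>J e\<close> therefore have
  to be added up.\<close>

lemma fin_dimI:
  assumes "module K V" and fin: "finite I" and E: "\<And>p. p \<in> I \<Longrightarrow> E p \<in> carrier V"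
    and span: "\<And>v. v \<in> carrier V \<Longrightarrow> \<exists>c\<in>I \<rightarrow> carrier K. v = (\<Oplus>\<^bsub>V\<^esub>p\<in>I. c p \<odot>\<^bsub>V\<^esub> E p)"
  shows "fin_dim K V"
  unfolding fin_dim_def
proof (intro exI[of _ "E ` I"] conjI ballI)
  interpret V: module K V by fact
  fix v assume "v \<in> carrier V"
  then obtain c where c: "c \<in> I \<rightarrow> carrier K" and v: "v = (\<Oplus>\<^bsub>V\<^esub>p\<in>I. c p \<odot>\<^bsub>V\<^esub> E p)"
    using span by blast
  define J where "J e = {p \<in> I. E p = e}" for e
  have J: "finite (J e)" "J e \<subseteq> I" for e using fin by (auto simp: J_def)
  define c' where "c' e = (\<Oplus>\<^bsub>K\<^esub>p\<in>J e. c p)" for e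
  have c': "c' e \<in> carrier K" for e
    unfolding c'_def using c J by (intro V.R.finsum_closedI) auto
  have "c' e \<odot>\<^bsub>V\<^esub> e = (\<Oplus>\<^bsub>V\<^esub>p\<in>J e. c p \<odot>\<^bsub>V\<^esub> E p)" if "e \<in> E ` I" for e
  proof -
    have e: "e \<in> carrier V" using that E by auto
    have "(\<lambda>a. a \<odot>\<^bsub>V\<^esub> e) \<in> ahom K V" using e by (intro ahomI) (auto simp: V.smult_l_distr)
    then have "c' e \<odot>\<^bsub>V\<^esub> e = (\<Oplus>\<^bsub>V\<^esub>p\<in>J e. c p \<odot>\<^bsub>V\<^esub> e)"
      unfolding c'_def using c J by (intro ahom_finsum[OF V.R.abelian_group_axioms V.M.abelian_group_axioms]) auto
    also have "\<dots> = (\<Oplus>\<^bsub>V\<^esub>p\<in>J e. c p \<odot>\<^bsub>V\<^esub> E p)"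
      using c E by (intro V.M.finsum_congI) (auto simp: J_def)
    finally show ?thesis .
  qed
  then have "(\<Oplus>\<^bsub>V\<^esub>e\<in>E ` I. c' e \<odot>\<^bsub>V\<^esub> e) = (\<Oplus>\<^bsub>V\<^esub>e\<in>E ` I. \<Oplus>\<^bsub>V\<^esub>p\<in>J e. c p \<odot>\<^bsub>V\<^esub> E p)"
    using c E J by (intro V.M.finsum_congI V.M.finsum_closedI V.smult_closed) (auto simp: J_def)
  also have "\<dots> = (\<Oplus>\<^bsub>V\<^esub>p\<in>(\<Union>e\<in>E ` I. J e). c p \<odot>\<^bsub>V\<^esub> E p)"
    using c E fin by (intro V.M.add.finprod_UN_disjoint[symmetric]) (auto simp: J_def pairwise_def disjnt_def)
  also have "(\<Union>e\<in>E ` I. J e) = I" by (auto simp: J_def)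
  finally have "v = (\<Oplus>\<^bsub>V\<^esub>e\<in>E ` I. c' e \<odot>\<^bsub>V\<^esub> e)" using v by simp
  then show "\<exists>c\<in>E ` I \<rightarrow> carrier K. v = (\<Oplus>\<^bsub>V\<^esub>e\<in>E ` I. c e \<odot>\<^bsub>V\<^esub> e)"
    using c' by (intro bexI[of _ c']) auto
qed (use fin E in auto)

text \<open>A spanning set of \<open>A\<close> need not be homogeneous, so its members are projected
  to degree \<open>j - i\<close> before they are put at position \<open>(i, j)\<close>.\<close>

lemma fin_dim_bg:
  assumes "graded_algebra K n A gA"
  shows "fin_dim K (bg_bimodule n (regular A) gA)"
proof -
  interpret R: graded_bimod K n A gA A gA "regular A" gA by (rule graded_bimod_regular[OF assms])
  note mgd = R.module_A R.grading_A R.deg_A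
  let ?h = "homogeneous_part A gA"
  obtain S where S: "finite S" "S \<subseteq> carrier A"
    and span: "\<And>v. v \<in> carrier A \<Longrightarrow> \<exists>c\<in>S \<rightarrow> carrier K. v = (\<Oplus>\<^bsub>A\<^esub>s\<in>S. c s \<odot>\<^bsub>A\<^esub> s)"
    using R.A.fin_dim unfolding fin_dim_def by blast
  define E where "E = (\<lambda>(i, j, s) i' j'. if i' = i \<and> j' = j \<and> i \<le> j \<and> j \<le> n then ?h (j - i) s else \<zero>\<^bsub>A\<^esub>)"
  define I where "I = {..n} \<times> {..n} \<times> S"
  have Ec: "E p \<in> carrier R.barM" if "p \<in> I" for p
    using that S homogeneous_part_in[OF mgd]
    by (auto simp: E_def I_def entry_def R.gA split: prod.splits)
  have Ecc: "E p i j \<in> carrier A" if "p \<in> I" for p i j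
    using Ec[OF that] R.entries_M[of "E p"] by simp
  show ?thesis
  proof (rule fin_dimI)
    show "module K R.barM" using R.bimodule_bar by (simp add: bimodule_def)
    show "finite I" using S by (simp add: I_def)
    fix X assume X: "X \<in> carrier R.barM"
    then have Xc: "X i j \<in> carrier A" for i j using R.entries_M[of X] by simp
    then have "\<exists>c\<in>S \<rightarrow> carrier K. X i j = (\<Oplus>\<^bsub>A\<^esub>s\<in>S. c s \<odot>\<^bsub>A\<^esub> s)" for i j by (rule span)
    then obtain c where c: "c i j \<in> S \<rightarrow> carrier K"
      and Xe: "X i j = (\<Oplus>\<^bsub>A\<^esub>s\<in>S. c i j s \<odot>\<^bsub>A\<^esub> s)" for i j by metis
    have cc: "c i j s \<in> carrier K" if "s \<in> S" for i j s using c that by blast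
    define c' where "c' = (\<lambda>(i, j, s). c i j s)"
    have "(\<Oplus>\<^bsub>R.barM\<^esub>p\<in>I. c' p \<odot>\<^bsub>R.barM\<^esub> E p) = X"
    proof (intro ext)
      fix i j
      have "(\<Oplus>\<^bsub>R.barM\<^esub>p\<in>I. c' p \<odot>\<^bsub>R.barM\<^esub> E p) i j = (\<Oplus>\<^bsub>A\<^esub>p\<in>I. c' p \<odot>\<^bsub>A\<^esub> E p i j)"
        using Ec cc by (subst R.bar_finsum) (auto simp: finsum_regular I_def c'_def intro!: R.entry_smult[simplified])
      also have "\<dots> = X i j"
      proof (cases "i \<le> j \<and> j \<le> n")
        case True
        let ?J = "(\<lambda>s. (i, j, s)) ` S"
        have "(\<Oplus>\<^bsub>A\<^esub>p\<in>I. c' p \<odot>\<^bsub>A\<^esub> E p i j) = (\<Oplus>\<^bsub>A\<^esub>p\<in>?J. c' p \<odot>\<^bsub>A\<^esub> E p i j)"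
          using S True cc Ecc
          by (intro R.A.add.finprod_mono_neutral_cong_right)
            (auto simp: I_def c'_def E_def)
        also have "\<dots> = (\<Oplus>\<^bsub>A\<^esub>s\<in>S. c i j s \<odot>\<^bsub>A\<^esub> ?h (j - i) s)"
          using True cc S homogeneous_part_closed[OF mgd]
          by (subst R.A.finsum_reindex) (auto simp: inj_on_def E_def c'_def intro!: R.A.finsum_congI)
        also have "\<dots> = ?h (j - i) (X i j)"
          unfolding Xe using cc S
          by (subst ahom_finsum[OF R.abelian_group_A R.abelian_group_A homogeneous_part_ahom[OF mgd]])
            (auto intro!: R.A.finsum_congI simp: homogeneous_part_smult[OF mgd] homogeneous_part_closed[OF mgd])
        \<comment> \<open>\<open>X i j\<close> has degree \<open>j - i\<close> itself and is fixed
          by the projection.\<close>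
        also have "\<dots> = X i j"
        proof (subst homogeneous_part_homogeneous[OF mgd])
          have "X i j \<in> entry n (regular A) gA i j" using X by simp
          then show "X i j \<in> gA (j - i)" using True by (simp add: entry_def)
        qed simp
        finally show ?thesis .
      next
        case False
        then have "X i j = \<zero>\<^bsub>A\<^esub>" using X by (auto simp: entry_def split: if_splits)
        moreover have "c' p \<odot>\<^bsub>A\<^esub> E p i j = \<zero>\<^bsub>A\<^esub>" if "p \<in> I" for p
          using that False cc by (auto simp: E_def I_def c'_def)
        ultimately show ?thesis by (simp add: R.A.finsum_zeroI)
      qed
      finally show "(\<Oplus>\<^bsub>R.barM\<^esub>p\<in>I. c' p \<odot>\<^bsub>R.barM\<^esub> E p) i j = X i j" .
    qed
    then show "\<exists>c\<in>I \<rightarrow> carrier K. X = (\<Oplus>\<^bsub>R.barM\<^esub>p\<in>I. c p \<odot>\<^bsub>R.barM\<^esub> E p)"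
      using cc by (intro bexI[of _ c']) (auto simp: c'_def I_def)
  qed (rule Ec)
qed
lemma fin_dim_cong:
  assumes "fin_dim K X" "carrier Y = carrier X" "add Y = add X" "\<zero>\<^bsub>Y\<^esub> = \<zero>\<^bsub>X\<^esub>" "smult Y = smult X"
  shows "fin_dim K Y"
  using assms by (simp add: fin_dim_def finsum_add_monoid_cong[OF assms(2-4)])

text \<open>The ring laws are read off the bimodule axioms of \<open>regular ?C\<close>. Besides
  finite dimension, what has to be added is that the unit matrix belongs to the carrier, which rests
  on the unit of \<open>A\<close> having degree zero.\<close>

lemma fd_algebra_beilinson_green:
  assumes "graded_algebra K n A gA"
  shows "fd_algebra K (beilinson_green n A gA)"
proof -
  interpret R: graded_bimod K n A gA A gA "regular A" gA by (rule graded_bimod_regular[OF assms])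
  let ?C = "beilinson_green n A gA"
  have eq: "bg_bimodule n (regular A) gA = regular ?C" by (rule regular_beilinson_green[symmetric])
  interpret C: bimodule K ?C ?C "regular ?C" using R.bimodule_bar by (simp add: eq)
  have one: "\<one>\<^bsub>?C\<^esub> \<in> carrier ?C"
    using graded_algebra_one[OF assms] by (auto simp: beilinson_green_simps entry_def R.gA)
  have ab: "abelian_group ?C"
    by (rule abelian_group_cong[OF C.abelian_group_axioms]) simp_all
  have fd: "fin_dim K ?C"
    by (rule fin_dim_cong[OF fin_dim_bg[OF assms, folded regular_beilinson_green]]) simp_all
  have "Group.monoid ?C"
    using C.lact_closed C.lact_mult C.lact_one C.ract_one one by (intro monoidI) simp_all
  then have "ring ?C"
    using ab C.lact_add_left C.lact_add_right by (intro ringI) simp_all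
  moreover have "module K ?C"
    using ab module.axioms(1)[OF R.module_A] C.smult_closed C.smult_l_distr C.smult_r_distr
      C.smult_assoc1 C.smult_one
    by (intro moduleI) simp_all
  ultimately show ?thesis
    using fd C.lact_smult
    by (intro fd_algebra.intro fd_algebra_axioms.intro) simp_all
qed


section \<open>Projectivity of triangular matrices\<close>

text \<open>Moving a column commutes with the left action, moving a row with the right action.\<close>

lemma move_column_bihom:
  assumes "graded_bimod K n A gA B gB X gX" "graded_bimod K n A gA B' gB' Y gY"
    and h: "h \<in> bihom A K (as_left X) (as_left Y)"
    and hg: "\<And>i x. x \<in> entry n X gX i p \<Longrightarrow> h x \<in> entry n Y gY i q"
  shows "(\<lambda>Z i l. if l = q then h (Z i p) else \<zero>\<^bsub>Y\<^esub>) \<in>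
    bihom (beilinson_green n A gA) K (as_left (bg_bimodule n X gX)) (as_left (bg_bimodule n Y gY))"
proof -
  interpret X: graded_bimod K n A gA B gB X gX by fact
  interpret Y: graded_bimod K n A gA B' gB' Y gY by fact
  note [simp] = bihomD[OF h, simplified]
  show ?thesis
  proof (intro bihomI ahomI)
    fix a Z assume "a \<in> carrier (beilinson_green n A gA)" "Z \<in> carrier (as_left (bg_bimodule n X gX))"
    then have c [simp]: "a i j \<in> carrier A" "Z i j \<in> carrier X" for i j
      by (auto simp: beilinson_green_simps X.entries_A X.entries_M)
    have "h (\<Oplus>\<^bsub>X\<^esub>l\<in>{..n}. lact X (a i l) (Z l p)) = (\<Oplus>\<^bsub>Y\<^esub>l\<in>{..n}. h (lact X (a i l) (Z l p)))" for i
      using ahom_finsum[OF abelian_group_as_left[OF X.abelian_group_M]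
          abelian_group_as_left[OF Y.abelian_group_M] bihom_ahom[OF h], of "\<lambda>l. lact X (a i l) (Z l p)" "{..n}"]
      by (simp add: finsum_as_left X.M.lact_closed)
    then show "(\<lambda>i l. if l = q then h (lact (as_left (bg_bimodule n X gX)) a Z i p) else \<zero>\<^bsub>Y\<^esub>) =
        lact (as_left (bg_bimodule n Y gY)) a (\<lambda>i l. if l = q then h (Z i p) else \<zero>\<^bsub>Y\<^esub>)"
      by (auto simp: fun_eq_iff Y.M.lact_zero intro!: Y.M.finsum_zeroI[symmetric])
  qed (auto simp: fun_eq_iff hg Y.entry_zero X.entries_M)
qed

lemma move_row_bihom:
  assumes "graded_bimod K n A gA B gB X gX" "graded_bimod K n A' gA' B gB Y gY"
    and h: "h \<in> bihom K B (as_right X) (as_right Y)"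
    and hg: "\<And>j x. x \<in> entry n X gX p j \<Longrightarrow> h x \<in> entry n Y gY q j"
  shows "(\<lambda>Z l j. if l = q then h (Z p j) else \<zero>\<^bsub>Y\<^esub>) \<in>
    bihom K (beilinson_green n B gB) (as_right (bg_bimodule n X gX)) (as_right (bg_bimodule n Y gY))"
proof -
  interpret X: graded_bimod K n A gA B gB X gX by fact
  interpret Y: graded_bimod K n A' gA' B gB Y gY by fact
  note [simp] = bihomD[OF h, simplified]
  show ?thesis
  proof (intro bihomI ahomI)
    fix Z b assume "Z \<in> carrier (as_right (bg_bimodule n X gX))" "b \<in> carrier (beilinson_green n B gB)"
    then have c [simp]: "b i j \<in> carrier B" "Z i j \<in> carrier X" for i j
      by (auto simp: beilinson_green_simps X.entries_B X.entries_M)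
    have "h (\<Oplus>\<^bsub>X\<^esub>l\<in>{..n}. ract X (Z p l) (b l j)) = (\<Oplus>\<^bsub>Y\<^esub>l\<in>{..n}. h (ract X (Z p l) (b l j)))" for j
      using ahom_finsum[OF abelian_group_as_right[OF X.abelian_group_M]
          abelian_group_as_right[OF Y.abelian_group_M] bihom_ahom[OF h], of "\<lambda>l. ract X (Z p l) (b l j)" "{..n}"]
      by (simp add: finsum_as_right X.M.ract_closed)
    then show "(\<lambda>l j. if l = q then h (ract (as_right (bg_bimodule n X gX)) Z b p j) else \<zero>\<^bsub>Y\<^esub>) =
        ract (as_right (bg_bimodule n Y gY)) (\<lambda>l j. if l = q then h (Z p j) else \<zero>\<^bsub>Y\<^esub>) b"
      by (auto simp: fun_eq_iff Y.M.ract_zero intro!: Y.M.finsum_zeroI[symmetric])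
  qed (auto simp: fun_eq_iff hg Y.entry_zero X.entries_M)
qed

text \<open>A drop of \<open>s\<close> in degree can be charged to either index, as
  \<open>j - i - s\<close> is both \<open>j - (i + s)\<close> and \<open>(j - s) - i\<close>. Right
  modules use the first version and left modules the second, so that the index on which the action
  operates stays put.\<close>

lemma entry_shift_down:
  assumes h: "h \<zero>\<^bsub>X\<^esub> = \<zero>\<^bsub>Y\<^esub>" and zero: "\<And>d. \<zero>\<^bsub>Y\<^esub> \<in> gY d"
    and hg: "\<And>d x. x \<in> gX d \<Longrightarrow> h x \<in> (if s \<le> d then gY (d - s) else {\<zero>\<^bsub>Y\<^esub>})"
    and x: "x \<in> entry n X gX i j"
  shows "i + s \<le> n \<Longrightarrow> h x \<in> entry n Y gY (i + s) j"
    and "s \<le> j \<Longrightarrow> h x \<in> entry n Y gY i (j - s)"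
    and "\<not> i + s \<le> j \<Longrightarrow> h x = \<zero>\<^bsub>Y\<^esub>"
  using x h zero hg[of x "j - i"]
  by (auto simp: entry_def add.commute split: if_splits)

text \<open>The side conditions of the second part guard the truncated subtraction: for
  \<open>s > j\<close> the index \<open>j - s\<close> would forget the shift, and
  \<open>j - s \<le> n\<close> does not bound \<open>j\<close>.\<close>

lemma entry_shift_up:
  assumes h: "h \<zero>\<^bsub>Y\<^esub> = \<zero>\<^bsub>X\<^esub>" and zero: "\<And>d. \<zero>\<^bsub>X\<^esub> \<in> gX d"
    and hg: "\<And>d y. y \<in> gY d \<Longrightarrow> h y \<in> gX (d + s)"
  shows "y \<in> entry n Y gY (i + s) j \<Longrightarrow> h y \<in> entry n X gX i j"
    and "s \<le> j \<Longrightarrow> j \<le> n \<Longrightarrow> y \<in> entry n Y gY i (j - s) \<Longrightarrow> h y \<in> entry n X gX i j"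
proof -
  have *: "h y \<in> gX (j - i)" if "i + s \<le> j" "y \<in> gY (j - (i + s))"
    using hg[OF that(2)] that(1) by simp
  show "y \<in> entry n Y gY (i + s) j \<Longrightarrow> h y \<in> entry n X gX i j"
    "s \<le> j \<Longrightarrow> j \<le> n \<Longrightarrow> y \<in> entry n Y gY i (j - s) \<Longrightarrow> h y \<in> entry n X gX i j"
    using h zero * by (auto simp: entry_def add.commute split: if_splits)
qed

context graded_bimod
begin

text \<open>For \<open>pos i j = i\<close> this is a decomposition into rows, for \<open>pos i j = j\<close> into columns.\<close>

lemma bar_sum_decomposition:
  assumes X: "X \<in> carrier barM" and I: "I \<subseteq> {..n} \<times> {..<m :: nat}"
    and F: "\<And>p. p \<in> I \<Longrightarrow> F p \<in> carrier barM"
    and Fe: "\<And>r k i j. F (r, k) i j = (if pos i j = r then g k (X i j) else \<zero>\<^bsub>M\<^esub>)"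
    and g: "\<And>k x. k < m \<Longrightarrow> x \<in> carrier M \<Longrightarrow> g k x \<in> carrier M"
    and sum: "\<And>x. x \<in> carrier M \<Longrightarrow> (\<Oplus>\<^bsub>M\<^esub>k\<in>{..<m}. g k x) = x"
    and van: "\<And>i j k. i \<le> j \<Longrightarrow> j \<le> n \<Longrightarrow> k < m \<Longrightarrow> (pos i j, k) \<notin> I \<Longrightarrow> g k (X i j) = \<zero>\<^bsub>M\<^esub>"
  shows "finsum barM F I = X"
proof (intro ext)
  fix i j
  have Xe: "X i j \<in> entry n M gM i j" and Xc: "X i j \<in> carrier M"
    using X by (simp_all add: entries_M)
  show "finsum barM F I i j = X i j"
  proof (cases "i \<le> j \<and> j \<le> n")
    case True
    let ?J = "Pair (pos i j) ` {..<m}"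
    have fin: "finite I" by (rule finite_subset[OF I]) simp
    have Im: "k < m" if "(r, k) \<in> I" for r k using I that by auto
    have "finsum barM F I i j = (\<Oplus>\<^bsub>M\<^esub>p\<in>I. F p i j)" by (rule bar_finsum[OF F])
    \<comment> \<open>Indices in \<open>I\<close> belonging to another row or column contribute zero
      by \<open>Fe\<close>, and generators missing from \<open>I\<close> by
      \<open>van\<close>.\<close>
    also have "\<dots> = (\<Oplus>\<^bsub>M\<^esub>p\<in>?J. g (snd p) (X i j))"
      using True Im fin Xc g van Fe
      by (intro M.add.finprod_mono_neutral_cong) auto
    also have "\<dots> = (\<Oplus>\<^bsub>M\<^esub>k\<in>{..<m}. g k (X i j))"
      using g Xc by (subst M.finsum_reindex) (auto simp: inj_on_def)
    finally show ?thesis using sum[OF Xc] by simp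
  next
    case False
    have "finsum barM F I \<in> carrier barM"
      using F by (intro abelian_monoid.finsum_closedI abelian_group.axioms(1)[OF abelian_group_bar])
    then have "finsum barM F I i j \<in> entry n M gM i j" by simp
    with False Xe show ?thesis by (auto simp: entry_def split: if_splits)
  qed
qed

lemma left_projective_bar:
  assumes "graded_left_projective K A gA M gM"
  shows "left_projective K barA barM"
proof -
  interpret R: graded_bimod K n A gA A gA "regular A" gA by (rule graded_bimod_regular[OF gr_alg_A])
  note abM = abelian_group_as_left[OF abelian_group_M] and abR = abelian_group_as_left[OF R.abelian_group_M]
  have z: "\<zero>\<^bsub>as_left (regular A)\<^esub> \<in> gA d" for d by (simp add: gA)
  obtain m :: nat and s \<phi> \<psi> where
    \<phi>: "\<And>k. k < m \<Longrightarrow> \<phi> k \<in> bihom A K (as_left M) (as_left (regular A))" and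
    \<psi>: "\<And>k. k < m \<Longrightarrow> \<psi> k \<in> bihom A K (as_left (regular A)) (as_left M)" and
    \<phi>g: "\<And>k d x. k < m \<Longrightarrow> x \<in> gM d \<Longrightarrow> \<phi> k x \<in> (if s k \<le> d then gA (d - s k) else {\<zero>\<^bsub>regular A\<^esub>})" and
    \<psi>g: "\<And>k d y. k < m \<Longrightarrow> y \<in> gA d \<Longrightarrow> \<psi> k y \<in> gM (d + s k)" and
    eq: "\<And>x. x \<in> carrier M \<Longrightarrow> (\<Oplus>\<^bsub>M\<^esub>k\<in>{..<m}. \<psi> k (\<phi> k x)) = x"
    apply (rule graded_summand_of_copiesE[OF assms[unfolded graded_left_projective_def] abM
          biact_as_left[OF R.bimodule_M] z, unfolded as_left_simps finsum_as_left])
    subgoal premises p for m s \<phi> \<psi> by (rule p(1)[OF p(2-)])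
    done
  have \<phi>0: "\<phi> k \<zero>\<^bsub>M\<^esub> = \<zero>\<^bsub>regular A\<^esub>" and \<psi>0: "\<psi> k \<zero>\<^bsub>regular A\<^esub> = \<zero>\<^bsub>M\<^esub>" if "k < m" for k
    using ahom_zero[OF abM abR bihom_ahom[OF \<phi>[OF that]]] ahom_zero[OF abR abM bihom_ahom[OF \<psi>[OF that]]]
    by simp_all
  note down = entry_shift_down[where h = "\<phi> k" and s = "s k" and X = M and gX = gM and Y = "regular A" and gY = gA for k,
        OF \<phi>0 R.gM(2) \<phi>g]
    and up = entry_shift_up[where h = "\<psi> k" and s = "s k" and X = M and gX = gM and Y = "regular A" and gY = gA for k,
        OF \<psi>0 gM(2) \<psi>g]
  \<comment> \<open>A column \<open>j < s k\<close> has only entries of degree below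
    \<open>s k\<close>, on which \<open>\<phi> k\<close> vanishes, so it can be left out.\<close>
  define I where "I = {(j, k). j \<le> n \<and> k < m \<and> s k \<le> j}"
  have sub: "I \<subseteq> {..n} \<times> {..<m}" by (auto simp: I_def)
  define \<Phi> where "\<Phi> = (\<lambda>(j, k) Z (i :: nat) l. if l = j - s k then \<phi> k (Z i j) else \<zero>\<^bsub>regular A\<^esub>)"
  define \<Psi> where "\<Psi> = (\<lambda>(j, k) Z (i :: nat) l. if l = j then \<psi> k (Z i (j - s k)) else \<zero>\<^bsub>M\<^esub>)"
  have \<Phi>: "\<Phi> p \<in> bihom barA K (as_left barM) (as_left (regular barA))" if "p \<in> I" for p
    unfolding regular_beilinson_green using that
    by (cases p) (auto simp: \<Phi>_def I_def intro!: down(2)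
        move_column_bihom[OF graded_bimod_axioms R.graded_bimod_axioms \<phi>])
  have \<Psi>: "\<Psi> p \<in> bihom barA K (as_left (regular barA)) (as_left barM)" if "p \<in> I" for p
    unfolding regular_beilinson_green using that
    by (cases p) (auto simp: \<Psi>_def I_def intro!: up(2)
        move_column_bihom[OF R.graded_bimod_axioms graded_bimod_axioms \<psi>])
  have sum: "(\<Oplus>\<^bsub>barM\<^esub>p\<in>I. \<Psi> p (\<Phi> p X)) = X" if X: "X \<in> carrier barM" for X
  proof (rule bar_sum_decomposition[OF X sub, where pos = "\<lambda>i j. j" and g = "\<lambda>k x. \<psi> k (\<phi> k x)"])
    show "\<Psi> p (\<Phi> p X) \<in> carrier barM" if "p \<in> I" for p
      using bihom_closed[OF \<Psi>[OF that] bihom_closed[OF \<Phi>[OF that]]] X by (simp only: as_left_simps)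
    show "\<psi> k (\<phi> k x) \<in> carrier M" if "k < m" "x \<in> carrier M" for k x
      using bihom_closed[OF \<psi>] bihom_closed[OF \<phi>] that by simp
    show "\<psi> k (\<phi> k (X i j)) = \<zero>\<^bsub>M\<^esub>" if "i \<le> j" "j \<le> n" "k < m" "(j, k) \<notin> I" for i j k
      using that down(3)[OF that(3), of "X i j" n i j] X by (auto simp: I_def \<psi>0[simplified])
  qed (use eq in \<open>auto simp: \<Psi>_def \<Phi>_def\<close>)
  show ?thesis
    unfolding left_projective_def
  proof (rule summand_of_copiesI[OF _ _ finite_subset[OF sub] \<Phi> \<Psi>])
    show "biact barA K (as_left barM)" by (rule biact_as_left[OF bimodule_bar])
    show "biact barA K (as_left (regular barA))"
      unfolding regular_beilinson_green by (rule biact_as_left[OF R.bimodule_bar])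
  qed (use sum in \<open>auto simp only: as_left_simps finsum_as_left finite_SigmaI finite_atMost finite_lessThan\<close>)
qed

text \<open>Besides the splitting of \<open>barM\<close> this records that
  \<open>\<Phi> (i, k)\<close> moves row \<open>i\<close>, mapped by \<open>\<phi> k\<close>, to row
  \<open>i + s k\<close>. Projectivity follows from the splitting; the injectivity argument for
  tensor products reads the formula entry by entry.\<close>

lemma right_dual_basis:
  assumes "graded_right_projective K B gB M gM"
  obtains I :: "(nat \<times> nat) set" and s :: "nat \<Rightarrow> nat" and \<phi> \<Phi> \<Psi> where
    "finite I" "\<And>i k. (i, k) \<in> I \<Longrightarrow> \<phi> k \<in> bihom K B (as_right M) (as_right (regular B))"
    "\<And>p. p \<in> I \<Longrightarrow> \<Phi> p \<in> bihom K barB (as_right barM) (as_right (regular barB))"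
    "\<And>p. p \<in> I \<Longrightarrow> \<Psi> p \<in> bihom K barB (as_right (regular barB)) (as_right barM)"
    "\<And>X. X \<in> carrier barM \<Longrightarrow> (\<Oplus>\<^bsub>barM\<^esub>p\<in>I. \<Psi> p (\<Phi> p X)) = X"
    "\<And>i k X. \<Phi> (i, k) X = (\<lambda>l j. if l = i + s k then \<phi> k (X i j) else \<zero>\<^bsub>B\<^esub>)"
proof -
  interpret R: graded_bimod K n B gB B gB "regular B" gB by (rule graded_bimod_regular[OF gr_alg_B])
  note abM = abelian_group_as_right[OF abelian_group_M] and abR = abelian_group_as_right[OF R.abelian_group_M]
  have z: "\<zero>\<^bsub>as_right (regular B)\<^esub> \<in> gB d" for d by (simp add: gB)
  obtain m :: nat and s \<phi> \<psi> where
    \<phi>: "\<And>k. k < m \<Longrightarrow> \<phi> k \<in> bihom K B (as_right M) (as_right (regular B))" and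
    \<psi>: "\<And>k. k < m \<Longrightarrow> \<psi> k \<in> bihom K B (as_right (regular B)) (as_right M)" and
    \<phi>g: "\<And>k d x. k < m \<Longrightarrow> x \<in> gM d \<Longrightarrow> \<phi> k x \<in> (if s k \<le> d then gB (d - s k) else {\<zero>\<^bsub>regular B\<^esub>})" and
    \<psi>g: "\<And>k d y. k < m \<Longrightarrow> y \<in> gB d \<Longrightarrow> \<psi> k y \<in> gM (d + s k)" and
    eq: "\<And>x. x \<in> carrier M \<Longrightarrow> (\<Oplus>\<^bsub>M\<^esub>k\<in>{..<m}. \<psi> k (\<phi> k x)) = x"
    apply (rule graded_summand_of_copiesE[OF assms[unfolded graded_right_projective_def] abM
          biact_as_right[OF R.bimodule_M] z, unfolded as_right_simps finsum_as_right])
    subgoal premises p for m s \<phi> \<psi> by (rule p(1)[OF p(2-)])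
    done
  have \<phi>0: "\<phi> k \<zero>\<^bsub>M\<^esub> = \<zero>\<^bsub>regular B\<^esub>" and \<psi>0: "\<psi> k \<zero>\<^bsub>regular B\<^esub> = \<zero>\<^bsub>M\<^esub>" if "k < m" for k
    using ahom_zero[OF abM abR bihom_ahom[OF \<phi>[OF that]]] ahom_zero[OF abR abM bihom_ahom[OF \<psi>[OF that]]]
    by simp_all
  note down = entry_shift_down[where h = "\<phi> k" and s = "s k" and X = M and gX = gM and Y = "regular B" and gY = gB for k,
        OF \<phi>0 R.gM(2) \<phi>g]
    and up = entry_shift_up[where h = "\<psi> k" and s = "s k" and X = M and gX = gM and Y = "regular B" and gY = gB for k,
        OF \<psi>0 gM(2) \<psi>g]
  \<comment> \<open>For \<open>i + s k > n\<close> the entries of row \<open>i\<close> have degree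
    at most \<open>n - i < s k\<close>, so \<open>\<phi> k\<close> kills the row.\<close>
  define I where "I = {(i, k). k < m \<and> i + s k \<le> n}"
  have sub: "I \<subseteq> {..n} \<times> {..<m}" by (auto simp: I_def)
  define \<Phi> where "\<Phi> = (\<lambda>(i, k) Z l (j :: nat). if l = i + s k then \<phi> k (Z i j) else \<zero>\<^bsub>regular B\<^esub>)"
  define \<Psi> where "\<Psi> = (\<lambda>(i, k) Z l (j :: nat). if l = i then \<psi> k (Z (i + s k) j) else \<zero>\<^bsub>M\<^esub>)"
  have \<Phi>: "\<Phi> p \<in> bihom K barB (as_right barM) (as_right (regular barB))" if "p \<in> I" for p
    unfolding regular_beilinson_green using that
    by (cases p) (auto simp: \<Phi>_def I_def intro!: down(1)
        move_row_bihom[OF graded_bimod_axioms R.graded_bimod_axioms \<phi>])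
  have \<Psi>: "\<Psi> p \<in> bihom K barB (as_right (regular barB)) (as_right barM)" if "p \<in> I" for p
    unfolding regular_beilinson_green using that
    by (cases p) (auto simp: \<Psi>_def I_def intro!: up(1)
        move_row_bihom[OF R.graded_bimod_axioms graded_bimod_axioms \<psi>])
  have sum: "(\<Oplus>\<^bsub>barM\<^esub>p\<in>I. \<Psi> p (\<Phi> p X)) = X" if X: "X \<in> carrier barM" for X
  proof (rule bar_sum_decomposition[OF X sub, where pos = "\<lambda>i j. i" and g = "\<lambda>k x. \<psi> k (\<phi> k x)"])
    show "\<Psi> p (\<Phi> p X) \<in> carrier barM" if "p \<in> I" for p
      using bihom_closed[OF \<Psi>[OF that] bihom_closed[OF \<Phi>[OF that]]] X by (simp only: as_right_simps)
    show "\<psi> k (\<phi> k x) \<in> carrier M" if "k < m" "x \<in> carrier M" for k x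
      using bihom_closed[OF \<psi>] bihom_closed[OF \<phi>] that by simp
    show "\<psi> k (\<phi> k (X i j)) = \<zero>\<^bsub>M\<^esub>" if "i \<le> j" "j \<le> n" "k < m" "(i, k) \<notin> I" for i j k
      using that down(3)[OF that(3), of "X i j" n i j] X by (auto simp: I_def \<psi>0[simplified])
  qed (use eq in \<open>auto simp: \<Psi>_def \<Phi>_def\<close>)
  show thesis
    by (rule that[OF finite_subset[OF sub] _ \<Phi> \<Psi> sum, of \<phi> s])
      (use \<phi> in \<open>auto simp: I_def \<Phi>_def fun_eq_iff\<close>)
qed

lemma right_projective_bar:
  assumes "graded_right_projective K B gB M gM"
  shows "right_projective K barB barM"
proof -
  interpret R: graded_bimod K n B gB B gB "regular B" gB by (rule graded_bimod_regular[OF gr_alg_B])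
  obtain I :: "(nat \<times> nat) set" and \<Phi> \<Psi> where fin: "finite I"
    and \<Phi>: "\<And>p. p \<in> I \<Longrightarrow> \<Phi> p \<in> bihom K barB (as_right barM) (as_right (regular barB))"
    and \<Psi>: "\<And>p. p \<in> I \<Longrightarrow> \<Psi> p \<in> bihom K barB (as_right (regular barB)) (as_right barM)"
    and sum: "\<And>X. X \<in> carrier barM \<Longrightarrow> (\<Oplus>\<^bsub>barM\<^esub>p\<in>I. \<Psi> p (\<Phi> p X)) = X"
    apply (rule right_dual_basis[OF assms])
    subgoal premises p for I s \<phi> \<Phi> \<Psi> by (rule p(1)[OF p(2,4,5,6)])
    done
  show ?thesis
    unfolding right_projective_def
  proof (rule summand_of_copiesI[OF _ _ fin \<Phi> \<Psi>])
    show "biact K barB (as_right barM)" by (rule biact_as_right[OF bimodule_bar])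
    show "biact K barB (as_right (regular barB))"
      unfolding regular_beilinson_green by (rule biact_as_right[OF R.bimodule_bar])
  qed (use sum in \<open>auto simp only: as_right_simps finsum_as_right\<close>)
qed

end


section \<open>Tensor products of triangular matrices\<close>

lemma bimodule_tensor_biact:
  assumes "bimodule K A R M" "bimodule K R C N"
  shows "tensor_biact A R C M N"
proof -
  interpret M: bimodule K A R M by fact
  interpret N: bimodule K R C N by fact
  have "biact A R M" "biact R C N" using assms bimodule_biact by auto
  then show ?thesis
    by (intro tensor_biact.intro tensor_factors.intro tensor_factors_axioms.intro
        tensor_biact_axioms.intro)
      (auto simp: M.ract_closed N.lact_closed M.lact_ract N.lact_ract
        intro: M.abelian_group_axioms N.abelian_group_axioms)
qed

definition matrix_unit :: "('m, 'z) ring_scheme \<Rightarrow> nat \<Rightarrow> nat \<Rightarrow> 'm \<Rightarrow> nat \<Rightarrow> nat \<Rightarrow> 'm" where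
  "matrix_unit M i j x = (\<lambda>i' j'. if i' = i \<and> j' = j then x else \<zero>\<^bsub>M\<^esub>)"

section \<open>Decomposition into matrix units\<close>

context graded_bimod
begin

lemma matrix_unit_bar: "x \<in> entry n M gM i j \<Longrightarrow> matrix_unit M i j x \<in> carrier barM"
  by (auto simp: matrix_unit_def entry_zero)

lemma bar_matrix_units:
  assumes "X \<in> carrier barM"
  shows "X = finsum barM (\<lambda>(i, j). matrix_unit M i j (X i j)) ({..n} \<times> {..n})"
proof (intro ext)
  fix i j
  have X: "X i j \<in> entry n M gM i j" "X i j \<in> carrier M" for i j
    using assms by (simp_all add: entries_M)
  have "finsum barM (\<lambda>(i, j). matrix_unit M i j (X i j)) ({..n} \<times> {..n}) i j =
      (\<Oplus>\<^bsub>M\<^esub>p\<in>{..n} \<times> {..n}. (case p of (i, j) \<Rightarrow> matrix_unit M i j (X i j)) i j)"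
    using matrix_unit_bar X(1) by (intro bar_finsum) (auto simp del: bg_bimodule_simps)
  also have "\<dots> = X i j"
  proof (cases "i \<le> j \<and> j \<le> n")
    case True
    then show ?thesis
      using X(2) by (subst M.finsum_single[of _ "(i, j)"]) (auto simp: matrix_unit_def split: if_splits)
  next
    case False
    then have "X i j = \<zero>\<^bsub>M\<^esub>" using X(1)[of i j] by (auto simp: entry_def split: if_splits)
    then show ?thesis by (intro trans[OF M.finsum_zeroI]) (auto simp: matrix_unit_def)
  qed
  finally show "X i j = finsum barM (\<lambda>(i, j). matrix_unit M i j (X i j)) ({..n} \<times> {..n}) i j"
    by simp
qed

end

text \<open>The module \<open>Y\<close> is a tensor product of \<open>M\<close> and \<open>N\<close>, presented through an isomorphism so
  that its grading is known to consist of submodules.\<close>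

locale graded_tensor = L: graded_bimod K n A gA B gB M gM + R: graded_bimod K n B gB C gC N gN +
  Y: graded_bimod K n A gA C gC Y gY
  for K :: "('k, 'x) ring_scheme" and n :: nat
    and A :: "('k, 'a) module" and gA :: "nat \<Rightarrow> 'a set"
    and B :: "('k, 'b) module" and gB :: "nat \<Rightarrow> 'b set"
    and C :: "('k, 'c) module" and gC :: "nat \<Rightarrow> 'c set"
    and M :: "('k, 'a, 'b, 'm) bimodule" and gM :: "nat \<Rightarrow> 'm set"
    and N :: "('k, 'b, 'c, 'n) bimodule" and gN :: "nat \<Rightarrow> 'n set"
    and Y :: "('k, 'a, 'c, 'y) bimodule" and gY :: "nat \<Rightarrow> 'y set" +
  fixes f
  assumes f: "f \<in> graded_biiso A C (tensor B M N) (tensor_grade B M gM N gN) Y gY"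
begin

sublocale T: tensor_biact A B C M N
  by (rule bimodule_tensor_biact[OF L.bimodule_M R.bimodule_M])

sublocale T': tensor_biact "L.barA" "L.barB" "R.barB" "L.barM" "R.barM"
  by (rule bimodule_tensor_biact[OF L.bimodule_bar R.bimodule_bar])

lemma f_bihom: "f \<in> bihom A C T.T Y" and f_biiso: "f \<in> biiso A C T.T Y"
  and f_grade: "f ` tensor_grade B M gM N gN d = gY d"
  using f by (auto simp: graded_biiso_def biiso_def)

definition \<tau> :: "'m \<Rightarrow> 'n \<Rightarrow> 'y" where
  "\<tau> x y = f (T.pt x y)"

lemma \<tau>_balanced: "balanced_map B M N Y \<tau>"
  unfolding \<tau>_def by (rule balanced_map_comp[OF T.balanced_map_pure bihom_ahom[OF f_bihom]])

lemmas \<tau>_simps = balanced_mapD[OF \<tau>_balanced]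

lemma \<tau>_lact: "a \<in> carrier A \<Longrightarrow> x \<in> carrier M \<Longrightarrow> y \<in> carrier N \<Longrightarrow> \<tau> (lact M a x) y = lact Y a (\<tau> x y)"
  using bihom_lact[OF f_bihom, of a "T.pt x y"] by (simp add: \<tau>_def T.tensor_lact T.pure_closed)

lemma \<tau>_ract: "x \<in> carrier M \<Longrightarrow> y \<in> carrier N \<Longrightarrow> c \<in> carrier C \<Longrightarrow> \<tau> x (ract N y c) = ract Y (\<tau> x y) c"
  using bihom_ract[OF f_bihom, of "T.pt x y" c] by (simp add: \<tau>_def T.tensor_ract T.pure_closed)

lemma \<tau>_zero_left: "y \<in> carrier N \<Longrightarrow> \<tau> \<zero>\<^bsub>M\<^esub> y = \<zero>\<^bsub>Y\<^esub>"
  using ahom_zero[OF L.abelian_group_M Y.abelian_group_M \<tau>_simps(2)] .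

lemma \<tau>_zero_right: "x \<in> carrier M \<Longrightarrow> \<tau> x \<zero>\<^bsub>N\<^esub> = \<zero>\<^bsub>Y\<^esub>"
  using ahom_zero[OF R.abelian_group_M Y.abelian_group_M \<tau>_simps(3)] .

lemma \<tau>_grade: "x \<in> gM i \<Longrightarrow> y \<in> gN j \<Longrightarrow> \<tau> x y \<in> gY (i + j)"
  unfolding f_grade[symmetric] \<tau>_def tensor_grade_def
  by (intro imageI generate.incl) blast

lemma \<tau>_entry:
  assumes "x \<in> entry n M gM i l" "y \<in> entry n N gN l j"
  shows "\<tau> x y \<in> entry n Y gY i j"
proof -
  consider "i \<le> l" "l \<le> j" "j \<le> n" | "x = \<zero>\<^bsub>M\<^esub>" | "y = \<zero>\<^bsub>N\<^esub>"
    using assms by (auto simp: entry_def split: if_splits)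
  then show ?thesis
  proof cases
    case 1
    then have "\<tau> x y \<in> gY (l - i + (j - l))" using assms by (intro \<tau>_grade) (auto simp: entry_def)
    then show ?thesis using 1 by (simp add: entry_def)
  qed (use assms L.entry_M R.entry_M Y.entry_zero in \<open>auto simp: \<tau>_zero_left \<tau>_zero_right\<close>)
qed

section \<open>Matrix multiplication with values in the tensor product\<close>

definition mat_tensor :: "(nat \<Rightarrow> nat \<Rightarrow> 'm) \<Rightarrow> (nat \<Rightarrow> nat \<Rightarrow> 'n) \<Rightarrow> nat \<Rightarrow> nat \<Rightarrow> 'y" where
  "mat_tensor X Z = (\<lambda>i j. \<Oplus>\<^bsub>Y\<^esub>l\<in>{..n}. \<tau> (X i l) (Z l j))"

lemma mat_tensor_closed:
  assumes "X \<in> carrier L.barM" "Z \<in> carrier R.barM"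
  shows "mat_tensor X Z \<in> carrier Y.barM"
proof -
  have "\<tau> (X i l) (Z l j) \<in> entry n Y gY i j" for i j l
    by (rule \<tau>_entry[where l = l]) (use assms in simp_all)
  then show ?thesis by (auto simp: mat_tensor_def intro!: Y.entry_finsum)
qed

lemma mat_tensor_balanced: "balanced_map L.barB L.barM R.barM Y.barM mat_tensor"
proof (rule balanced_mapI[OF mat_tensor_closed])
  fix X b Z assume "X \<in> carrier L.barM" "b \<in> carrier L.barB" "Z \<in> carrier R.barM"
  then have [simp]: "X i j \<in> carrier M" "b i j \<in> carrier B" "Z i j \<in> carrier N" for i j
    by (auto simp: L.entries_M R.entries_M beilinson_green_simps L.entries_B)
  show "mat_tensor (ract L.barM X b) Z = mat_tensor X (lact R.barM b Z)"
    unfolding mat_tensor_def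
    by (intro ext, simp, rule finsum_assoc[OF L.abelian_group_M R.abelian_group_M Y.abelian_group_M])
      (auto simp: L.M.ract_closed R.M.lact_closed \<tau>_simps(6) intro: \<tau>_simps(2,3))
qed (auto simp: mat_tensor_def fun_eq_iff \<tau>_simps L.entries_M R.entries_M Y.M.finsum_addI)

lemma mat_tensor_lact:
  assumes "a \<in> carrier L.barA" "X \<in> carrier L.barM" "Z \<in> carrier R.barM"
  shows "mat_tensor (lact L.barM a X) Z = lact Y.barM a (mat_tensor X Z)"
proof -
  have [simp]: "X i j \<in> carrier M" "a i j \<in> carrier A" "Z i j \<in> carrier N" for i j
    using assms by (auto simp: L.entries_M R.entries_M beilinson_green_simps L.entries_A)
  show ?thesis
    unfolding mat_tensor_def
    by (intro ext, simp, rule finsum_assoc[OF L.abelian_group_M Y.abelian_group_M Y.abelian_group_M])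
      (auto simp: L.M.lact_closed \<tau>_simps(1) \<tau>_lact intro: \<tau>_simps(2) Y.M.lact_ahom)
qed

lemma mat_tensor_ract:
  assumes "X \<in> carrier L.barM" "Z \<in> carrier R.barM" "c \<in> carrier R.barB"
  shows "mat_tensor X (ract R.barM Z c) = ract Y.barM (mat_tensor X Z) c"
proof -
  have [simp]: "X i j \<in> carrier M" "c i j \<in> carrier C" "Z i j \<in> carrier N" for i j
    using assms by (auto simp: L.entries_M R.entries_M beilinson_green_simps R.entries_B)
  show ?thesis
    unfolding mat_tensor_def
    by (intro ext, simp, rule finsum_assoc[OF Y.abelian_group_M R.abelian_group_M Y.abelian_group_M, symmetric])
      (auto simp: R.M.ract_closed \<tau>_simps(1) \<tau>_ract intro: \<tau>_simps(3) Y.M.ract_ahom)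
qed

lemma mat_tensor_matrix_units:
  assumes "x \<in> carrier M" "y \<in> carrier N" "l \<le> n"
  shows "mat_tensor (matrix_unit M i l x) (matrix_unit N l j y) = matrix_unit Y i j (\<tau> x y)"
proof (intro ext)
  fix i' j'
  have "\<tau> (matrix_unit M i l x i' l') (matrix_unit N l j y l' j') =
      (if l' = l then matrix_unit Y i j (\<tau> x y) i' j' else \<zero>\<^bsub>Y\<^esub>)" for l'
    using assms by (auto simp: matrix_unit_def \<tau>_zero_left \<tau>_zero_right)
  moreover have "matrix_unit Y i j (\<tau> x y) i' j' \<in> carrier Y"
    using assms by (auto simp: matrix_unit_def \<tau>_simps)
  ultimately show "mat_tensor (matrix_unit M i l x) (matrix_unit N l j y) i' j' = matrix_unit Y i j (\<tau> x y) i' j'"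
    using assms by (simp add: mat_tensor_def Y.M.finsum_single[of _ l])
qed

text \<open>Degrees are nonnegative, so a pure tensor of degrees \<open>p\<close> and
  \<open>q\<close> with \<open>p + q = j - i\<close> passes through a middle index
  \<open>i + p\<close> between \<open>i\<close> and \<open>j\<close>: at position
  \<open>(i, j)\<close> it is the product of matrix units at \<open>(i, i + p)\<close> and
  \<open>(i + p, j)\<close>.\<close>

lemma matrix_unit_image:
  assumes h: "h \<in> bihom L.barA R.barB T'.T Y.barM"
    and hp: "\<And>X Z. X \<in> carrier L.barM \<Longrightarrow> Z \<in> carrier R.barM \<Longrightarrow> h (T'.pt X Z) = mat_tensor X Z"
    and "i \<le> j" "j \<le> n" "y \<in> gY (j - i)"
  shows "matrix_unit Y i j y \<in> h ` carrier T'.T"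
proof -
  have pure: "matrix_unit Y i j (\<tau> x z) \<in> h ` carrier T'.T"
    if "x \<in> gM p" "z \<in> gN q" "p + q = j - i" for x z p q
  proof
    have x: "x \<in> entry n M gM i (i + p)" and z: "z \<in> entry n N gN (i + p) j"
    proof -
      have "i + p \<le> n" "i + p \<le> j" "j - (i + p) = q" using that assms(3,4) by linarith+
      then show "x \<in> entry n M gM i (i + p)" "z \<in> entry n N gN (i + p) j"
        using that assms by (auto simp: entry_def)
    qed
    have "i + p \<le> n" using that assms(3,4) by linarith
    then show "matrix_unit Y i j (\<tau> x z) = h (T'.pt (matrix_unit M i (i + p) x) (matrix_unit N (i + p) j z))"
      using x z by (simp add: hp L.matrix_unit_bar R.matrix_unit_bar mat_tensor_matrix_units
          L.entry_M R.entry_M del: bg_bimodule_simps)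
    show "T'.pt (matrix_unit M i (i + p) x) (matrix_unit N (i + p) j z) \<in> carrier T'.T"
      using x z by (intro T'.pure_closed L.matrix_unit_bar R.matrix_unit_bar)
  qed
  have T: "abelian_group T.T" by (rule T.abelian_group_tensor)
  interpret T: abelian_group T.T by fact
  obtain t where t: "t \<in> tensor_grade B M gM N gN (j - i)" "y = f t"
    using assms(5) f_grade[of "j - i"] by auto
  \<comment> \<open>Membership in the carrier is part of the induction because \<open>f\<close> is
    known to be additive only there.\<close>
  have "t \<in> carrier T.T \<and> matrix_unit Y i j (f t) \<in> h ` carrier T'.T"
    using t(1) unfolding tensor_grade_def
  proof (induction rule: generate.induct)
    case one
    have "matrix_unit Y i j \<zero>\<^bsub>Y\<^esub> = h \<zero>\<^bsub>T'.T\<^esub>"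
      using ahom_zero[OF T'.abelian_group_tensor Y.abelian_group_bar bihom_ahom[OF h]]
      by (simp add: matrix_unit_def fun_eq_iff)
    then show ?case
      using ahom_zero[OF T Y.abelian_group_M bihom_ahom[OF f_bihom]]
        abelian_monoid.zero_closed[OF abelian_group.axioms(1)[OF T'.abelian_group_tensor]]
      by simp
  next
    case (incl u)
    then obtain x z p q where "u = T.pt x z" "x \<in> gM p" "z \<in> gN q" "p + q = j - i" by blast
    then show ?case using pure[of x p z q] T.pure_closed[of x z] L.gM R.gM by (auto simp: \<tau>_def)
  next
    case (inv u)
    then obtain x z p q where u: "u = T.pt x z" "x \<in> gM p" "z \<in> gN q" "p + q = j - i" by blast
    have xz: "x \<in> carrier M" "z \<in> carrier N" using u L.gM R.gM by auto
    \<comment> \<open>The left factor absorbs the sign, so the inverse of a generator is again a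
      homogeneous pure tensor.\<close>
    have "inv\<^bsub>add_monoid T.T\<^esub> u = T.pt (\<ominus>\<^bsub>M\<^esub> x) z"
      using ahom_minus[OF L.abelian_group_M T balanced_map_ahom_left[OF T.balanced_map_pure xz(2)] xz(1)] u
      by (simp add: a_inv_def)
    then show ?case
      using pure[of "\<ominus>\<^bsub>M\<^esub> x" p z q] T.pure_closed[of "\<ominus>\<^bsub>M\<^esub> x" z] L.gM(4)[of x p] u xz
      by (auto simp: \<tau>_def)
  next
    case (eng u v)
    then obtain a b where ab: "a \<in> carrier T'.T" "b \<in> carrier T'.T"
      "matrix_unit Y i j (f u) = h a" "matrix_unit Y i j (f v) = h b" by auto
    have "matrix_unit Y i j (f (u \<oplus>\<^bsub>T.T\<^esub> v)) = matrix_unit Y i j (f u) \<oplus>\<^bsub>Y.barM\<^esub> matrix_unit Y i j (f v)"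
      using eng bihom_add[OF f_bihom, of u v] by (auto simp: matrix_unit_def fun_eq_iff)
    also have "\<dots> = h (a \<oplus>\<^bsub>T'.T\<^esub> b)" using ab bihom_add[OF h, of a b] by simp
    finally show ?case
      using eng ab abelian_monoid.a_closed[OF abelian_group.axioms(1)[OF T'.abelian_group_tensor]]
      by auto
  qed
  then show ?thesis using t by simp
qed

lemma bar_tensor_surj:
  assumes h: "h \<in> bihom L.barA R.barB T'.T Y.barM"
    and hp: "\<And>X Z. X \<in> carrier L.barM \<Longrightarrow> Z \<in> carrier R.barM \<Longrightarrow> h (T'.pt X Z) = mat_tensor X Z"
  shows "h ` carrier T'.T = carrier Y.barM"
proof
  show "h ` carrier T'.T \<subseteq> carrier Y.barM" using bihom_closed[OF h] by blast
  interpret T': abelian_group T'.T by (rule T'.abelian_group_tensor)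
  show "carrier Y.barM \<subseteq> h ` carrier T'.T"
  proof
    fix W assume W: "W \<in> carrier Y.barM"
    have "\<exists>t\<in>carrier T'.T. h t = matrix_unit Y i j (W i j)" for i j
    proof (cases "i \<le> j \<and> j \<le> n")
      case True
      have "W i j \<in> entry n Y gY i j" using W by simp
      then have "W i j \<in> gY (j - i)" using True by (simp add: entry_def)
      from matrix_unit_image[OF h hp _ _ this] True show ?thesis by force
    next
      case False
      have "W i j \<in> entry n Y gY i j" using W by simp
      then have "W i j = \<zero>\<^bsub>Y\<^esub>" using False by (auto simp: entry_def split: if_splits)
      then show ?thesis
        using ahom_zero[OF T'.abelian_group_axioms Y.abelian_group_bar bihom_ahom[OF h]]
        by (intro bexI[of _ "\<zero>\<^bsub>T'.T\<^esub>"]) (auto simp: matrix_unit_def)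
    qed
    then obtain t where t: "t i j \<in> carrier T'.T" "h (t i j) = matrix_unit Y i j (W i j)" for i j
      by metis
    have "h (\<Oplus>\<^bsub>T'.T\<^esub>p\<in>{..n} \<times> {..n}. case_prod t p) = (\<Oplus>\<^bsub>Y.barM\<^esub>p\<in>{..n} \<times> {..n}. h (case_prod t p))"
      using t(1) by (intro ahom_finsum[OF T'.abelian_group_axioms Y.abelian_group_bar bihom_ahom[OF h]]) auto
    also have "(\<lambda>p. h (case_prod t p)) = (\<lambda>(i, j). matrix_unit Y i j (W i j))"
      using t(2) by (auto simp: fun_eq_iff)
    also have "finsum Y.barM \<dots> ({..n} \<times> {..n}) = W"
      using Y.bar_matrix_units[OF W] by simp
    finally have "h (\<Oplus>\<^bsub>T'.T\<^esub>p\<in>{..n} \<times> {..n}. case_prod t p) = W" .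
    moreover have "(\<Oplus>\<^bsub>T'.T\<^esub>p\<in>{..n} \<times> {..n}. case_prod t p) \<in> carrier T'.T"
      by (rule T'.finsum_closedI) (simp add: t(1) split: prod.splits)
    ultimately show "W \<in> h ` carrier T'.T" by blast
  qed
qed

text \<open>A dual basis of \<open>M\<close> as right module expresses \<open>t\<close> through elements of \<open>barN\<close> that depend
  only on the image of \<open>t\<close>.\<close>

lemma bar_tensor_kernel:
  assumes proj: "graded_right_projective K B gB M gM"
    and h: "h \<in> bihom L.barA R.barB T'.T Y.barM"
    and hp: "\<And>X Z. X \<in> carrier L.barM \<Longrightarrow> Z \<in> carrier R.barM \<Longrightarrow> h (T'.pt X Z) = mat_tensor X Z"
    and t: "t \<in> carrier T'.T" "h t = \<zero>\<^bsub>Y.barM\<^esub>"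
  shows "t = \<zero>\<^bsub>T'.T\<^esub>"
proof -
  obtain I :: "(nat \<times> nat) set" and s \<phi> \<Phi> \<Psi> where fin: "finite I"
    and \<phi>: "\<And>i k. (i, k) \<in> I \<Longrightarrow> \<phi> k \<in> bihom K B (as_right M) (as_right (regular B))"
    and \<Phi>: "\<And>p. p \<in> I \<Longrightarrow> \<Phi> p \<in> bihom K L.barB (as_right L.barM) (as_right (regular L.barB))"
    and \<Psi>: "\<And>p. p \<in> I \<Longrightarrow> \<Psi> p \<in> bihom K L.barB (as_right (regular L.barB)) (as_right L.barM)"
    and sum: "\<And>X. X \<in> carrier L.barM \<Longrightarrow> (\<Oplus>\<^bsub>L.barM\<^esub>p\<in>I. \<Psi> p (\<Phi> p X)) = X"
    and \<Phi>_eq: "\<And>i k X. \<Phi> (i, k) X = (\<lambda>l j. if l = i + s k then \<phi> k (X i j) else \<zero>\<^bsub>B\<^esub>)"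
    apply (rule L.right_dual_basis[OF proj])
    subgoal premises p for I s \<phi> \<Phi> \<Psi> by (rule p(1)[OF p(2-)])
    done
  interpret T': abelian_group T'.T by (rule T'.abelian_group_tensor)
  interpret bB: fd_algebra K L.barB by (rule fd_algebra_beilinson_green[OF L.gr_alg_B])
  interpret bM: bimodule K L.barA L.barB L.barM by (rule L.bimodule_bar)
  interpret bN: bimodule K L.barB R.barB R.barM by (rule R.bimodule_bar)
  note \<Phi>s = bihomD[OF \<Phi>, unfolded as_right_simps regular_simps]
  note \<Psi>s = bihomD[OF \<Psi>, unfolded as_right_simps regular_simps]
  note \<phi>s = bihomD[OF \<phi>, unfolded as_right_simps regular_simps]
  \<comment> \<open>\<open>g p\<close> is \<open>\<Phi> p\<close> tensored with the identity,
    followed by the action of \<open>L.barB\<close> on \<open>R.barM\<close>.\<close>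
  have "\<exists>g. g \<in> ahom T'.T R.barM \<and> (\<forall>X\<in>carrier L.barM. \<forall>Z\<in>carrier R.barM.
      g (T'.pt X Z) = lact R.barM (\<Phi> p X) Z)" if p: "p \<in> I" for p
  proof -
    have "balanced_map L.barB L.barM R.barM R.barM (\<lambda>X Z. lact R.barM (\<Phi> p X) Z)"
      by (rule balanced_mapI)
        (simp_all add: \<Phi>s[OF p] bN.lact_closed bN.lact_add_left bN.lact_add_right bN.lact_mult
          del: bg_bimodule_simps)
    from T'.tensor_universal[OF R.abelian_group_bar this] show ?thesis by metis
  qed
  then obtain g where g: "\<And>p. p \<in> I \<Longrightarrow> g p \<in> ahom T'.T R.barM"
    and gp: "\<And>p X Z. p \<in> I \<Longrightarrow> X \<in> carrier L.barM \<Longrightarrow> Z \<in> carrier R.barM \<Longrightarrow>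
      g p (T'.pt X Z) = lact R.barM (\<Phi> p X) Z"
    by metis
  let ?one = "\<one>\<^bsub>L.barB\<^esub>"
  have \<Psi>1: "\<Psi> p ?one \<in> carrier L.barM" if "p \<in> I" for p
    using \<Psi>s(2)[OF that] bB.one_closed by blast
  \<comment> \<open>The matrices \<open>\<Psi> p ?one\<close> are the dual basis elements, and
    \<open>E\<close> expands a tensor in them with coefficients \<open>g p u\<close>.\<close>
  define E where "E u = (\<Oplus>\<^bsub>T'.T\<^esub>p\<in>I. T'.pt (\<Psi> p ?one) (g p u))" for u
  have E: "E \<in> ahom T'.T T'.T"
    unfolding E_def
  proof (rule finsum_ahomI[OF T'.abelian_group_axioms T'.abelian_group_axioms])
    fix p assume "p \<in> I"
    then show "(\<lambda>u. T'.pt (\<Psi> p ?one) (g p u)) \<in> ahom T'.T T'.T"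
      by (intro ahom_comp[OF g balanced_map_ahom_right[OF T'.balanced_map_pure \<Psi>1]])
  qed
  \<comment> \<open>On a pure tensor the coefficients \<open>\<Phi> p X\<close> move across to the
    left factor, where the dual basis identity sums them to \<open>X\<close>.\<close>
  have "E t = t"
  proof (rule T'.tensor_hom_eqI[OF T'.abelian_group_axioms E _ t(1)])
    show "(\<lambda>u. u) \<in> ahom T'.T T'.T" by (rule ahomI) simp_all
    fix X Z assume X: "X \<in> carrier L.barM" and Z: "Z \<in> carrier R.barM"
    have "E (T'.pt X Z) = (\<Oplus>\<^bsub>T'.T\<^esub>p\<in>I. T'.pt (\<Psi> p (\<Phi> p X)) Z)"
      unfolding E_def
    proof (rule T'.finsum_congI)
      fix p assume p: "p \<in> I"
      have \<Phi>X: "\<Phi> p X \<in> carrier L.barB" using \<Phi>s(2)[OF p] X by blast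
      have "T'.pt (\<Psi> p ?one) (g p (T'.pt X Z)) = T'.pt (ract L.barM (\<Psi> p ?one) (\<Phi> p X)) Z"
        using T'.pure_ract[OF \<Psi>1[OF p] \<Phi>X Z] gp[OF p X Z] by simp
      also have "ract L.barM (\<Psi> p ?one) (\<Phi> p X) = \<Psi> p (\<Phi> p X)"
        using \<Psi>s(5)[OF p bB.one_closed \<Phi>X] \<Phi>X by simp
      finally show "T'.pt (\<Psi> p ?one) (g p (T'.pt X Z)) = T'.pt (\<Psi> p (\<Phi> p X)) Z" .
      show "T'.pt (\<Psi> p (\<Phi> p X)) Z \<in> carrier T'.T"
        using \<Psi>s(2)[OF p \<Phi>X] Z by (rule T'.pure_closed)
    qed
    also have "\<dots> = T'.pt (\<Oplus>\<^bsub>L.barM\<^esub>p\<in>I. \<Psi> p (\<Phi> p X)) Z"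
      using \<Psi>s(2) \<Phi>s(2) X
      by (intro ahom_finsum[OF L.abelian_group_bar T'.abelian_group_axioms
            balanced_map_ahom_left[OF T'.balanced_map_pure Z], symmetric]) (auto simp del: bg_bimodule_simps)
    finally show "E (T'.pt X Z) = T'.pt X Z" using sum[OF X] by simp
  qed
  \<comment> \<open>Row \<open>i + s k\<close> of \<open>g p t\<close> is computed from row
    \<open>i\<close> of \<open>h t\<close>, and all its other rows vanish; hence \<open>h t\<close>
    determines \<open>g p t\<close>.\<close>
  moreover have "g p t = \<zero>\<^bsub>R.barM\<^esub>" if p: "p \<in> I" for p
  proof (intro ext)
    fix i' j
    obtain i k where ik: "p = (i, k)" by (cases p)
    note \<phi>k = \<phi>s[OF p[unfolded ik]]
    have \<phi>0: "\<phi> k \<zero>\<^bsub>M\<^esub> = \<zero>\<^bsub>B\<^esub>"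
      using ahom_zero[OF abelian_group_as_right[OF L.abelian_group_M] _ bihom_ahom[OF \<phi>[OF p[unfolded ik]]]]
        biact.abelian_group[OF biact_as_right[OF bimodule_regular[OF L.alg_B]]] by simp
    have bal: "balanced_map B M N N (\<lambda>x y. lact N (\<phi> k x) y)"
      by (rule balanced_mapI)
        (simp_all add: \<phi>k R.M.lact_closed R.M.lact_add_left R.M.lact_add_right R.M.lact_mult)
    obtain \<kappa>' where \<kappa>': "\<kappa>' \<in> ahom T.T N"
      and \<kappa>'p: "\<And>x y. x \<in> carrier M \<Longrightarrow> y \<in> carrier N \<Longrightarrow> \<kappa>' (T.pt x y) = lact N (\<phi> k x) y"
      using T.tensor_universal[OF R.abelian_group_M bal] by metis
    let ?f' = "inv_into (carrier T.T) f"
    \<comment> \<open>\<open>\<kappa>\<close> sends \<open>\<tau> x y\<close> to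
      \<open>lact N (\<phi> k x) y\<close>. Being additive on \<open>Y\<close>, it can be applied to
      the entries of \<open>h t\<close>, where the summands of the matrix product are no longer
      visible.\<close>
    define \<kappa> where "\<kappa> = (\<lambda>y. \<kappa>' (?f' y))"
    have f': "?f' \<in> bihom A C Y T.T"
      using biiso_inv[OF T.biact_tensor f_biiso] by (simp add: biiso_def)
    have \<kappa>: "\<kappa> \<in> ahom Y N" unfolding \<kappa>_def by (rule ahom_comp[OF bihom_ahom[OF f'] \<kappa>'])
    have "?f' (\<tau> x y) = T.pt x y" if "x \<in> carrier M" "y \<in> carrier N" for x y
      using f_biiso T.pure_closed[OF that] by (simp add: \<tau>_def biiso_def bij_betw_def)
    then have \<kappa>p: "\<kappa> (\<tau> x y) = lact N (\<phi> k x) y" if "x \<in> carrier M" "y \<in> carrier N" for x y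
      using that by (simp add: \<kappa>_def \<kappa>'p)
    have "(\<lambda>u. g p u i' j) \<in> ahom T'.T N" by (rule ahom_comp[OF g[OF p] R.bar_eval_ahom])
    moreover have "(\<lambda>u. if i' = i + s k then \<kappa> (h u i j) else \<zero>\<^bsub>N\<^esub>) \<in> ahom T'.T N"
      using ahom_comp[OF ahom_comp[OF bihom_ahom[OF h] Y.bar_eval_ahom[of i j]] \<kappa>]
      by (cases "i' = i + s k") (auto intro: ahomI)
    moreover have "g p (T'.pt X Z) i' j = (if i' = i + s k then \<kappa> (h (T'.pt X Z) i j) else \<zero>\<^bsub>N\<^esub>)"
      if XZ: "X \<in> carrier L.barM" "Z \<in> carrier R.barM" for X Z
    proof -
      have [simp]: "X i j \<in> carrier M" "Z i j \<in> carrier N" for i j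
        using XZ by (simp_all add: L.entries_M R.entries_M)
      have "g p (T'.pt X Z) i' j = (\<Oplus>\<^bsub>N\<^esub>l\<in>{..n}. lact N (if i' = i + s k then \<phi> k (X i l) else \<zero>\<^bsub>B\<^esub>) (Z l j))"
        using gp[OF p XZ] by (simp add: ik \<Phi>_eq)
      also have "\<dots> = (if i' = i + s k then (\<Oplus>\<^bsub>N\<^esub>l\<in>{..n}. lact N (\<phi> k (X i l)) (Z l j)) else \<zero>\<^bsub>N\<^esub>)"
        by (auto simp: R.lact_zero_left intro!: R.M.finsum_zeroI)
      also have "(\<Oplus>\<^bsub>N\<^esub>l\<in>{..n}. lact N (\<phi> k (X i l)) (Z l j)) = (\<Oplus>\<^bsub>N\<^esub>l\<in>{..n}. \<kappa> (\<tau> (X i l) (Z l j)))"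
        by (simp add: \<kappa>p)
      also have "\<dots> = \<kappa> (h (T'.pt X Z) i j)"
        unfolding hp[OF XZ] mat_tensor_def
        by (rule ahom_finsum[OF Y.abelian_group_M R.abelian_group_M \<kappa>, symmetric]) (simp add: \<tau>_simps)
      finally show ?thesis .
    qed
    ultimately have "g p t i' j = (if i' = i + s k then \<kappa> (h t i j) else \<zero>\<^bsub>N\<^esub>)"
      by (rule T'.tensor_hom_eqI[OF R.abelian_group_M _ _ t(1)])
    then show "g p t i' j = \<zero>\<^bsub>R.barM\<^esub> i' j"
      using ahom_zero[OF Y.abelian_group_M R.abelian_group_M \<kappa>] by (simp add: t(2))
  qed
  then have "E t = \<zero>\<^bsub>T'.T\<^esub>"
    unfolding E_def
    using ahom_zero[OF R.abelian_group_bar T'.abelian_group_axioms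
        balanced_map_ahom_right[OF T'.balanced_map_pure \<Psi>1]]
    by (intro T'.finsum_zeroI) (simp del: bg_bimodule_simps)
  ultimately show ?thesis by simp
qed

text \<open>Surjectivity is a matter of degrees; right projectivity of \<open>M\<close> enters
  through the kernel.\<close>

theorem bar_tensor_biiso:
  assumes "graded_right_projective K B gB M gM"
  shows "biiso L.barA R.barB (tensor L.barB L.barM R.barM) Y.barM \<noteq> {}"
proof -
  interpret T'g: abelian_group T'.T by (rule T'.abelian_group_tensor)
  obtain h where h: "h \<in> bihom L.barA R.barB T'.T Y.barM"
    and hp: "\<And>X Z. X \<in> carrier L.barM \<Longrightarrow> Z \<in> carrier R.barM \<Longrightarrow> h (T'.pt X Z) = mat_tensor X Z"
    apply (rule T'.tensor_bihom[OF Y.biact_bar mat_tensor_balanced])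
      apply (rule mat_tensor_lact; assumption)
     apply (rule mat_tensor_ract; assumption)
    subgoal premises p for h by (rule p(1)[OF p(2-)])
    done
  have "inj_on h (carrier T'.T)"
  proof (rule inj_onI)
    fix u v assume uv: "u \<in> carrier T'.T" "v \<in> carrier T'.T" "h u = h v"
    have "h (u \<ominus>\<^bsub>T'.T\<^esub> v) = h v \<oplus>\<^bsub>Y.barM\<^esub> \<ominus>\<^bsub>Y.barM\<^esub> h v"
      using uv bihom_add[OF h] ahom_minus[OF T'.abelian_group_tensor Y.abelian_group_bar bihom_ahom[OF h]]
      by (simp add: a_minus_def del: bg_bimodule_simps)
    also have "\<dots> = \<zero>\<^bsub>Y.barM\<^esub>"
      by (rule abelian_group.r_neg[OF Y.abelian_group_bar bihom_closed[OF h uv(2)]])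
    finally have "u \<ominus>\<^bsub>T'.T\<^esub> v = \<zero>\<^bsub>T'.T\<^esub>"
      using uv by (intro bar_tensor_kernel[OF assms h hp]) auto
    moreover have "(u \<ominus>\<^bsub>T'.T\<^esub> v) \<oplus>\<^bsub>T'.T\<^esub> v = u"
      using uv by (simp add: T'g.minus_eq T'g.a_assoc T'g.l_neg)
    ultimately show "u = v" using uv by simp
  qed
  then have "h \<in> biiso L.barA R.barB T'.T Y.barM"
    using h bar_tensor_surj[OF h hp] by (auto simp: biiso_def bij_betw_def)
  then show ?thesis by blast
qed

end


section \<open>Projective bimodules of triangular matrices\<close>

lemma free_bimodule_tensor_biact:
  assumes "fd_algebra K A" "fd_algebra K B"
  shows "tensor_biact A K B (as_left (regular A)) (as_right (regular B))"
proof -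
  interpret A: fd_algebra K A by fact
  interpret B: fd_algebra K B by fact
  have "biact A K (as_left (regular A))" "biact K B (as_right (regular B))"
    using biact_as_left[OF bimodule_regular[OF assms(1)]] biact_as_right[OF bimodule_regular[OF assms(2)]]
    by auto
  then show ?thesis
    by (intro tensor_biact.intro tensor_factors.intro tensor_factors_axioms.intro
        tensor_biact_axioms.intro)
      (auto simp: A.smult_mult_right B.smult_mult_left intro: biact.abelian_group)
qed

text \<open>A piece of \<open>tensor_grade\<close> is generated by the pure tensors of one total
  degree, so identities valid in that degree alone can be tested on them.\<close>

lemma ahom_eq_on_generate:
  assumes "abelian_group X" "abelian_group Y" "f \<in> ahom X Y" "g \<in> ahom X Y"
    and S: "S \<subseteq> carrier X" "\<And>s. s \<in> S \<Longrightarrow> f s = g s"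
    and t: "t \<in> generate (add_monoid X) S"
  shows "f t = g t"
proof -
  interpret X: abelian_group X by fact
  note simps = ahom_zero[OF assms(1,2)] ahom_minus[OF assms(1,2)] ahom_add
  have "t \<in> carrier X \<and> f t = g t"
    using t
  proof (induction rule: generate.induct)
    case one
    then show ?case using simps(1)[OF assms(3)] simps(1)[OF assms(4)] by simp
  next
    case (incl s)
    then show ?case using S by auto
  next
    case (inv s)
    then have "s \<in> carrier X" using S by auto
    then show ?case using simps(2)[OF assms(3)] simps(2)[OF assms(4)] S(2)[OF inv]
      by (simp add: a_inv_def[symmetric])
  next
    case (eng s t)
    then show ?case using simps(3)[OF assms(3), of s t] simps(3)[OF assms(4), of s t] by simp
  qed
  then show ?thesis ..
qed

text \<open>The projection to degree \<open>j - i\<close> makes \<open>place\<close> additive on all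
  of \<open>A\<close>. It can then be tensored with its counterpart for \<open>B\<close>, whatever
  the degrees of the factors of a pure tensor.\<close>

definition place :: "nat \<Rightarrow> ('k, 'a) module \<Rightarrow> (nat \<Rightarrow> 'a set) \<Rightarrow> nat \<Rightarrow> nat \<Rightarrow> 'a \<Rightarrow> nat \<Rightarrow> nat \<Rightarrow> 'a" where
  "place n A gA i j x =
     matrix_unit A i j (if i \<le> j \<and> j \<le> n then homogeneous_part A gA (j - i) x else \<zero>\<^bsub>A\<^esub>)"

context
  fixes K :: "('k, 'x) ring_scheme" and n :: nat and A :: "('k, 'a) module" and gA :: "nat \<Rightarrow> 'a set"
  assumes gr_alg: "graded_algebra K n A gA"
begin

interpretation R: graded_bimod K n A gA A gA "regular A" gA by (rule graded_bimod_regular[OF gr_alg])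

lemmas hp = homogeneous_part_in[OF R.module_A R.grading_A R.deg_A]
  homogeneous_part_sum[OF R.module_A R.grading_A R.deg_A]
  homogeneous_part_closed[OF R.module_A R.grading_A R.deg_A]
  homogeneous_part_ahom[OF R.module_A R.grading_A R.deg_A]
  homogeneous_part_smult[OF R.module_A R.grading_A R.deg_A]
  homogeneous_part_homogeneous[OF R.module_A R.grading_A R.deg_A]

lemma graded_algebra_mult: "a \<in> gA i \<Longrightarrow> b \<in> gA j \<Longrightarrow> a \<otimes>\<^bsub>A\<^esub> b \<in> gA (i + j)"
  using gr_alg by (auto simp: graded_algebra_def)

text \<open>As \<open>f\<close> raises degrees by \<open>c\<close>, it turns the decomposition of
  \<open>x\<close> into that of \<open>f x\<close>, with the components reindexed.\<close>

lemma homogeneous_part_shift: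
  assumes f: "f \<in> ahom A A" "\<And>e y. y \<in> gA e \<Longrightarrow> f y \<in> gA (c + e)" and x: "x \<in> carrier A"
  shows "homogeneous_part A gA d (f x) =
    (if c \<le> d then f (homogeneous_part A gA (d - c) x) else \<zero>\<^bsub>A\<^esub>)"
proof -
  note [simp] = ahom_closed[OF f(1) hp(3)[OF x]]
  have eq: "homogeneous_part A gA d (f (homogeneous_part A gA e x)) =
      (if d = c + e then f (homogeneous_part A gA e x) else \<zero>\<^bsub>A\<^esub>)" for e
    by (rule hp(6)[OF f(2)[OF hp(1)[OF x]]])
  have "homogeneous_part A gA d (f x) =
      homogeneous_part A gA d (f (\<Oplus>\<^bsub>A\<^esub>e\<in>{..n}. homogeneous_part A gA e x))"
    by (simp add: hp(2) x)
  also have "\<dots> = (\<Oplus>\<^bsub>A\<^esub>e\<in>{..n}. if d = c + e then f (homogeneous_part A gA e x) else \<zero>\<^bsub>A\<^esub>)"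
    unfolding eq[symmetric] using x hp(3)
    by (intro ahom_finsum[OF R.abelian_group_A R.abelian_group_A ahom_comp[OF f(1) hp(4)]]) auto
  also have "\<dots> = (if c \<le> d then f (homogeneous_part A gA (d - c) x) else \<zero>\<^bsub>A\<^esub>)"
  proof (cases "c \<le> d \<and> d - c \<le> n")
    case True
    then show ?thesis by (subst R.A.finsum_single[of _ "d - c"]) auto
  next
    case False
    \<comment> \<open>An index \<open>d - c > n\<close> does not occur in the sum, but there the
      component of \<open>x\<close> is zero by the degree bound.\<close>
    have "homogeneous_part A gA (d - c) x = \<zero>\<^bsub>A\<^esub>" if "\<not> d - c \<le> n"
      using that R.deg_A hp(1)[OF x, of "d - c"] by (auto simp: degree_le_def)
    then show ?thesis
      using False ahom_zero[OF R.abelian_group_A R.abelian_group_A f(1)] by (auto intro!: R.A.finsum_zeroI)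
  qed
  finally show ?thesis .
qed

lemma homogeneous_part_mult_left:
  assumes "z \<in> gA c" "x \<in> carrier A"
  shows "homogeneous_part A gA d (z \<otimes>\<^bsub>A\<^esub> x) =
    (if c \<le> d then z \<otimes>\<^bsub>A\<^esub> homogeneous_part A gA (d - c) x else \<zero>\<^bsub>A\<^esub>)"
  using assms R.gA(1)[OF assms(1)]
  by (intro homogeneous_part_shift ahomI) (auto simp: R.A.r_distr graded_algebra_mult)

lemma homogeneous_part_mult_right:
  assumes "z \<in> gA c" "x \<in> carrier A"
  shows "homogeneous_part A gA d (x \<otimes>\<^bsub>A\<^esub> z) =
    (if c \<le> d then homogeneous_part A gA (d - c) x \<otimes>\<^bsub>A\<^esub> z else \<zero>\<^bsub>A\<^esub>)"
  using assms R.gA(1)[OF assms(1)] graded_algebra_mult[OF _ assms(1)]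
  by (intro homogeneous_part_shift[where f = "\<lambda>x. x \<otimes>\<^bsub>A\<^esub> z"] ahomI) (auto simp: R.A.l_distr add.commute)

lemma beilinson_green_finsum:
  assumes "\<And>k. k \<in> I \<Longrightarrow> f k \<in> carrier (beilinson_green n A gA)"
  shows "finsum (beilinson_green n A gA) f I i j = (\<Oplus>\<^bsub>A\<^esub>k\<in>I. f k i j)"
  using R.bar_finsum[of I f i j] assms
  by (simp only: regular_beilinson_green[symmetric] finsum_regular regular_simps)

lemma beilinson_green_entry:
  "Y \<in> carrier (beilinson_green n A gA) \<Longrightarrow> Y i j \<in> entry n A gA i j"
  "Y \<in> carrier (beilinson_green n A gA) \<Longrightarrow> Y i j \<in> carrier A"
  by (auto simp: beilinson_green_simps R.entries_A)

lemma place_closed: "x \<in> carrier A \<Longrightarrow> place n A gA i j x \<in> carrier (beilinson_green n A gA)"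
  by (auto simp: place_def matrix_unit_def beilinson_green_simps entry_def hp(1) R.gA)

lemma place_ahom: "place n A gA i j \<in> ahom A (beilinson_green n A gA)"
  by (intro ahomI place_closed)
    (auto simp: place_def matrix_unit_def beilinson_green_simps fun_eq_iff ahom_add[OF hp(4)])

lemma place_smult:
  "c \<in> carrier K \<Longrightarrow> x \<in> carrier A \<Longrightarrow>
    place n A gA i j (c \<odot>\<^bsub>A\<^esub> x) = c \<odot>\<^bsub>beilinson_green n A gA\<^esub> place n A gA i j x"
  by (auto simp: place_def matrix_unit_def beilinson_green_simps fun_eq_iff hp(5))

text \<open>Only row \<open>l\<close> of the placed matrix is nonzero, so column \<open>l\<close> of
  \<open>Y\<close> is multiplied by one element. In row \<open>i\<close> this gives
  \<open>Y i l\<close> times the degree \<open>a - l\<close> part of \<open>x\<close>; since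
  \<open>Y i l\<close> has degree \<open>l - i\<close>, that is the degree \<open>a - i\<close> part
  of the full product.\<close>

lemma place_mult_left:
  assumes Y: "Y \<in> carrier (beilinson_green n A gA)" and x: "x \<in> carrier A" and l: "l \<le> n"
  shows "Y \<otimes>\<^bsub>beilinson_green n A gA\<^esub> place n A gA l a x =
    (\<Oplus>\<^bsub>beilinson_green n A gA\<^esub>i\<in>{..n}. place n A gA i a (Y i l \<otimes>\<^bsub>A\<^esub> x))"
proof (intro ext)
  fix i' a'
  note Ye = beilinson_green_entry[OF Y]
  have "(Y \<otimes>\<^bsub>beilinson_green n A gA\<^esub> place n A gA l a x) i' a' =
      (if a' = a \<and> l \<le> a \<and> a \<le> n then Y i' l \<otimes>\<^bsub>A\<^esub> homogeneous_part A gA (a - l) x else \<zero>\<^bsub>A\<^esub>)"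
    unfolding beilinson_green_simps
    using Ye(2) l x
    by (subst R.A.finsum_single[of _ l]) (auto simp: place_def matrix_unit_def hp(3))
  also have "\<dots> = (if a' = a \<and> i' \<le> a \<and> a \<le> n then homogeneous_part A gA (a - i') (Y i' l \<otimes>\<^bsub>A\<^esub> x) else \<zero>\<^bsub>A\<^esub>)"
  proof (cases "i' \<le> l")
    case True
    then have "Y i' l \<in> gA (l - i')" using Ye(1)[of i' l] l by (simp add: entry_def)
    from homogeneous_part_mult_left[OF this x] True show ?thesis by auto
  next
    case False
    then have "Y i' l = \<zero>\<^bsub>A\<^esub>" using Ye(1)[of i' l] by (simp add: entry_def)
    then show ?thesis using x hp(3) ahom_zero[OF R.abelian_group_A R.abelian_group_A hp(4)] by simp
  qed
  also have "\<dots> = (\<Oplus>\<^bsub>A\<^esub>i\<in>{..n}. place n A gA i a (Y i l \<otimes>\<^bsub>A\<^esub> x) i' a')"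
  proof (cases "i' \<le> n")
    case True
    then show ?thesis using Ye(2) x
      by (subst R.A.finsum_single[of _ i']) (auto simp: place_def matrix_unit_def hp(3))
  next
    case False
    then show ?thesis
      by (intro trans[OF _ R.A.finsum_zeroI[symmetric]]) (auto simp: place_def matrix_unit_def)
  qed
  also have "\<dots> = (\<Oplus>\<^bsub>beilinson_green n A gA\<^esub>i\<in>{..n}. place n A gA i a (Y i l \<otimes>\<^bsub>A\<^esub> x)) i' a'"
    using Ye(2) x by (intro beilinson_green_finsum[symmetric] place_closed) auto
  finally show "(Y \<otimes>\<^bsub>beilinson_green n A gA\<^esub> place n A gA l a x) i' a' = \<dots>" .
qed

text \<open>The mirror image: one element is multiplied by row \<open>l\<close> of \<open>Y\<close>,
  the degrees being \<open>l - b\<close> and \<open>j - l\<close>.\<close>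

lemma place_mult_right:
  assumes Y: "Y \<in> carrier (beilinson_green n A gA)" and x: "x \<in> carrier A" and l: "l \<le> n"
  shows "place n A gA b l x \<otimes>\<^bsub>beilinson_green n A gA\<^esub> Y =
    (\<Oplus>\<^bsub>beilinson_green n A gA\<^esub>j\<in>{..n}. place n A gA b j (x \<otimes>\<^bsub>A\<^esub> Y l j))"
proof (intro ext)
  fix b' j'
  note Ye = beilinson_green_entry[OF Y]
  have "(place n A gA b l x \<otimes>\<^bsub>beilinson_green n A gA\<^esub> Y) b' j' =
      (if b' = b \<and> b \<le> l then homogeneous_part A gA (l - b) x \<otimes>\<^bsub>A\<^esub> Y l j' else \<zero>\<^bsub>A\<^esub>)"
    unfolding beilinson_green_simps
    using Ye(2) l x
    by (subst R.A.finsum_single[of _ l]) (auto simp: place_def matrix_unit_def hp(3))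
  also have "\<dots> = (if b' = b \<and> b \<le> j' \<and> j' \<le> n then homogeneous_part A gA (j' - b) (x \<otimes>\<^bsub>A\<^esub> Y l j') else \<zero>\<^bsub>A\<^esub>)"
  proof (cases "l \<le> j' \<and> j' \<le> n")
    case True
    then have "Y l j' \<in> gA (j' - l)" using Ye(1)[of l j'] l by (simp add: entry_def)
    from homogeneous_part_mult_right[OF this x] True show ?thesis by auto
  next
    case False
    then have "Y l j' = \<zero>\<^bsub>A\<^esub>" using Ye(1)[of l j'] by (auto simp: entry_def split: if_splits)
    then show ?thesis using x hp(3) ahom_zero[OF R.abelian_group_A R.abelian_group_A hp(4)] by simp
  qed
  also have "\<dots> = (\<Oplus>\<^bsub>A\<^esub>j\<in>{..n}. place n A gA b j (x \<otimes>\<^bsub>A\<^esub> Y l j) b' j')"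
  proof (cases "j' \<le> n")
    case True
    then show ?thesis using Ye(2) x
      by (subst R.A.finsum_single[of _ j']) (auto simp: place_def matrix_unit_def hp(3))
  next
    case False
    then show ?thesis
      by (intro trans[OF _ R.A.finsum_zeroI[symmetric]]) (auto simp: place_def matrix_unit_def)
  qed
  also have "\<dots> = (\<Oplus>\<^bsub>beilinson_green n A gA\<^esub>j\<in>{..n}. place n A gA b j (x \<otimes>\<^bsub>A\<^esub> Y l j)) b' j'"
    using Ye(2) x by (intro beilinson_green_finsum[symmetric] place_closed) auto
  finally show "(place n A gA b l x \<otimes>\<^bsub>beilinson_green n A gA\<^esub> Y) b' j' = \<dots>" .
qed

end


text \<open>On elements of degree \<open>j - i - s\<close> the maps \<open>split_entry i j a (a + s)\<close>, taken over all \<open>a\<close>,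
  pick out the summands according to the degree \<open>a - i\<close> of the left factor.\<close>

locale graded_free =
  fixes K :: "('k, 'x) ring_scheme" and n :: nat
    and A :: "('k, 'a) module" and gA :: "nat \<Rightarrow> 'a set"
    and B :: "('k, 'b) module" and gB :: "nat \<Rightarrow> 'b set"
  assumes gr_alg_A: "graded_algebra K n A gA" and gr_alg_B: "graded_algebra K n B gB"
begin

abbreviation "barA \<equiv> beilinson_green n A gA"
abbreviation "barB \<equiv> beilinson_green n B gB"

lemma alg: "fd_algebra K A" "fd_algebra K B" "fd_algebra K barA" "fd_algebra K barB"
  using gr_alg_A gr_alg_B fd_algebra_beilinson_green by (auto simp: graded_algebra_def)

sublocale A: fd_algebra K A by (rule alg)
sublocale B: fd_algebra K B by (rule alg)
sublocale bA: fd_algebra K barA by (rule alg)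
sublocale bB: fd_algebra K barB by (rule alg)

sublocale F: tensor_biact A K B "as_left (regular A)" "as_right (regular B)"
  by (rule free_bimodule_tensor_biact[OF alg(1,2)])

sublocale F': tensor_biact barA K barB "as_left (regular barA)" "as_right (regular barB)"
  by (rule free_bimodule_tensor_biact[OF alg(3,4)])

lemma F_eq: "free_bimodule K A B = F.T" "free_bimodule K barA barB = F'.T"
  by (simp_all add: free_bimodule_def)

abbreviation "plA \<equiv> place n A gA"
abbreviation "plB \<equiv> place n B gB"

lemma pl_closed: "x \<in> carrier A \<Longrightarrow> plA i j x \<in> carrier barA" "y \<in> carrier B \<Longrightarrow> plB i j y \<in> carrier barB"
  using place_closed[OF gr_alg_A] place_closed[OF gr_alg_B] by auto

text \<open>Elements of \<open>F.T\<close> are cosets without a normal form and the universal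
  property gives existence only; so the map is named by choice and handled through its values on
  pure tensors.\<close>

definition split_entry :: "nat \<Rightarrow> nat \<Rightarrow> nat \<Rightarrow> nat \<Rightarrow>
    ('a \<times> 'b \<Rightarrow>\<^sub>0 int) set \<Rightarrow> ((nat \<Rightarrow> nat \<Rightarrow> 'a) \<times> (nat \<Rightarrow> nat \<Rightarrow> 'b) \<Rightarrow>\<^sub>0 int) set" where
  "split_entry i j a b = (SOME h. h \<in> ahom F.T F'.T \<and>
     (\<forall>x\<in>carrier A. \<forall>y\<in>carrier B. h (F.pt x y) = F'.pt (plA i a x) (plB b j y)))"

lemma split_entry:
  shows split_entry_ahom: "split_entry i j a b \<in> ahom F.T F'.T"
    and split_entry_pure: "x \<in> carrier A \<Longrightarrow> y \<in> carrier B \<Longrightarrow>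
      split_entry i j a b (F.pt x y) = F'.pt (plA i a x) (plB b j y)"
proof -
  have *: "plA i a (x \<oplus>\<^bsub>A\<^esub> x') = plA i a x \<oplus>\<^bsub>barA\<^esub> plA i a x'" if "x \<in> carrier A" "x' \<in> carrier A" for x x'
    using ahom_add[OF place_ahom[OF gr_alg_A]] that .
  have **: "plB b j (x \<oplus>\<^bsub>B\<^esub> x') = plB b j x \<oplus>\<^bsub>barB\<^esub> plB b j x'" if "x \<in> carrier B" "x' \<in> carrier B" for x x'
    using ahom_add[OF place_ahom[OF gr_alg_B]] that .
  have "balanced_map K (as_left (regular A)) (as_right (regular B)) F'.T (\<lambda>x y. F'.pt (plA i a x) (plB b j y))"
    using balanced_mapD[OF F'.balanced_map_pure]
    by (intro balanced_mapI)
      (simp_all add: pl_closed * ** place_smult[OF gr_alg_A] place_smult[OF gr_alg_B])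
  then obtain h where h: "h \<in> ahom F.T F'.T"
    "\<And>x y. x \<in> carrier A \<Longrightarrow> y \<in> carrier B \<Longrightarrow> h (F.pt x y) = F'.pt (plA i a x) (plB b j y)"
    apply (rule F.tensor_universal[OF F'.abelian_group_tensor])
    subgoal premises p for h by (rule p(1)[OF p(2)]) (simp add: p(3))
    done
  have "split_entry i j a b \<in> ahom F.T F'.T \<and>
     (\<forall>x\<in>carrier A. \<forall>y\<in>carrier B. split_entry i j a b (F.pt x y) = F'.pt (plA i a x) (plB b j y))"
    unfolding split_entry_def by (rule someI[of _ h]) (simp add: h)
  then show "split_entry i j a b \<in> ahom F.T F'.T"
    "x \<in> carrier A \<Longrightarrow> y \<in> carrier B \<Longrightarrow> split_entry i j a b (F.pt x y) = F'.pt (plA i a x) (plB b j y)"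
    by auto
qed

lemma split_entry_closed: "t \<in> carrier F.T \<Longrightarrow> split_entry i j a b t \<in> carrier F'.T"
  using ahom_closed[OF split_entry_ahom] .

text \<open>Acting by \<open>Y\<close> spreads row \<open>l\<close> over all rows \<open>i\<close>,
  so a single \<open>split_entry\<close> is not linear in general. The sum over all positions in
  \<open>split_column_bihom\<close> is.\<close>

lemma split_entry_lact:
  assumes Y: "Y \<in> carrier barA" and t: "t \<in> carrier F.T" and l: "l \<le> n"
  shows "lact F'.T Y (split_entry l j a b t) = (\<Oplus>\<^bsub>F'.T\<^esub>i\<in>{..n}. split_entry i j a b (lact F.T (Y i l) t))"
proof (rule F.tensor_hom_eqI[OF F'.abelian_group_tensor _ _ t])
  note Yc = beilinson_green_entry(2)[OF gr_alg_A Y]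
  show "(\<lambda>t. lact F'.T Y (split_entry l j a b t)) \<in> ahom F.T F'.T"
    by (rule ahom_comp[OF split_entry_ahom F'.tensor_lact(1)[OF Y]])
  show "(\<lambda>t. \<Oplus>\<^bsub>F'.T\<^esub>i\<in>{..n}. split_entry i j a b (lact F.T (Y i l) t)) \<in> ahom F.T F'.T"
    by (intro finsum_ahomI F.abelian_group_tensor F'.abelian_group_tensor
        ahom_comp[OF F.tensor_lact(1)[OF Yc] split_entry_ahom])
  fix x y assume x: "x \<in> carrier (as_left (regular A))" and y: "y \<in> carrier (as_right (regular B))"
  have "lact F'.T Y (split_entry l j a b (F.pt x y)) = F'.pt (Y \<otimes>\<^bsub>barA\<^esub> plA l a x) (plB b j y)"
    using x y Y by (simp add: split_entry_pure F'.tensor_lact(2) pl_closed)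
  also have "Y \<otimes>\<^bsub>barA\<^esub> plA l a x = (\<Oplus>\<^bsub>barA\<^esub>i\<in>{..n}. plA i a (Y i l \<otimes>\<^bsub>A\<^esub> x))"
    using place_mult_left[OF gr_alg_A Y _ l] x by simp
  also have "F'.pt \<dots> (plB b j y) = (\<Oplus>\<^bsub>F'.T\<^esub>i\<in>{..n}. F'.pt (plA i a (Y i l \<otimes>\<^bsub>A\<^esub> x)) (plB b j y))"
    using ahom_finsum[OF _ F'.abelian_group_tensor balanced_map_ahom_left[OF F'.balanced_map_pure],
        of "plB b j y" "\<lambda>i. plA i a (Y i l \<otimes>\<^bsub>A\<^esub> x)" "{..n}"] x y Yc F'.M.abelian_group
    by (simp add: pl_closed finsum_as_left finsum_regular)
  also have "\<dots> = (\<Oplus>\<^bsub>F'.T\<^esub>i\<in>{..n}. split_entry i j a b (lact F.T (Y i l) (F.pt x y)))"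
    using x y Yc by (simp add: F.tensor_lact(2) split_entry_pure)
  finally show "lact F'.T Y (split_entry l j a b (F.pt x y)) = \<dots>" .
qed

lemma split_entry_ract:
  assumes Y: "Y \<in> carrier barB" and t: "t \<in> carrier F.T" and l: "l \<le> n"
  shows "ract F'.T (split_entry i l a b t) Y = (\<Oplus>\<^bsub>F'.T\<^esub>j\<in>{..n}. split_entry i j a b (ract F.T t (Y l j)))"
proof (rule F.tensor_hom_eqI[OF F'.abelian_group_tensor _ _ t])
  note Yc = beilinson_green_entry(2)[OF gr_alg_B Y]
  show "(\<lambda>t. ract F'.T (split_entry i l a b t) Y) \<in> ahom F.T F'.T"
    by (rule ahom_comp[OF split_entry_ahom F'.tensor_ract(1)[OF Y]])
  show "(\<lambda>t. \<Oplus>\<^bsub>F'.T\<^esub>j\<in>{..n}. split_entry i j a b (ract F.T t (Y l j))) \<in> ahom F.T F'.T"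
    by (intro finsum_ahomI F.abelian_group_tensor F'.abelian_group_tensor
        ahom_comp[OF F.tensor_ract(1)[OF Yc] split_entry_ahom])
  fix x y assume x: "x \<in> carrier (as_left (regular A))" and y: "y \<in> carrier (as_right (regular B))"
  have "ract F'.T (split_entry i l a b (F.pt x y)) Y = F'.pt (plA i a x) (plB b l y \<otimes>\<^bsub>barB\<^esub> Y)"
    using x y Y by (simp add: split_entry_pure F'.tensor_ract(2) pl_closed)
  also have "plB b l y \<otimes>\<^bsub>barB\<^esub> Y = (\<Oplus>\<^bsub>barB\<^esub>j\<in>{..n}. plB b j (y \<otimes>\<^bsub>B\<^esub> Y l j))"
    using place_mult_right[OF gr_alg_B Y _ l] y by simp
  also have "F'.pt (plA i a x) \<dots> = (\<Oplus>\<^bsub>F'.T\<^esub>j\<in>{..n}. F'.pt (plA i a x) (plB b j (y \<otimes>\<^bsub>B\<^esub> Y l j)))"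
    using ahom_finsum[OF _ F'.abelian_group_tensor balanced_map_ahom_right[OF F'.balanced_map_pure],
        of "plA i a x" "\<lambda>j. plB b j (y \<otimes>\<^bsub>B\<^esub> Y l j)" "{..n}"] x y Yc F'.N.abelian_group
    by (simp add: pl_closed finsum_as_right finsum_regular)
  also have "\<dots> = (\<Oplus>\<^bsub>F'.T\<^esub>j\<in>{..n}. split_entry i j a b (ract F.T (F.pt x y) (Y l j)))"
    using x y Yc by (simp add: F.tensor_ract(2) split_entry_pure)
  finally show "ract F'.T (split_entry i l a b (F.pt x y)) Y = \<dots>" .
qed

end

section \<open>Splitting into and merging from the free bimodule of rank one\<close>

context graded_bimod
begin

interpretation G: graded_free K n A gA B gB
  by (rule graded_free.intro[OF gr_alg_A gr_alg_B])

text \<open>For fixed \<open>a\<close> and \<open>b\<close> this is a component in the projective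
  bimodule generated by the idempotents at \<open>(a, a)\<close> and \<open>(b, b)\<close>: the
  entry at \<open>(i, j)\<close> is spread over position \<open>(i, a)\<close> of the left factor
  and \<open>(b, j)\<close> of the right one.\<close>

lemma split_column_bihom:
  assumes \<phi>: "\<phi> \<in> bihom A B M G.F.T"
  shows "(\<lambda>X. \<Oplus>\<^bsub>G.F'.T\<^esub>i\<in>{..n}. \<Oplus>\<^bsub>G.F'.T\<^esub>j\<in>{..n}. G.split_entry i j a b (\<phi> (X i j)))
    \<in> bihom barA barB barM G.F'.T" (is "?f \<in> _")
proof -
  interpret F': abelian_group G.F'.T by (rule G.F'.abelian_group_tensor)
  interpret F'b: biact barA barB G.F'.T by (rule G.F'.biact_tensor)
  note \<phi>s = bihomD[OF \<phi>]
  show ?thesis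
  proof (intro bihomI finsum_ahomI abelian_group_bar F'.abelian_group_axioms
      ahom_comp[OF ahom_comp[OF bar_eval_ahom \<phi>s(1)] G.split_entry_ahom])
    fix Y X assume Y: "Y \<in> carrier barA" and X: "X \<in> carrier barM"
    have [simp]: "Y i j \<in> carrier A" "X i j \<in> carrier M" for i j
      using X Y by (auto simp: entries_A entries_M beilinson_green_simps)
    have [simp]: "\<phi> (X i j) \<in> carrier G.F.T" "lact G.F.T (Y l i) (\<phi> (X i j)) \<in> carrier G.F.T" for l i j
      using biact.lact_closed[OF G.F.biact_tensor] by (auto simp: \<phi>s)
    have "?f (lact barM Y X) = (\<Oplus>\<^bsub>G.F'.T\<^esub>i\<in>{..n}. \<Oplus>\<^bsub>G.F'.T\<^esub>j\<in>{..n}. \<Oplus>\<^bsub>G.F'.T\<^esub>l\<in>{..n}.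
        G.split_entry i j a b (lact G.F.T (Y i l) (\<phi> (X l j))))"
    proof (intro F'.finsum_congI F'.finsum_closedI)
      fix i j
      have "\<phi> (lact barM Y X i j) = (\<Oplus>\<^bsub>G.F.T\<^esub>l\<in>{..n}. lact G.F.T (Y i l) (\<phi> (X l j)))"
        using ahom_finsum[OF abelian_group_M G.F.abelian_group_tensor \<phi>s(1),
            of "\<lambda>l. lact M (Y i l) (X l j)" "{..n}"]
        by (simp add: M.lact_closed \<phi>s)
      then show "G.split_entry i j a b (\<phi> (lact barM Y X i j)) =
          (\<Oplus>\<^bsub>G.F'.T\<^esub>l\<in>{..n}. G.split_entry i j a b (lact G.F.T (Y i l) (\<phi> (X l j))))"
        using ahom_finsum[OF G.F.abelian_group_tensor F'.abelian_group_axioms G.split_entry_ahom,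
            of "\<lambda>l. lact G.F.T (Y i l) (\<phi> (X l j))" "{..n}"]
        by simp
    qed (simp_all add: G.split_entry_closed)
    \<comment> \<open>The three summations are permuted until the target row \<open>i\<close> is
      innermost, the form in which \<open>split_entry_lact\<close> reassembles the action of
      \<open>Y\<close>.\<close>
    also have "\<dots> = (\<Oplus>\<^bsub>G.F'.T\<^esub>i\<in>{..n}. \<Oplus>\<^bsub>G.F'.T\<^esub>l\<in>{..n}. \<Oplus>\<^bsub>G.F'.T\<^esub>j\<in>{..n}.
        G.split_entry i j a b (lact G.F.T (Y i l) (\<phi> (X l j))))"
      by (intro F'.finsum_congI F'.finsum_swap F'.finsum_closedI) (simp_all add: G.split_entry_closed)
    also have "\<dots> = (\<Oplus>\<^bsub>G.F'.T\<^esub>l\<in>{..n}. \<Oplus>\<^bsub>G.F'.T\<^esub>i\<in>{..n}. \<Oplus>\<^bsub>G.F'.T\<^esub>j\<in>{..n}.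
        G.split_entry i j a b (lact G.F.T (Y i l) (\<phi> (X l j))))"
      by (intro F'.finsum_swap F'.finsum_closedI) (simp_all add: G.split_entry_closed)
    also have "\<dots> = (\<Oplus>\<^bsub>G.F'.T\<^esub>l\<in>{..n}. \<Oplus>\<^bsub>G.F'.T\<^esub>j\<in>{..n}. \<Oplus>\<^bsub>G.F'.T\<^esub>i\<in>{..n}.
        G.split_entry i j a b (lact G.F.T (Y i l) (\<phi> (X l j))))"
      by (intro F'.finsum_congI F'.finsum_swap F'.finsum_closedI) (simp_all add: G.split_entry_closed)
    also have "\<dots> = (\<Oplus>\<^bsub>G.F'.T\<^esub>l\<in>{..n}. \<Oplus>\<^bsub>G.F'.T\<^esub>j\<in>{..n}. lact G.F'.T Y (G.split_entry l j a b (\<phi> (X l j))))"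
      using Y by (intro F'.finsum_congI F'.finsum_closedI)
        (simp_all add: G.split_entry_lact F'b.lact_closed G.split_entry_closed)
    also have "\<dots> = lact G.F'.T Y (?f X)"
      using Y by (simp add: F'b.lact_finsum G.split_entry_closed F'.finsum_closedI)
    finally show "?f (lact barM Y X) = lact G.F'.T Y (?f X)" .
  next
    fix Y X assume X: "X \<in> carrier barM" and Y: "Y \<in> carrier barB"
    have [simp]: "Y i j \<in> carrier B" "X i j \<in> carrier M" for i j
      using X Y by (auto simp: entries_B entries_M beilinson_green_simps)
    have [simp]: "\<phi> (X i j) \<in> carrier G.F.T" "ract G.F.T (\<phi> (X i j)) (Y j l) \<in> carrier G.F.T" for l i j
      using biact.ract_closed[OF G.F.biact_tensor] by (auto simp: \<phi>s)
    have "?f (ract barM X Y) = (\<Oplus>\<^bsub>G.F'.T\<^esub>i\<in>{..n}. \<Oplus>\<^bsub>G.F'.T\<^esub>j\<in>{..n}. \<Oplus>\<^bsub>G.F'.T\<^esub>l\<in>{..n}.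
        G.split_entry i j a b (ract G.F.T (\<phi> (X i l)) (Y l j)))"
    proof (intro F'.finsum_congI F'.finsum_closedI)
      fix i j
      have "\<phi> (ract barM X Y i j) = (\<Oplus>\<^bsub>G.F.T\<^esub>l\<in>{..n}. ract G.F.T (\<phi> (X i l)) (Y l j))"
        using ahom_finsum[OF abelian_group_M G.F.abelian_group_tensor \<phi>s(1),
            of "\<lambda>l. ract M (X i l) (Y l j)" "{..n}"]
        by (simp add: M.ract_closed \<phi>s)
      then show "G.split_entry i j a b (\<phi> (ract barM X Y i j)) =
          (\<Oplus>\<^bsub>G.F'.T\<^esub>l\<in>{..n}. G.split_entry i j a b (ract G.F.T (\<phi> (X i l)) (Y l j)))"
        using ahom_finsum[OF G.F.abelian_group_tensor F'.abelian_group_axioms G.split_entry_ahom,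
            of "\<lambda>l. ract G.F.T (\<phi> (X i l)) (Y l j)" "{..n}"]
        by simp
    qed (simp_all add: G.split_entry_closed)
    also have "\<dots> = (\<Oplus>\<^bsub>G.F'.T\<^esub>i\<in>{..n}. \<Oplus>\<^bsub>G.F'.T\<^esub>l\<in>{..n}. \<Oplus>\<^bsub>G.F'.T\<^esub>j\<in>{..n}.
        G.split_entry i j a b (ract G.F.T (\<phi> (X i l)) (Y l j)))"
      by (intro F'.finsum_congI F'.finsum_swap F'.finsum_closedI) (simp_all add: G.split_entry_closed)
    also have "\<dots> = (\<Oplus>\<^bsub>G.F'.T\<^esub>i\<in>{..n}. \<Oplus>\<^bsub>G.F'.T\<^esub>l\<in>{..n}. ract G.F'.T (G.split_entry i l a b (\<phi> (X i l))) Y)"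
      using Y by (intro F'.finsum_congI F'.finsum_closedI)
        (simp_all add: G.split_entry_ract F'b.ract_closed G.split_entry_closed)
    also have "\<dots> = ract G.F'.T (?f X) Y"
      using Y by (simp add: F'b.ract_finsum G.split_entry_closed F'.finsum_closedI)
    finally show "?f (ract barM X Y) = ract G.F'.T (?f X) Y" .
  qed
qed

text \<open>The counterpart of splitting: column \<open>a\<close> of \<open>Z\<close> and row
  \<open>b\<close> of \<open>W\<close> are tensored entry by entry and sent on by
  \<open>\<psi>\<close>. The hypothesis \<open>\<psi>g\<close> makes the result triangular with
  entries of the right degrees.\<close>

lemma merge_bihom:
  assumes \<psi>: "\<psi> \<in> bihom A B G.F.T M"
    and \<psi>g: "\<And>i j x y. x \<in> entry n A gA i a \<Longrightarrow> y \<in> entry n B gB b j \<Longrightarrow> \<psi> (G.F.pt x y) \<in> entry n M gM i j"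
  obtains h where "h \<in> bihom barA barB G.F'.T barM"
    "\<And>Z W. Z \<in> carrier barA \<Longrightarrow> W \<in> carrier barB \<Longrightarrow> h (G.F'.pt Z W) = (\<lambda>i j. \<psi> (G.F.pt (Z i a) (W b j)))"
proof -
  note \<psi>s = bihomD[OF \<psi>]
  let ?\<beta> = "\<lambda>Z W i j. \<psi> (G.F.pt (Z i a) (W b j))"
  note ptD = balanced_mapD[OF G.F.balanced_map_pure, simplified]
  have [simp]: "Z i j \<in> carrier A" if "Z \<in> carrier barA" for Z i j
    using that by (simp add: entries_A beilinson_green_simps)
  have [simp]: "W i j \<in> carrier B" if "W \<in> carrier barB" for W i j
    using that by (simp add: entries_B beilinson_green_simps)
  have bal: "balanced_map K (as_left (regular barA)) (as_right (regular barB)) barM ?\<beta>"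
  proof (rule balanced_mapI, goal_cases)
    case (1 Z W)
    then show ?case using \<psi>g by (simp add: beilinson_green_simps(1))
  next
    case (2 Z Z' W)
    then show ?case by (simp add: beilinson_green_simps(5) fun_eq_iff ptD \<psi>s)
  next
    case (3 Z W W')
    then show ?case by (simp add: beilinson_green_simps(5) fun_eq_iff ptD \<psi>s)
  next
    case (4 Z c W)
    then show ?case by (simp add: beilinson_green_simps(6) fun_eq_iff ptD)
  qed
  show thesis
  proof (rule G.F'.tensor_bihom[OF biact_bar bal], goal_cases)
    case (1 Y Z W)
    show ?case
    proof (intro ext)
      fix i j
      have "?\<beta> (Y \<otimes>\<^bsub>barA\<^esub> Z) W i j = \<psi> (\<Oplus>\<^bsub>G.F.T\<^esub>l\<in>{..n}. G.F.pt (Y i l \<otimes>\<^bsub>A\<^esub> Z l a) (W b j))"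
        using 1 ahom_finsum[OF G.F.M.abelian_group
            G.F.abelian_group_tensor balanced_map_ahom_left[OF G.F.balanced_map_pure],
            of "W b j" "\<lambda>l. Y i l \<otimes>\<^bsub>A\<^esub> Z l a" "{..n}"]
        by (simp add: finsum_as_left finsum_regular beilinson_green_simps(2))
      also have "\<dots> = (\<Oplus>\<^bsub>M\<^esub>l\<in>{..n}. \<psi> (G.F.pt (Y i l \<otimes>\<^bsub>A\<^esub> Z l a) (W b j)))"
        using 1 by (intro ahom_finsum[OF G.F.abelian_group_tensor abelian_group_M \<psi>s(1)]) (auto simp: ptD)
      also have "\<dots> = (\<Oplus>\<^bsub>M\<^esub>l\<in>{..n}. lact M (Y i l) (\<psi> (G.F.pt (Z l a) (W b j))))"
        using 1 \<psi>s(4)[of "Y i l" "G.F.pt (Z l a) (W b j)" for l]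
        by (intro M.finsum_congI) (auto simp: G.F.tensor_lact ptD M.lact_closed \<psi>s)
      finally show "?\<beta> (lact (as_left (regular barA)) Y Z) W i j = lact barM Y (?\<beta> Z W) i j" by simp
    qed
  next
    case (2 Z W Y)
    show ?case
    proof (intro ext)
      fix i j
      have "?\<beta> Z (W \<otimes>\<^bsub>barB\<^esub> Y) i j = \<psi> (\<Oplus>\<^bsub>G.F.T\<^esub>l\<in>{..n}. G.F.pt (Z i a) (W b l \<otimes>\<^bsub>B\<^esub> Y l j))"
        using 2 ahom_finsum[OF G.F.N.abelian_group
            G.F.abelian_group_tensor balanced_map_ahom_right[OF G.F.balanced_map_pure],
            of "Z i a" "\<lambda>l. W b l \<otimes>\<^bsub>B\<^esub> Y l j" "{..n}"]
        by (simp add: finsum_as_right finsum_regular beilinson_green_simps(2))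
      also have "\<dots> = (\<Oplus>\<^bsub>M\<^esub>l\<in>{..n}. \<psi> (G.F.pt (Z i a) (W b l \<otimes>\<^bsub>B\<^esub> Y l j)))"
        using 2 by (intro ahom_finsum[OF G.F.abelian_group_tensor abelian_group_M \<psi>s(1)]) (auto simp: ptD)
      also have "\<dots> = (\<Oplus>\<^bsub>M\<^esub>l\<in>{..n}. ract M (\<psi> (G.F.pt (Z i a) (W b l))) (Y l j))"
        using 2 \<psi>s(5)[of "G.F.pt (Z i a) (W b l)" "Y l j" for l]
        by (intro M.finsum_congI) (auto simp: G.F.tensor_ract ptD M.ract_closed \<psi>s)
      finally show "?\<beta> Z (ract (as_right (regular barB)) W Y) i j = ract barM (?\<beta> Z W) Y i j" by simp
    qed
  next
    case (3 h)
    then show ?case by (intro that[of h]) auto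
  qed
qed

end


context graded_bimod
begin

text \<open>In the shift by \<open>s k\<close> the entry at \<open>(i, j)\<close> consists of
  tensors of degrees \<open>a - i\<close> and \<open>j - (a + s k)\<close> for varying
  \<open>a\<close>, whence one summand for each generator \<open>k\<close> and each
  \<open>a\<close>. Merging after splitting selects these tensors for one \<open>a\<close>; summing
  over \<open>a\<close> and the generators restores the matrix.\<close>

lemma projective_bimodule_bar:
  assumes "graded_summand_of_copies A B (free_bimodule K A B)
    (tensor_grade K (as_left (regular A)) gA (as_right (regular B)) gB) M gM"
  shows "projective_bimodule K barA barB barM"
proof -
  interpret G: graded_free K n A gA B gB
    by (rule graded_free.intro[OF gr_alg_A gr_alg_B])
  interpret F: abelian_group G.F.T by (rule G.F.abelian_group_tensor)
  interpret F': abelian_group G.F'.T by (rule G.F'.abelian_group_tensor)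
  let ?gF = "tensor_grade K (as_left (regular A)) gA (as_right (regular B)) gB"
  note ptD = balanced_mapD[OF G.F.balanced_map_pure, simplified]
  have z: "\<zero>\<^bsub>G.F.T\<^esub> \<in> ?gF d" for d
    using generate.one[of "add_monoid G.F.T"] by (simp add: tensor_grade_def)
  obtain m :: nat and s \<phi> \<psi> where
    \<phi>: "\<And>k. k < m \<Longrightarrow> \<phi> k \<in> bihom A B M G.F.T" and
    \<psi>: "\<And>k. k < m \<Longrightarrow> \<psi> k \<in> bihom A B G.F.T M" and
    \<phi>g: "\<And>k d x. k < m \<Longrightarrow> x \<in> gM d \<Longrightarrow> \<phi> k x \<in> (if s k \<le> d then ?gF (d - s k) else {\<zero>\<^bsub>G.F.T\<^esub>})" and
    \<psi>g: "\<And>k d y. k < m \<Longrightarrow> y \<in> ?gF d \<Longrightarrow> \<psi> k y \<in> gM (d + s k)" and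
    eq: "\<And>x. x \<in> carrier M \<Longrightarrow> (\<Oplus>\<^bsub>M\<^esub>k\<in>{..<m}. \<psi> k (\<phi> k x)) = x"
    apply (rule graded_summand_of_copiesE[OF assms[unfolded G.F_eq] abelian_group_M G.F.biact_tensor z])
    subgoal premises p for m s \<phi> \<psi> by (rule p(1)[OF p(2-)])
    done
  have ptg: "G.F.pt x y \<in> ?gF d" if "x \<in> gA c" "y \<in> gB e" "c + e = d" for x y c e d
    unfolding tensor_grade_def using that by (intro generate.incl) blast
  have \<psi>0: "\<psi> k \<zero>\<^bsub>G.F.T\<^esub> = \<zero>\<^bsub>M\<^esub>" if "k < m" for k
    using ahom_zero[OF F.abelian_group_axioms abelian_group_M bihom_ahom[OF \<psi>[OF that]]] .
  have pt0: "x \<in> carrier A \<Longrightarrow> G.F.pt x \<zero>\<^bsub>B\<^esub> = \<zero>\<^bsub>G.F.T\<^esub>" "y \<in> carrier B \<Longrightarrow> G.F.pt \<zero>\<^bsub>A\<^esub> y = \<zero>\<^bsub>G.F.T\<^esub>" for x y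
    using ahom_zero[OF _ F.abelian_group_axioms balanced_map_ahom_right[OF G.F.balanced_map_pure], of x]
      ahom_zero[OF _ F.abelian_group_axioms balanced_map_ahom_left[OF G.F.balanced_map_pure], of y]
      G.F.M.abelian_group G.F.N.abelian_group
    by simp_all
  define \<Phi> where "\<Phi> p X = (\<Oplus>\<^bsub>G.F'.T\<^esub>i\<in>{..n}. \<Oplus>\<^bsub>G.F'.T\<^esub>j\<in>{..n}.
      G.split_entry i j (snd p) (snd p + s (fst p)) (\<phi> (fst p) (X i j)))" for p X
  define I where "I = {..<m} \<times> {..n}"
  have \<Phi>: "\<Phi> p \<in> bihom barA barB barM G.F'.T" if "p \<in> I" for p
    using split_column_bihom[OF \<phi>, of "fst p" "snd p" "snd p + s (fst p)"] that
    by (auto simp: \<Phi>_def[abs_def] I_def)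
  have "\<exists>h. h \<in> bihom barA barB G.F'.T barM \<and> (\<forall>Z\<in>carrier barA. \<forall>W\<in>carrier barB.
      h (G.F'.pt Z W) = (\<lambda>i j. \<psi> (fst p) (G.F.pt (Z i (snd p)) (W (snd p + s (fst p)) j))))" if "p \<in> I" for p
  proof -
    from that obtain k a where p: "p = (k, a)" "k < m" "a \<le> n" by (auto simp: I_def)
    have "\<psi> k (G.F.pt x y) \<in> entry n M gM i j"
      if xy: "x \<in> entry n A gA i a" "y \<in> entry n B gB (a + s k) j" for i j x y
    proof (cases "i \<le> a \<and> a + s k \<le> j \<and> j \<le> n")
      case True
      then have "G.F.pt x y \<in> ?gF (a - i + (j - (a + s k)))"
        using xy p by (intro ptg) (auto simp: entry_def)
      then have "\<psi> k (G.F.pt x y) \<in> gM (a - i + (j - (a + s k)) + s k)" by (rule \<psi>g[OF p(2)])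
      moreover have "a - i + (j - (a + s k)) + s k = j - i" "i \<le> j" using True by auto
      ultimately show ?thesis using True by (simp only: entry_def if_True simp_thms)
    next
      case False
      then have "x = \<zero>\<^bsub>A\<^esub> \<or> y = \<zero>\<^bsub>B\<^esub>" using xy by (auto simp: entry_def split: if_splits)
      then show ?thesis
        using xy entry_A entry_B entry_zero by (auto simp: pt0 \<psi>0 p)
    qed
    then obtain h where "h \<in> bihom barA barB G.F'.T barM"
      "\<And>Z W. Z \<in> carrier barA \<Longrightarrow> W \<in> carrier barB \<Longrightarrow>
        h (G.F'.pt Z W) = (\<lambda>i j. \<psi> k (G.F.pt (Z i a) (W (a + s k) j)))"
      using merge_bihom[OF \<psi>[OF p(2)], of a "a + s k"] by metis
    then show ?thesis by (auto simp: p)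
  qed
  then obtain \<Psi> where \<Psi>: "\<And>p. p \<in> I \<Longrightarrow> \<Psi> p \<in> bihom barA barB G.F'.T barM"
    and \<Psi>p: "\<And>p Z W. p \<in> I \<Longrightarrow> Z \<in> carrier barA \<Longrightarrow> W \<in> carrier barB \<Longrightarrow>
      \<Psi> p (G.F'.pt Z W) = (\<lambda>i j. \<psi> (fst p) (G.F.pt (Z i (snd p)) (W (snd p + s (fst p)) j)))"
    by metis
  have \<Psi>e: "(\<lambda>u. \<Psi> p u i j) \<in> ahom G.F'.T M" if "p \<in> I" for p i j
    by (rule ahom_comp[OF bihom_ahom[OF \<Psi>[OF that]] bar_eval_ahom])
  have \<Psi>s: "(\<lambda>t. \<Psi> p (G.split_entry i' j' a b t) i j) \<in> ahom G.F.T M" if "p \<in> I" for p i j i' j' a b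
    by (rule ahom_comp[OF G.split_entry_ahom \<Psi>e[OF that]])
  have \<Psi>s_pure: "\<Psi> (k, a) (G.split_entry i' j' a (a + s k) (G.F.pt x y)) i j =
      \<psi> k (G.F.pt (place n A gA i' a x i a) (place n B gB (a + s k) j' y (a + s k) j))"
    if "(k, a) \<in> I" "x \<in> carrier A" "y \<in> carrier B" for k a i j i' j' x y
    using that \<Psi>p[OF that(1)] by (simp add: G.split_entry_pure G.pl_closed)
  \<comment> \<open>Merging reads the entries \<open>(i, a)\<close> and \<open>(a + s k, j)\<close>,
    whereas splitting has filled only \<open>(i', a)\<close> and
    \<open>(a + s k, j')\<close>.\<close>
  have off: "\<Psi> (k, a) (G.split_entry i' j' a (a + s k) t) i j = \<zero>\<^bsub>M\<^esub>"
    if p: "(k, a) \<in> I" and ij: "(i', j') \<noteq> (i, j)" and t: "t \<in> carrier G.F.T" for k a i j i' j' t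
  proof (rule G.F.tensor_hom_eqI[OF abelian_group_M \<Psi>s[OF p] _ t])
    show "(\<lambda>_. \<zero>\<^bsub>M\<^esub>) \<in> ahom G.F.T M" by (rule ahomI) auto
    fix x y assume xy: "x \<in> carrier (as_left (regular A))" "y \<in> carrier (as_right (regular B))"
    have "place n A gA i' a x i a \<in> carrier A" "place n B gB (a + s k) j' y (a + s k) j \<in> carrier B"
      using G.pl_closed xy beilinson_green_entry(2)[OF gr_alg_A] beilinson_green_entry(2)[OF gr_alg_B] by simp_all
    moreover have "place n A gA i' a x i a = \<zero>\<^bsub>A\<^esub> \<or> place n B gB (a + s k) j' y (a + s k) j = \<zero>\<^bsub>B\<^esub>"
      using ij by (auto simp: place_def matrix_unit_def)
    ultimately show "\<Psi> (k, a) (G.split_entry i' j' a (a + s k) (G.F.pt x y)) i j = \<zero>\<^bsub>M\<^esub>"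
      using xy p by (auto simp: \<Psi>s_pure pt0 \<psi>0 I_def)
  qed
  \<comment> \<open>On a pure tensor of degrees \<open>c\<close> and \<open>d\<close> the projection
    in \<open>place\<close> leaves only \<open>a = i + c\<close>. The degree of \<open>t\<close>
    matters here: it makes \<open>j - (i + c + s k)\<close> equal to \<open>d\<close>, so that the
    right factor survives too.\<close>
  have diag: "(\<Oplus>\<^bsub>M\<^esub>a\<in>{..n}. \<Psi> (k, a) (G.split_entry i j a (a + s k) t) i j) = \<psi> k t"
    if k: "k < m" and ij: "i \<le> j" "j \<le> n" "s k \<le> j - i" and t: "t \<in> ?gF (j - i - s k)" for k i j t
  proof (rule ahom_eq_on_generate[OF F.abelian_group_axioms abelian_group_M _ bihom_ahom[OF \<psi>[OF k]] _ _
        t[unfolded tensor_grade_def]])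
    show "(\<lambda>t. \<Oplus>\<^bsub>M\<^esub>a\<in>{..n}. \<Psi> (k, a) (G.split_entry i j a (a + s k) t) i j) \<in> ahom G.F.T M"
      using k by (intro finsum_ahomI F.abelian_group_axioms abelian_group_M \<Psi>s) (simp add: I_def)
    show "{G.F.pt x y |x y i' j'. x \<in> gA i' \<and> y \<in> gB j' \<and> i' + j' = j - i - s k} \<subseteq> carrier G.F.T"
      using gA gB by (auto intro!: G.F.pure_closed)
    fix u assume "u \<in> {G.F.pt x y |x y i' j'. x \<in> gA i' \<and> y \<in> gB j' \<and> i' + j' = j - i - s k}"
    then obtain x y c d where u: "u = G.F.pt x y" "x \<in> gA c" "y \<in> gB d" "c + d = j - i - s k" by blast
    have xy: "x \<in> carrier A" "y \<in> carrier B" using u gA gB by blast+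
    \<comment> \<open>The surviving index \<open>a = i + c\<close> lies within the range of
      summation.\<close>
    have cn: "i + c \<le> n" using u ij by linarith
    have px: "place n A gA i a x i a = (if a = i + c then x else \<zero>\<^bsub>A\<^esub>)" if "a \<le> n" for a
      using that homogeneous_part_homogeneous[OF module_A grading_A deg_A u(2), of "a - i"]
      by (auto simp: place_def matrix_unit_def)
    have py: "place n B gB (i + c + s k) j y (i + c + s k) j = y"
    proof -
      have "i + c + s k \<le> j" "j - (i + c + s k) = d" using u ij by linarith+
      then show ?thesis
        using ij homogeneous_part_homogeneous[OF module_B grading_B deg_B u(3), of d]
        by (simp add: place_def matrix_unit_def)
    qed
    have pyc: "place n B gB b j y b j \<in> carrier B" for b
      using G.pl_closed(2)[OF xy(2)] beilinson_green_entry(2)[OF gr_alg_B] by blast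
    have "(\<Oplus>\<^bsub>M\<^esub>a\<in>{..n}. \<Psi> (k, a) (G.split_entry i j a (a + s k) u) i j) =
        \<Psi> (k, i + c) (G.split_entry i j (i + c) (i + c + s k) u) i j"
      using cn k xy pyc ptD(1) bihom_closed[OF \<psi>[OF k]]
      by (intro M.finsum_single) (auto simp: u(1) \<Psi>s_pure I_def px pt0 \<psi>0)
    also have "\<dots> = \<psi> k u"
      using cn k xy by (simp add: u(1) \<Psi>s_pure I_def px py)
    finally show "(\<Oplus>\<^bsub>M\<^esub>a\<in>{..n}. \<Psi> (k, a) (G.split_entry i j a (a + s k) u) i j) = \<psi> k u" .
  qed
  have sum: "(\<Oplus>\<^bsub>barM\<^esub>p\<in>I. \<Psi> p (\<Phi> p X)) = X" if X: "X \<in> carrier barM" for X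
  proof (intro ext)
    fix i j
    have Xe: "X i j \<in> entry n M gM i j" and Xc: "X i j \<in> carrier M" for i j
      using X by (simp_all add: entries_M)
    have \<phi>c: "\<phi> k (X i j) \<in> carrier G.F.T" if "k < m" for k i j
      using bihom_closed[OF \<phi>[OF that] Xc] .
    have c: "\<Psi> p (\<Phi> p X) \<in> carrier barM" if "p \<in> I" for p
      using bihom_closed[OF \<Psi>[OF that] bihom_closed[OF \<Phi>[OF that] X]] .
    have \<Psi>c: "\<Psi> (k, a) (G.split_entry i' j' a (a + s k) (\<phi> k (X i' j'))) i j \<in> carrier M"
      if "(k, a) \<in> I" for k a i j i' j'
      using that by (intro ahom_closed[OF \<Psi>s] \<phi>c) (auto simp: I_def)
    show "(\<Oplus>\<^bsub>barM\<^esub>p\<in>I. \<Psi> p (\<Phi> p X)) i j = X i j"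
    proof (cases "i \<le> j \<and> j \<le> n")
      case False
      have "(\<Oplus>\<^bsub>barM\<^esub>p\<in>I. \<Psi> p (\<Phi> p X)) \<in> carrier barM"
        using c by (intro abelian_monoid.finsum_closedI abelian_group.axioms(1)[OF abelian_group_bar])
      then have "(\<Oplus>\<^bsub>barM\<^esub>p\<in>I. \<Psi> p (\<Phi> p X)) i j \<in> entry n M gM i j" by simp
      with False Xe[of i j] show ?thesis by (auto simp: entry_def split: if_splits)
    next
      case True
      \<comment> \<open>Of the double sum in \<open>\<Phi>\<close>, only the term at position
        \<open>(i, j)\<close> reaches the entry \<open>(i, j)\<close>, by
        \<open>off\<close>.\<close>
      have "\<Psi> (k, a) (\<Phi> (k, a) X) i j = \<Psi> (k, a) (G.split_entry i j a (a + s k) (\<phi> k (X i j))) i j"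
        if p: "(k, a) \<in> I" for k a
      proof -
        have k: "k < m" using p by (simp add: I_def)
        note sc = G.split_entry_closed[OF \<phi>c[OF k]]
        have "\<Psi> (k, a) (\<Phi> (k, a) X) i j = (\<Oplus>\<^bsub>M\<^esub>i'\<in>{..n}. \<Psi> (k, a) (\<Oplus>\<^bsub>G.F'.T\<^esub>j'\<in>{..n}.
            G.split_entry i' j' a (a + s k) (\<phi> k (X i' j'))) i j)"
          unfolding \<Phi>_def fst_conv snd_conv
          by (rule ahom_finsum[OF F'.abelian_group_axioms abelian_group_M \<Psi>e[OF p]])
            (auto intro!: F'.finsum_closedI sc)
        also have "\<dots> = (\<Oplus>\<^bsub>M\<^esub>i'\<in>{..n}. \<Oplus>\<^bsub>M\<^esub>j'\<in>{..n}.
            \<Psi> (k, a) (G.split_entry i' j' a (a + s k) (\<phi> k (X i' j'))) i j)"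
          using \<Psi>c[OF p] sc
          by (intro M.finsum_congI M.finsum_closedI
              ahom_finsum[OF F'.abelian_group_axioms abelian_group_M \<Psi>e[OF p]]) auto
        also have "\<dots> = (\<Oplus>\<^bsub>M\<^esub>j'\<in>{..n}. \<Psi> (k, a) (G.split_entry i j' a (a + s k) (\<phi> k (X i j'))) i j)"
          using True \<Psi>c[OF p] off[OF p _ \<phi>c[OF k]]
          by (intro M.finsum_single) (auto intro!: M.finsum_closedI M.finsum_zeroI)
        also have "\<dots> = \<Psi> (k, a) (G.split_entry i j a (a + s k) (\<phi> k (X i j))) i j"
          using True \<Psi>c[OF p] off[OF p _ \<phi>c[OF k]]
          by (intro M.finsum_single) auto
        finally show ?thesis .
      qed
      then have "(\<Oplus>\<^bsub>M\<^esub>p\<in>I. \<Psi> p (\<Phi> p X) i j) =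
          finsum M (\<lambda>(k, a). \<Psi> (k, a) (G.split_entry i j a (a + s k) (\<phi> k (X i j))) i j) I"
        using \<Psi>c by (intro M.finsum_congI) auto
      also have "\<dots> = (\<Oplus>\<^bsub>M\<^esub>k\<in>{..<m}. \<Oplus>\<^bsub>M\<^esub>a\<in>{..n}. \<Psi> (k, a) (G.split_entry i j a (a + s k) (\<phi> k (X i j))) i j)"
        unfolding I_def using \<Psi>c by (intro M.finsum_Times) (auto simp: I_def)
      also have "\<dots> = (\<Oplus>\<^bsub>M\<^esub>k\<in>{..<m}. \<psi> k (\<phi> k (X i j)))"
      proof (rule M.finsum_congI)
        fix k assume "k \<in> {..<m}"
        then have k: "k < m" by simp
        show "\<psi> k (\<phi> k (X i j)) \<in> carrier M" using bihom_closed[OF \<psi>[OF k] \<phi>c[OF k]] .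
        have "X i j \<in> gM (j - i)" using Xe[of i j] True by (simp add: entry_def)
        note \<phi>X = \<phi>g[OF k this]
        show "(\<Oplus>\<^bsub>M\<^esub>a\<in>{..n}. \<Psi> (k, a) (G.split_entry i j a (a + s k) (\<phi> k (X i j))) i j) = \<psi> k (\<phi> k (X i j))"
        proof (cases "s k \<le> j - i")
          case True
          with \<open>i \<le> j \<and> j \<le> n\<close> \<phi>X k show ?thesis by (intro diag) simp_all
        next
          case False
          \<comment> \<open>The entry has degree below the shift, so \<open>\<phi> k\<close>
            annihilates it and both sides vanish.\<close>
          then have "\<phi> k (X i j) = \<zero>\<^bsub>G.F.T\<^esub>" using \<phi>X by simp
          then show ?thesis
            using ahom_zero[OF F.abelian_group_axioms abelian_group_M \<Psi>s] k
            by (auto simp: \<psi>0 I_def intro!: M.finsum_zeroI)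
        qed
      qed
      also have "\<dots> = X i j" by (rule eq[OF Xc])
      finally show ?thesis by (subst bar_finsum[OF c]) auto
    qed
  qed
  show ?thesis
    unfolding projective_bimodule_def G.F_eq
  proof (intro conjI bimodule_bar summand_of_copiesI[OF biact_bar G.F'.biact_tensor _ \<Phi> \<Psi> sum])
    show "finite I" by (simp add: I_def)
  qed
qed

end


section \<open>Direct sums and transport of structure\<close>

text \<open>Separates the Beilinson-Green algebra from the triangular matrices over the projective
  summand.\<close>

lemma bar_dsum_biiso:
  assumes "graded_bimod K n A gA B gB X gX" "graded_bimod K n A gA B gB Y gY"
  shows "(\<lambda>Z. (\<lambda>i j. fst (Z i j), \<lambda>i j. snd (Z i j))) \<in>
    biiso (beilinson_green n A gA) (beilinson_green n B gB)
      (bg_bimodule n (dsum X Y) (dsum_grade gX gY)) (dsum (bg_bimodule n X gX) (bg_bimodule n Y gY))"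
    (is "?f \<in> biiso ?A ?B ?D ?E")
proof -
  interpret X: graded_bimod K n A gA B gB X gX by fact
  interpret Y: graded_bimod K n A gA B gB Y gY by fact
  have ab: "abelian_group (dsum X Y)"
    using bimodule_dsum[OF X.bimodule_M Y.bimodule_M] by (simp add: bimodule_def module_def)
  have fst: "fst \<in> ahom (dsum X Y) X" by (rule ahomI) auto
  have snd: "snd \<in> ahom (dsum X Y) Y" by (rule ahomI) auto
  have sums: "fst (finsum (dsum X Y) g I) = (\<Oplus>\<^bsub>X\<^esub>i\<in>I. fst (g i))"
    "snd (finsum (dsum X Y) g I) = (\<Oplus>\<^bsub>Y\<^esub>i\<in>I. snd (g i))"
    if "\<And>i. i \<in> I \<Longrightarrow> g i \<in> carrier X \<times> carrier Y" for g and I :: "nat set"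
    using that by (auto intro!: ahom_finsum[OF ab X.abelian_group_M fst] ahom_finsum[OF ab Y.abelian_group_M snd])
  have entry: "entry n (dsum X Y) (dsum_grade gX gY) i j = entry n X gX i j \<times> entry n Y gY i j" for i j
    by (auto simp: entry_def dsum_grade_def)
  have c: "fst (Z i j) \<in> carrier X" "snd (Z i j) \<in> carrier Y" if "Z \<in> carrier ?D" for Z i j
    using that X.entries_M[of "\<lambda>i j. fst (Z i j)"] Y.entries_M[of "\<lambda>i j. snd (Z i j)"]
    by (auto simp: entry mem_Times_iff)
  have bihom: "?f \<in> bihom ?A ?B ?D ?E"
  proof (intro bihomI ahomI)
    fix a Z assume "a \<in> carrier ?A" "Z \<in> carrier ?D"
    with c[OF this(2)] show "?f (lact ?D a Z) = lact ?E a (?f Z)"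
      by (simp add: sums X.M.lact_closed Y.M.lact_closed X.entries_A beilinson_green_simps)
  next
    fix Z b assume "Z \<in> carrier ?D" "b \<in> carrier ?B"
    with c[OF this(1)] show "?f (ract ?D Z b) = ract ?E (?f Z) b"
      by (simp add: sums X.M.ract_closed Y.M.ract_closed X.entries_B beilinson_green_simps)
  qed (auto simp: entry mem_Times_iff)
  have "bij_betw ?f (carrier ?D) (carrier ?E)"
    by (rule bij_betwI[where g = "\<lambda>(U, V) i j. (U i j, V i j)"]) (auto simp: entry mem_Times_iff)
  with bihom show ?thesis by (rule biisoI)
qed

lemma submodule_dsum_grade:
  assumes "module K X" "module K Y" "module K (dsum X Y)" "submodule H K X" "submodule H' K Y"
  shows "submodule (H \<times> H') K (dsum X Y)"
proof -
  interpret X: module K X by fact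
  interpret Y: module K Y by fact
  interpret D: module K "dsum X Y" by fact
  note X = X.submoduleE[OF assms(4)] and Y = Y.submoduleE[OF assms(5)]
  have z: "\<zero>\<^bsub>X\<^esub> \<in> H" "\<zero>\<^bsub>Y\<^esub> \<in> H'"
    using subgroup.one_closed[OF submodule.axioms(1)[OF assms(4)]]
      subgroup.one_closed[OF submodule.axioms(1)[OF assms(5)]] by auto
  show ?thesis
  proof (rule D.submoduleI)
    fix p assume p: "p \<in> H \<times> H'"
    have "\<ominus>\<^bsub>dsum X Y\<^esub> p = (\<ominus>\<^bsub>X\<^esub> fst p, \<ominus>\<^bsub>Y\<^esub> snd p)"
      using p X(1) Y(1) by (intro D.M.minus_equality) (auto simp: X.M.l_neg Y.M.l_neg)
    then show "\<ominus>\<^bsub>dsum X Y\<^esub> p \<in> H \<times> H'" using p X(3) Y(3) by auto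
  qed (use X Y z in auto)
qed

lemma graded_bimod_dsum:
  assumes "graded_bimod K n A gA B gB X gX" "graded_bimod K n A gA B gB Y gY"
  shows "graded_bimod K n A gA B gB (dsum X Y) (dsum_grade gX gY)"
proof -
  interpret X: graded_bimod K n A gA B gB X gX by fact
  interpret Y: graded_bimod K n A gA B gB Y gY by fact
  have "bimodule K A B (dsum X Y)" by (rule bimodule_dsum[OF X.bimodule_M Y.bimodule_M])
  moreover from this have "module K (dsum X Y)" by (simp add: bimodule_def)
  then have "submodule (dsum_grade gX gY d) K (dsum X Y)" for d
    unfolding dsum_grade_def
    by (intro submodule_dsum_grade X.module_M Y.module_M X.submodule_M Y.submodule_M)
  ultimately show ?thesis
    using X.gr_alg_A X.gr_alg_B X.gM_lact Y.gM_lact X.gM_ract Y.gM_ract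
    by (auto simp: graded_bimod_def dsum_grade_def)
qed

lemma dsum_biiso:
  assumes "h \<in> biiso A B Y Z"
  shows "map_prod id h \<in> biiso A B (dsum X Y) (dsum X Z)"
proof (rule biisoI)
  from assms have h: "h \<in> bihom A B Y Z" and b: "bij_betw h (carrier Y) (carrier Z)"
    by (auto simp: biiso_def)
  show "map_prod id h \<in> bihom A B (dsum X Y) (dsum X Z)"
    by (intro bihomI ahomI) (auto simp: bihomD[OF h])
  show "bij_betw (map_prod id h) (carrier (dsum X Y)) (carrier (dsum X Z))"
    using bij_betw_map_prod[OF bij_betw_id b] by simp
qed

text \<open>Structure copied along an injection of the carrier, which becomes an isomorphism by
  construction. It replaces bimodules of matrices by copies over
  \<open>nat \<Rightarrow> 'k\<close>, the type prescribed for bimodules that are asserted to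
  exist.\<close>

definition transport ::
  "('m \<Rightarrow> 'n) \<Rightarrow> ('k, 'a, 'b, 'm) bimodule \<Rightarrow> ('k, 'a, 'b, 'n) bimodule" where
  "transport h X = (let h' = inv_into (carrier X) h in
     \<lparr>carrier = h ` carrier X, monoid.mult = undefined, one = undefined,
      ring.zero = h \<zero>\<^bsub>X\<^esub>, add = (\<lambda>u v. h (h' u \<oplus>\<^bsub>X\<^esub> h' v)),
      smult = (\<lambda>c u. h (c \<odot>\<^bsub>X\<^esub> h' u)),
      lact = (\<lambda>a u. h (lact X a (h' u))), ract = (\<lambda>u b. h (ract X (h' u) b))\<rparr>)"

context
  fixes K :: "('k, 'x) ring_scheme" and A :: "('k, 'a) module" and B :: "('k, 'b) module"
    and X :: "('k, 'a, 'b, 'm) bimodule" and h :: "'m \<Rightarrow> 'n"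
  assumes X: "bimodule K A B X" and inj: "inj_on h (carrier X)"
begin

interpretation X: bimodule K A B X by (rule X)

lemma transport_simps:
  "carrier (transport h X) = h ` carrier X" "\<zero>\<^bsub>transport h X\<^esub> = h \<zero>\<^bsub>X\<^esub>"
  "x \<in> carrier X \<Longrightarrow> y \<in> carrier X \<Longrightarrow> h x \<oplus>\<^bsub>transport h X\<^esub> h y = h (x \<oplus>\<^bsub>X\<^esub> y)"
  "x \<in> carrier X \<Longrightarrow> c \<odot>\<^bsub>transport h X\<^esub> h x = h (c \<odot>\<^bsub>X\<^esub> x)"
  "x \<in> carrier X \<Longrightarrow> lact (transport h X) a (h x) = h (lact X a x)"
  "x \<in> carrier X \<Longrightarrow> ract (transport h X) (h x) b = h (ract X x b)"
  using inj by (simp_all add: transport_def Let_def inv_into_f_f)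

lemma bimodule_transport: "bimodule K A B (transport h X)"
proof -
  have ab: "abelian_group (transport h X)"
  proof (rule abelian_groupI)
    fix u assume "u \<in> carrier (transport h X)"
    then obtain x where x: "x \<in> carrier X" "u = h x" by (auto simp: transport_simps)
    then show "\<exists>v\<in>carrier (transport h X). v \<oplus>\<^bsub>transport h X\<^esub> u = \<zero>\<^bsub>transport h X\<^esub>"
      by (intro bexI[of _ "h (\<ominus>\<^bsub>X\<^esub> x)"]) (auto simp: transport_simps X.M.l_neg)
  qed (auto simp: transport_simps X.M.a_ac)
  show ?thesis
    by (intro bimodule.intro moduleI bimodule_axioms.intro)
      (use ab X.R.is_cring in \<open>auto simp: transport_simps X.smult_l_distr X.smult_r_distr X.smult_assoc1
        X.lact_closed X.ract_closed X.lact_one X.ract_one X.lact_add_left X.lact_add_right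
        X.ract_add_left X.ract_add_right X.lact_mult X.ract_mult X.lact_ract X.lact_smult X.ract_smult\<close>)
qed

lemma bij_transport: "bij_betw h (carrier X) (carrier (transport h X))"
  using inj by (simp add: bij_betw_def transport_simps)

lemma transport_biiso: "h \<in> biiso A B X (transport h X)"
  by (intro biisoI bihomI ahomI bij_transport) (auto simp: transport_simps)

lemma transport_biiso_left: "h \<in> biiso A K (as_left X) (as_left (transport h X))"
  using bij_transport by (intro biisoI bihomI ahomI) (auto simp: transport_simps)

lemma transport_biiso_right: "h \<in> biiso K B (as_right X) (as_right (transport h X))"
  using bij_transport by (intro biisoI bihomI ahomI) (auto simp: transport_simps)

lemma left_projective_transport: "left_projective K A X \<Longrightarrow> left_projective K A (transport h X)"
  unfolding left_projective_def
  by (rule summand_of_copies_biiso[OF biact_as_left[OF X] transport_biiso_left])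

lemma right_projective_transport: "right_projective K B X \<Longrightarrow> right_projective K B (transport h X)"
  unfolding right_projective_def
  by (rule summand_of_copies_biiso[OF biact_as_right[OF X] transport_biiso_right])

lemma projective_bimodule_transport:
  "projective_bimodule K A B X \<Longrightarrow> projective_bimodule K A B (transport h X)"
  unfolding projective_bimodule_def
  using summand_of_copies_biiso[OF bimodule_biact[OF X] transport_biiso] bimodule_transport by blast

end


section \<open>Coordinates\<close>

text \<open>Coefficients with respect to a finite spanning set determine the vector, however they
  are chosen. The choice need not be linear, since \<open>transport\<close> asks for an injection
  and brings its own structure.\<close>

lemma fin_dim_inj:
  fixes K :: "('k, 'x) ring_scheme" and V :: "('k, 'v, 'z) module_scheme"
  assumes "module K V" "fin_dim K V"
  shows "\<exists>e :: 'v \<Rightarrow> nat \<Rightarrow> 'k. inj_on e (carrier V)"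
proof -
  interpret V: module K V by fact
  obtain S where S: "finite S" "S \<subseteq> carrier V"
    and span: "\<And>v. v \<in> carrier V \<Longrightarrow> \<exists>c\<in>S \<rightarrow> carrier K. v = (\<Oplus>\<^bsub>V\<^esub>s\<in>S. c s \<odot>\<^bsub>V\<^esub> s)"
    using assms unfolding fin_dim_def by blast
  then obtain c where cK: "\<And>v. v \<in> carrier V \<Longrightarrow> c v \<in> S \<rightarrow> carrier K"
    and c: "\<And>v. v \<in> carrier V \<Longrightarrow> v = (\<Oplus>\<^bsub>V\<^esub>s\<in>S. c v s \<odot>\<^bsub>V\<^esub> s)" by metis
  obtain num :: "'v \<Rightarrow> nat" where num: "inj_on num S"
    using finite_imp_inj_to_nat_seg[OF S(1)] by blast
  \<comment> \<open>Outside the numbering of \<open>S\<close> the value is arbitrary; injectivity is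
    tested at the indices \<open>num s\<close>.\<close>
  define e where "e v = (\<lambda>i. c v (inv_into S num i))" for v
  have "inj_on e (carrier V)"
  proof (rule inj_onI)
    fix v w assume v: "v \<in> carrier V" "w \<in> carrier V" "e v = e w"
    have "c v s = c w s" if "s \<in> S" for s
      using fun_cong[OF v(3), of "num s"] that num by (simp add: e_def)
    then have "(\<Oplus>\<^bsub>V\<^esub>s\<in>S. c v s \<odot>\<^bsub>V\<^esub> s) = (\<Oplus>\<^bsub>V\<^esub>s\<in>S. c w s \<odot>\<^bsub>V\<^esub> s)"
      using cK[OF v(2)] S(2) by (intro V.M.finsum_congI V.smult_closed) auto
    then show "v = w" using c[OF v(1)] c[OF v(2)] by simp
  qed
  then show ?thesis by blast
qed

text \<open>A pairing function interleaves a sequence of sequences into one sequence. Applied twice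
  it flattens matrices, applied once it flattens tuples over \<open>A\<close>.\<close>

lemma sequence_inj:
  fixes e :: "'v \<Rightarrow> nat \<Rightarrow> 'k"
  assumes "inj_on e C"
  shows "inj_on (\<lambda>X i. e (X (fst (prod_decode i))) (snd (prod_decode i))) {X. \<forall>p :: nat. X p \<in> C}"
proof (rule inj_onI)
  fix X Y assume *: "X \<in> {X. \<forall>p. X p \<in> C}" "Y \<in> {X. \<forall>p. X p \<in> C}"
    and eq: "(\<lambda>i. e (X (fst (prod_decode i))) (snd (prod_decode i))) =
      (\<lambda>i. e (Y (fst (prod_decode i))) (snd (prod_decode i)))"
  show "X = Y"
  proof
    fix p
    have "e (X p) = e (Y p)"
    proof
      fix q show "e (X p) q = e (Y p) q" using fun_cong[OF eq, of "prod_encode (p, q)"] by simp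
    qed
    then show "X p = Y p" using * assms by (auto simp: inj_on_def)
  qed
qed

lemma (in graded_bimod) bar_inj:
  fixes e :: "'m \<Rightarrow> nat \<Rightarrow> 'l"
  assumes "inj_on e (carrier M)"
  shows "\<exists>e' :: (nat \<Rightarrow> nat \<Rightarrow> 'm) \<Rightarrow> nat \<Rightarrow> 'l. inj_on e' (carrier barM)"
proof -
  note sequence_inj[OF sequence_inj[OF assms]]
  moreover have "carrier barM \<subseteq> {X. \<forall>p. X p \<in> {X. \<forall>p. X p \<in> carrier M}}" using entries_M by auto
  ultimately show ?thesis using inj_on_subset by blast
qed

text \<open>The splitting embeds \<open>M\<close> into a finite power of the finite-dimensional
  algebra \<open>A\<close>; finite generation of \<open>M\<close> is encoded in its
  projectivity.\<close>

lemma (in graded_bimod) left_projective_inj: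
  assumes "graded_left_projective K A gA M gM"
  shows "\<exists>e :: 'm \<Rightarrow> nat \<Rightarrow> 'k. inj_on e (carrier M)"
proof -
  from assms obtain m s \<iota> \<pi>
    where "\<iota> \<in> graded_bihom A K (as_left M) gM (copies m (as_left (regular A)))
        (copies_grade m s (as_left (regular A)) gA)"
      and \<pi>: "\<forall>x\<in>carrier (as_left M). \<pi> (\<iota> x) = x"
    unfolding graded_left_projective_def graded_summand_of_copies_def by blast
  then have \<iota>: "\<iota> \<in> bihom A K (as_left M) (copies m (as_left (regular A)))"
    by (simp add: graded_bihom_def)
  obtain e :: "'a \<Rightarrow> nat \<Rightarrow> 'k" where e: "inj_on e (carrier A)"
    using fin_dim_inj[OF module_A A.fin_dim] by blast
  \<comment> \<open>Beyond \<open>m\<close> the tuples are \<open>undefined\<close>; zero is put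
    there so that all members of the sequence lie in \<open>A\<close>.\<close>
  define \<iota>' where "\<iota>' x p = (if p < m then \<iota> x p else \<zero>\<^bsub>A\<^esub>)" for x p
  have \<iota>c: "\<iota> x \<in> {..<m} \<rightarrow>\<^sub>E carrier A" if "x \<in> carrier M" for x
    using bihom_closed[OF \<iota>] that by simp
  have "inj_on \<iota>' (carrier M)"
  proof (rule inj_onI)
    fix x y assume xy: "x \<in> carrier M" "y \<in> carrier M" "\<iota>' x = \<iota>' y"
    have "\<iota> x = \<iota> y"
    proof (rule PiE_ext[OF \<iota>c[OF xy(1)] \<iota>c[OF xy(2)]])
      fix p assume "p \<in> {..<m}"
      then show "\<iota> x p = \<iota> y p" using fun_cong[OF xy(3), of p] by (simp add: \<iota>'_def)
    qed
    then show "x = y" using \<pi> xy by (metis as_left_simps(1))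
  qed
  moreover have "\<iota>' ` carrier M \<subseteq> {X. \<forall>p. X p \<in> carrier A}"
    using \<iota>c by (auto simp: \<iota>'_def PiE_iff)
  ultimately show ?thesis
    using comp_inj_on[OF _ inj_on_subset[OF sequence_inj[OF e]]] by blast
qed


section \<open>The stable equivalence\<close>

text \<open>Stated for one composite, so that it applies to \<open>M\<close>, \<open>N\<close> and,
  with the roles exchanged, to \<open>N\<close>, \<open>M\<close>. The chain of isomorphisms leads
  from the tensor product to triangular matrices over the direct sum, then to a direct sum of
  triangular matrices, and finally into coordinates.\<close>

lemma bar_tensor_dsum:
  fixes P :: "('k, 'a, 'a, nat \<Rightarrow> 'k) bimodule"
  assumes "graded_bimod K n A gA B gB M gM" "graded_bimod K n B gB A gA N gN"
    and "graded_right_projective K B gB M gM"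
    and P: "graded_projective_bimodule K A gA A gA P gP"
    and f: "f \<in> graded_biiso A A (tensor B M N) (tensor_grade B M gM N gN)
      (dsum (regular A) P) (dsum_grade gA gP)"
  shows "\<exists>P' :: ('k, nat \<Rightarrow> nat \<Rightarrow> 'a, nat \<Rightarrow> nat \<Rightarrow> 'a, nat \<Rightarrow> 'k) bimodule.
    projective_bimodule K (beilinson_green n A gA) (beilinson_green n A gA) P' \<and>
    biiso (beilinson_green n A gA) (beilinson_green n A gA)
      (tensor (beilinson_green n B gB) (bg_bimodule n M gM) (bg_bimodule n N gN))
      (dsum (regular (beilinson_green n A gA)) P') \<noteq> {}"
proof -
  interpret L: graded_bimod K n A gA B gB M gM by fact
  interpret R: graded_bimod K n B gB A gA N gN by fact
  interpret reg: graded_bimod K n A gA A gA "regular A" gA by (rule graded_bimod_regular[OF L.gr_alg_A])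
  interpret P: graded_bimod K n A gA A gA P gP
    using P L.gr_alg_A by (intro graded_bimodI) (auto simp: graded_projective_bimodule_def)
  interpret Y: graded_bimod K n A gA A gA "dsum (regular A) P" "dsum_grade gA gP"
    by (rule graded_bimod_dsum[OF reg.graded_bimod_axioms P.graded_bimod_axioms])
  interpret graded_tensor K n A gA B gB A gA M gM N gN "dsum (regular A) P" "dsum_grade gA gP" f
    using f by unfold_locales
  obtain h1 where h1: "h1 \<in> biiso L.barA L.barA (tensor L.barB L.barM R.barM) Y.barM"
    using bar_tensor_biiso[OF assms(3)] by blast
  \<comment> \<open>Elements of \<open>P\<close> are coordinate sequences already, so the identity
    serves as the injection for the entries and just the matrix has to be flattened.\<close>
  obtain e :: "(nat \<Rightarrow> nat \<Rightarrow> nat \<Rightarrow> 'k) \<Rightarrow> nat \<Rightarrow> 'k" where e: "inj_on e (carrier P.barM)"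
    using P.bar_inj[of "\<lambda>x. x"] by auto
  let ?P = "transport e P.barM"
  have proj: "projective_bimodule K L.barA L.barA ?P"
    using P by (intro projective_bimodule_transport P.bimodule_bar e P.projective_bimodule_bar)
      (simp add: graded_projective_bimodule_def)
  note h2 = bar_dsum_biiso[OF reg.graded_bimod_axioms P.graded_bimod_axioms]
  have h3: "map_prod id e \<in> biiso L.barA L.barA (dsum reg.barM P.barM) (dsum reg.barM ?P)"
    by (rule dsum_biiso[OF transport_biiso[OF P.bimodule_bar e]])
  have "biiso L.barA L.barA (tensor L.barB L.barM R.barM) (dsum reg.barM ?P) \<noteq> {}"
    using biiso_comp[OF biiso_comp[OF h1 h2] h3] by blast
  then show ?thesis using proj unfolding regular_beilinson_green by blast
qed

theorem theorem5p1:
  fixes K :: "('k, 'x) ring_scheme" and n :: nat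
    and A :: "('k, 'a) module" and gA :: "nat \<Rightarrow> 'a set"
    and B :: "('k, 'b) module" and gB :: "nat \<Rightarrow> 'b set"
    and M :: "('k, 'a, 'b, 'm) bimodule" and gM :: "nat \<Rightarrow> 'm set"
    and N :: "('k, 'b, 'a, 'n) bimodule" and gN :: "nat \<Rightarrow> 'n set"
  assumes "field K"
    and "graded_algebra K n A gA"
    and "graded_algebra K n B gB"
    and "graded_bimodule K A gA B gB M gM" and "degree_le n M gM"
    and "graded_bimodule K B gB A gA N gN" and "degree_le n N gN"
    and "induce_graded_stable_equivalence K A gA B gB M gM N gN"
  shows "stable_equivalence_Morita_type K (beilinson_green n A gA) (beilinson_green n B gB)"
proof -
  interpret M: graded_bimod K n A gA B gB M gM by (rule graded_bimodI[OF assms(2,3,4)])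
  interpret N: graded_bimod K n B gB A gA N gN by (rule graded_bimodI[OF assms(3,2,6)])
  from assms(8) obtain P :: "('k, 'a, 'a, nat \<Rightarrow> 'k) bimodule" and gP
      and Q :: "('k, 'b, 'b, nat \<Rightarrow> 'k) bimodule" and gQ and f g where
    M: "graded_left_projective K A gA M gM" "graded_right_projective K B gB M gM" and
    N: "graded_left_projective K B gB N gN" "graded_right_projective K A gA N gN" and
    P: "graded_projective_bimodule K A gA A gA P gP"
      "f \<in> graded_biiso A A (tensor B M N) (tensor_grade B M gM N gN)
        (dsum (regular A) P) (dsum_grade gA gP)" and
    Q: "graded_projective_bimodule K B gB B gB Q gQ"
      "g \<in> graded_biiso B B (tensor A N M) (tensor_grade A N gN M gM)
        (dsum (regular B) Q) (dsum_grade gB gQ)"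
    unfolding induce_graded_stable_equivalence_def by blast
  \<comment> \<open>Left projectivity supplies the injections, embedding \<open>M\<close> in a power
    of \<open>A\<close> and \<open>N\<close> in a power of \<open>B\<close>.\<close>
  obtain u :: "(nat \<Rightarrow> nat \<Rightarrow> 'm) \<Rightarrow> nat \<Rightarrow> 'k" where u: "inj_on u (carrier M.barM)"
    using M.left_projective_inj[OF M(1)] M.bar_inj by metis
  obtain v :: "(nat \<Rightarrow> nat \<Rightarrow> 'n) \<Rightarrow> nat \<Rightarrow> 'k" where v: "inj_on v (carrier N.barM)"
    using N.left_projective_inj[OF N(1)] N.bar_inj by metis
  let ?U = "transport u M.barM" and ?V = "transport v N.barM"
  have U: "bimodule K M.barA M.barB ?U" by (rule bimodule_transport[OF M.bimodule_bar u])
  have V: "bimodule K M.barB M.barA ?V" by (rule bimodule_transport[OF N.bimodule_bar v])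
  have u': "inv_into (carrier M.barM) u \<in> biiso M.barA M.barB ?U M.barM"
    by (rule biiso_inv[OF M.biact_bar transport_biiso[OF M.bimodule_bar u]])
  have v': "inv_into (carrier N.barM) v \<in> biiso M.barB M.barA ?V N.barM"
    by (rule biiso_inv[OF N.biact_bar transport_biiso[OF N.bimodule_bar v]])
  \<comment> \<open>The witnesses are transported copies, so their tensor products are first
    compared with those of the matrix bimodules.\<close>
  have UV: "biiso M.barA M.barA (tensor M.barB ?U ?V) (tensor M.barB M.barM N.barM) \<noteq> {}"
    by (rule tensor_biiso[OF bimodule_tensor_biact[OF U V]
          bimodule_tensor_biact[OF M.bimodule_bar N.bimodule_bar] u' v'])
  have VU: "biiso M.barB M.barB (tensor M.barA ?V ?U) (tensor M.barA N.barM M.barM) \<noteq> {}"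
    by (rule tensor_biiso[OF bimodule_tensor_biact[OF V U]
          bimodule_tensor_biact[OF N.bimodule_bar M.bimodule_bar] v' u'])
  have "\<exists>P' :: ('k, nat \<Rightarrow> nat \<Rightarrow> 'a, nat \<Rightarrow> nat \<Rightarrow> 'a, nat \<Rightarrow> 'k) bimodule.
      projective_bimodule K M.barA M.barA P' \<and>
      biiso M.barA M.barA (tensor M.barB ?U ?V) (dsum (regular M.barA) P') \<noteq> {}"
    using bar_tensor_dsum[OF M.graded_bimod_axioms N.graded_bimod_axioms M(2) P] UV biiso_comp by blast
  \<comment> \<open>For this composite the left factor is \<open>N\<close>, so the kernel argument
    rests on \<open>N\<close> being projective as a right \<open>A\<close>-module.\<close>
  moreover have "\<exists>Q' :: ('k, nat \<Rightarrow> nat \<Rightarrow> 'b, nat \<Rightarrow> nat \<Rightarrow> 'b, nat \<Rightarrow> 'k) bimodule.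
      projective_bimodule K M.barB M.barB Q' \<and>
      biiso M.barB M.barB (tensor M.barA ?V ?U) (dsum (regular M.barB) Q') \<noteq> {}"
    using bar_tensor_dsum[OF N.graded_bimod_axioms M.graded_bimod_axioms N(2) Q] VU biiso_comp by blast
  moreover have "left_projective K M.barA ?U" "right_projective K M.barB ?U"
    using left_projective_transport[OF M.bimodule_bar u M.left_projective_bar[OF M(1)]]
      right_projective_transport[OF M.bimodule_bar u M.right_projective_bar[OF M(2)]] .
  moreover have "left_projective K M.barB ?V" "right_projective K M.barA ?V"
    using left_projective_transport[OF N.bimodule_bar v N.left_projective_bar[OF N(1)]]
      right_projective_transport[OF N.bimodule_bar v N.right_projective_bar[OF N(2)]] .
  ultimately have "induce_stable_equivalence K M.barA M.barB ?U ?V"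
    using U V by (simp add: induce_stable_equivalence_def)
  then show ?thesis
    using fd_algebra_beilinson_green[OF assms(2)] fd_algebra_beilinson_green[OF assms(3)]
    by (auto simp: stable_equivalence_Morita_type_def)
qed

end
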